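(* Let $n=2p$, $J_n=i\begin{pmatrix} I_p & 0 \\ 0 & -I_p \end{pmatrix}$, and let $Q=\begin{pmatrix} Q_{11} & Q_{12} \\ Q_{21} & Q_{22} \end{pmatrix}\in L^1_{\mathrm{loc}}(\mathbb{R}_+,\mathbb{C}^{n\times n})$ with $p\times p$ blocks satisfy $Q_{11}^\top=Q_{22}$, $Q_{12}^\top=Q_{12}$, $Q_{21}^\top=Q_{21}$ a.e. on $\mathbb{R}_+$. Let $j$ be the conjugation in $L^2(\mathbb{R}_+,\mathbb{C}^n)$ given by $(jf)(t)=\begin{pmatrix} 0 & I_p \\ I_p & 0 \end{pmatrix}\overline{f(t)}$. If $\widehat\rho(D^+_{\min}(Q))\ne\emptyset$, then: (i) The minimal operator $D^+_{\min}(Q)$ is $j$-symmetric and $\mathrm{Def}(D^+_{\min}(Q))=p$, i.e. for each $\lambda\in\widehat\rho(D^+_{\min}(Q))$ (or, equivalently, for each $\lambda\in\widehat\rho\{D^+_{\min}(Q),D^+_{\min}(Q^* )\}$) $$\dim\mathfrak{N}_\lambda(D^+_{\min}(Q^* ))=\dim\mathfrak{N}_{\overline\lambda}(D^+_{\min}(Q))=p.$$ (ii) There exists an operator $C\in\mathbf{B}(\mathbb{C}^n,\mathbb{C}^p)$ such that the equalities $$\widetilde A=D^+_{\max}(Q)\upharpoonright\mathrm{dom}\,\widetilde A,\qquad\mathrm{dom}\,\widetilde A=\{y\in\mathrm{dom}\,D^+_{\max}(Q): C\,y(0)=0\}$$ define a $j$-selfadjoint extension $\widetilde A$ of $D^+_{\min}(Q)$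 with $\rho(\widetilde A)\ne\emptyset$, and for each $\lambda\in\rho(\widetilde A)$ there exists a unique operator-valued solution $\Psi_+(\cdot,\lambda)\in L^2(\mathbb{R}_+,\mathbf{B}(\mathbb{C}^p,\mathbb{C}^n))$ (the Weyl solution) of $J_ny'+Q(x)y=\lambda y$ satisfying $C\,\Psi_+(0,\lambda)=I_p$. Moreover, the solution $\Psi_+(\cdot,\lambda)$ is holomorphic in $\lambda\in\rho(\widetilde A)$.
   Context: $\mathbb{R}_+=[0,\infty)$ and $D(Q)y=J_ny'+Q(x)y$. The maximal operator $D^+_{\max}(Q)$ in $L^2(\mathbb{R}_+,\mathbb{C}^n)$ has domain $\{y\in L^2: y\in AC_{\mathrm{loc}}(\mathbb{R}_+,\mathbb{C}^n),\ D(Q)y\in L^2\}$ and acts as $y\mapsto D(Q)y$; the minimal operator $D^+_{\min}(Q)$ is the closure of its restriction to those $y\in\mathrm{dom}\,D^+_{\max}(Q)$ with compact support and $y(0)=0$; $(D^+_{\min}(Q))^*=D^+_{\max}(Q^* )$. $\mathbf{B}(\mathbb{C}^k,\mathbb{C}^l)$ is the set of linear operators $\mathbb{C}^k\to\mathbb{C}^l$. For a conjugation $j$ (antilinear, $j^2=I$, $(ju,v)=(jv,u)$), a densely defined $A$ is $j$-symmetric if $A\subseteq jA^*j$ and $j$-selfadjoint if $A=jA^*j$. $\mathfrak{N}_\lambda(T)=\ker(T^*-\lambda)$. $\widehat\rho(T)$ is the set of $\lambda$ such that $\|Tf-\lambda f\|\ge\varepsilon\|f\|$ for all $f\in\mathrm{dom}\,T$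 with some $\varepsilon>0$; $\widehat\rho\{A,B\}=\{\lambda:\lambda\in\widehat\rho(A),\ \overline\lambda\in\widehat\rho(B)\}$. For a $j$-symmetric $A$ with $\widehat\rho(A)\neq\emptyset$, $\mathrm{Def}(A)$ is the constant value of $\dim\mathfrak{N}_{\overline\lambda}(A)$, $\lambda\in\widehat\rho(A)$. $\rho$ denotes the resolvent set. *)

theory Defs
  imports "HOL-Analysis.Analysis"
begin

section \<open>The Hilbert space of square integrable functions on the half-line\<close>

abbreviation halfline :: "real measure" where
  "halfline \<equiv> lebesgue_on {0..}"

definition square_integrable :: "(real \<Rightarrow> 'b::euclidean_space) \<Rightarrow> bool" where
  "square_integrable f \<longleftrightarrow>
     f \<in> borel_measurable halfline \<and> integrable halfline (\<lambda>t. (norm (f t))\<^sup>2)"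

lemma square_integrable_measurable [measurable_dest]:
  "square_integrable f \<Longrightarrow> f \<in> borel_measurable halfline"
  by (simp add: square_integrable_def)

lemma square_integrable_0: "square_integrable (\<lambda>t. 0)"
  by (simp add: square_integrable_def)

lemma square_integrable_add:
  assumes "square_integrable f" "square_integrable g"
  shows "square_integrable (\<lambda>t. f t + g t)"
  unfolding square_integrable_def
proof
  note [measurable] = assms[THEN square_integrable_measurable]
  show "(\<lambda>t. f t + g t) \<in> borel_measurable halfline" by measurable
  have "integrable halfline (\<lambda>t. 2 * (norm (f t))\<^sup>2 + 2 * (norm (g t))\<^sup>2)"
    using assms by (auto simp: square_integrable_def)
  then show "integrable halfline (\<lambda>t. (norm (f t + g t))\<^sup>2)"
  proof (rule Bochner_Integration.integrable_bound)
    show "AE t in halfline. norm ((norm (f t + g t))\<^sup>2)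
            \<le> norm (2 * (norm (f t))\<^sup>2 + 2 * (norm (g t))\<^sup>2)"
    proof (rule AE_I2)
      fix t
      have "(norm (f t + g t))\<^sup>2 \<le> (norm (f t) + norm (g t))\<^sup>2"
        by (intro power_mono norm_triangle_ineq) auto
      also have "\<dots> \<le> 2 * (norm (f t))\<^sup>2 + 2 * (norm (g t))\<^sup>2"
        using sum_squares_bound[of "norm (f t)" "norm (g t)"] by (simp add: power2_sum)
      finally show "norm ((norm (f t + g t))\<^sup>2)
            \<le> norm (2 * (norm (f t))\<^sup>2 + 2 * (norm (g t))\<^sup>2)" by simp
    qed
  qed measurable
qed

lemma square_integrable_bounded_linear:
  assumes "bounded_linear h" "square_integrable f"
  shows "square_integrable (\<lambda>t. h (f t))"
  unfolding square_integrable_def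
proof
  obtain K where K: "\<And>x. norm (h x) \<le> norm x * K"
    using bounded_linear.bounded[OF assms(1)] by blast
  note [measurable] = assms(2)[THEN square_integrable_measurable]
  have [measurable]: "h \<in> borel_measurable borel"
    by (intro borel_measurable_continuous_onI linear_continuous_on assms)
  show "(\<lambda>t. h (f t)) \<in> borel_measurable halfline" by measurable
  have "integrable halfline (\<lambda>t. K\<^sup>2 * (norm (f t))\<^sup>2)"
    using assms by (auto simp: square_integrable_def)
  then show "integrable halfline (\<lambda>t. (norm (h (f t)))\<^sup>2)"
  proof (rule Bochner_Integration.integrable_bound)
    show "AE t in halfline. norm ((norm (h (f t)))\<^sup>2) \<le> norm (K\<^sup>2 * (norm (f t))\<^sup>2)"
    proof (rule AE_I2)
      fix t
      have "(norm (h (f t)))\<^sup>2 \<le> (norm (f t) * K)\<^sup>2"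
        by (intro power_mono K) auto
      then show "norm ((norm (h (f t)))\<^sup>2) \<le> norm (K\<^sup>2 * (norm (f t))\<^sup>2)"
        by (simp add: power_mult_distrib mult.commute)
    qed
  qed measurable
qed

lemma integrable_square_integrable_inner:
  assumes "square_integrable f" "square_integrable g"
  shows "integrable halfline (\<lambda>t. f t \<bullet> g t)"
proof -
  note [measurable] = assms[THEN square_integrable_measurable]
  have "integrable halfline (\<lambda>t. (norm (f t))\<^sup>2 + (norm (g t))\<^sup>2)"
    using assms by (auto simp: square_integrable_def)
  then show ?thesis
  proof (rule Bochner_Integration.integrable_bound)
    show "AE t in halfline. norm (f t \<bullet> g t) \<le> norm ((norm (f t))\<^sup>2 + (norm (g t))\<^sup>2)"
    proof (rule AE_I2)
      fix t
      have "\<bar>f t \<bullet> g t\<bar> \<le> norm (f t) * norm (g t)" by (rule Cauchy_Schwarz_ineq2)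
      moreover have "0 \<le> norm (f t) * norm (g t)" by simp
      ultimately have "\<bar>f t \<bullet> g t\<bar> \<le> 2 * norm (f t) * norm (g t)"
        by linarith
      also have "\<dots> \<le> (norm (f t))\<^sup>2 + (norm (g t))\<^sup>2" by (rule sum_squares_bound)
      finally show "norm (f t \<bullet> g t) \<le> norm ((norm (f t))\<^sup>2 + (norm (g t))\<^sup>2)" by simp
    qed
  qed measurable
qed

definition l2_eq :: "(real \<Rightarrow> 'b::euclidean_space) \<Rightarrow> (real \<Rightarrow> 'b) \<Rightarrow> bool" where
  "l2_eq f g \<longleftrightarrow>
     square_integrable f \<and> square_integrable g \<and> (AE t in halfline. f t = g t)"

lemma l2_eq_bounded_linear:
  "bounded_linear h \<Longrightarrow> l2_eq f g \<Longrightarrow> l2_eq (\<lambda>t. h (f t)) (\<lambda>t. h (g t))"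
  unfolding l2_eq_def by (auto intro: square_integrable_bounded_linear elim: AE_mp)

quotient_type (overloaded) 'b l2 =
  "real \<Rightarrow> 'b::euclidean_space" / partial: l2_eq
  morphisms rep_l2 l2_class
proof (rule part_equivpI)
  show "\<exists>f::real \<Rightarrow> 'b. l2_eq f f"
    by (rule exI[of _ "\<lambda>t. 0"]) (simp add: l2_eq_def square_integrable_0)
  show "symp (l2_eq :: (real \<Rightarrow> 'b) \<Rightarrow> _)"
    by (rule sympI) (auto simp: l2_eq_def elim: AE_mp)
  show "transp (l2_eq :: (real \<Rightarrow> 'b) \<Rightarrow> _)"
  proof (rule transpI)
    fix f g h :: "real \<Rightarrow> 'b"
    assume "l2_eq f g" "l2_eq g h"
    then show "l2_eq f h"
      unfolding l2_eq_def by (auto elim: AE_mp)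
  qed
qed

instantiation l2 :: (euclidean_space) real_inner
begin

lift_definition zero_l2 :: "'a l2" is "\<lambda>t. 0"
  by (simp add: l2_eq_def square_integrable_0)

lift_definition plus_l2 :: "'a l2 \<Rightarrow> 'a l2 \<Rightarrow> 'a l2" is "\<lambda>f g t. f t + g t"
  unfolding l2_eq_def by (auto intro: square_integrable_add elim: AE_mp)

lift_definition uminus_l2 :: "'a l2 \<Rightarrow> 'a l2" is "\<lambda>f t. - f t"
  by (rule l2_eq_bounded_linear[OF bounded_linear_minus[OF bounded_linear_ident]])

definition minus_l2 :: "'a l2 \<Rightarrow> 'a l2 \<Rightarrow> 'a l2" where
  "minus_l2 f g = f + - g"

lift_definition scaleR_l2 :: "real \<Rightarrow> 'a l2 \<Rightarrow> 'a l2" is "\<lambda>r f t. r *\<^sub>R f t"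
  by (rule l2_eq_bounded_linear[OF bounded_linear_scaleR_right])

lift_definition inner_l2 :: "'a l2 \<Rightarrow> 'a l2 \<Rightarrow> real"
  is "\<lambda>f g. integral\<^sup>L halfline (\<lambda>t. f t \<bullet> g t)"
  unfolding l2_eq_def
  by (intro integral_cong_AE borel_measurable_inner)
     (auto elim: AE_mp dest: square_integrable_measurable)

definition norm_l2 :: "'a l2 \<Rightarrow> real" where
  "norm_l2 f = sqrt (f \<bullet> f)"

definition sgn_l2 :: "'a l2 \<Rightarrow> 'a l2" where
  "sgn_l2 f = scaleR (inverse (norm f)) f"

definition dist_l2 :: "'a l2 \<Rightarrow> 'a l2 \<Rightarrow> real" where
  "dist_l2 f g = norm (f - g)"

definition uniformity_l2 :: "('a l2 \<times> 'a l2) filter" where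
  "uniformity_l2 = (INF e\<in>{0<..}. principal {(x, y). dist x y < e})"

definition open_l2 :: "'a l2 set \<Rightarrow> bool" where
  "open_l2 U = (\<forall>x\<in>U. eventually (\<lambda>(x', y). x' = x \<longrightarrow> y \<in> U) uniformity)"

instance
proof
  fix f g h :: "'a l2" and r s :: real
  show "f + g + h = f + (g + h)"
    by transfer (auto simp: l2_eq_def add.assoc intro!: square_integrable_add)
  show "f + g = g + f"
    by transfer (auto simp: l2_eq_def add.commute intro!: square_integrable_add)
  show "0 + f = f"
    by transfer (auto simp: l2_eq_def)
  show "- f + f = 0"
    by transfer (auto simp: l2_eq_def square_integrable_0)
  show "f - g = f + - g"
    by (rule minus_l2_def)
  show "r *\<^sub>R (f + g) = r *\<^sub>R f + r *\<^sub>R g"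
    by transfer (auto simp: l2_eq_def scaleR_add_right
        intro!: square_integrable_add square_integrable_bounded_linear[OF bounded_linear_scaleR_right])
  show "(r + s) *\<^sub>R f = r *\<^sub>R f + s *\<^sub>R f"
    by transfer (auto simp: l2_eq_def scaleR_add_left
        intro!: square_integrable_add square_integrable_bounded_linear[OF bounded_linear_scaleR_right])
  show "r *\<^sub>R s *\<^sub>R f = (r * s) *\<^sub>R f"
    by transfer (auto simp: l2_eq_def
        intro!: square_integrable_bounded_linear[OF bounded_linear_scaleR_right])
  show "1 *\<^sub>R f = f"
    by transfer (auto simp: l2_eq_def)
  show "f \<bullet> g = g \<bullet> f"
    by transfer (simp add: inner_commute)
  show "(f + g) \<bullet> h = f \<bullet> h + g \<bullet> h"
    by transfer (simp add: l2_eq_def inner_add_left integrable_square_integrable_inner)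
  show "r *\<^sub>R f \<bullet> g = r * (f \<bullet> g)"
    by transfer simp
  show "0 \<le> f \<bullet> f"
    by transfer simp
  show "f \<bullet> f = 0 \<longleftrightarrow> f = 0"
  proof transfer
    fix f :: "real \<Rightarrow> 'a" assume "l2_eq f f"
    then have f: "square_integrable f" by (simp add: l2_eq_def)
    have "integral\<^sup>L halfline (\<lambda>t. f t \<bullet> f t) = 0 \<longleftrightarrow> (AE t in halfline. f t \<bullet> f t = 0)"
      by (rule integral_nonneg_eq_0_iff_AE)
         (auto intro: integrable_square_integrable_inner f)
    then show "integral\<^sup>L halfline (\<lambda>t. f t \<bullet> f t) = 0 \<longleftrightarrow> l2_eq f (\<lambda>t. 0)"
      using f by (simp add: l2_eq_def square_integrable_0)
  qed
qed (simp_all add: norm_l2_def sgn_l2_def dist_l2_def uniformity_l2_def open_l2_def)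

end

lemma bounded_linear_vec_scale: "bounded_linear (\<lambda>v::complex^'n. c *s v)"
  by (rule linear_conv_bounded_linear[THEN iffD1], rule linearI)
     (auto simp: vec_eq_iff algebra_simps)

lift_definition cscale :: "complex \<Rightarrow> (complex^'n) l2 \<Rightarrow> (complex^'n) l2"
  is "\<lambda>c f t. c *s f t"
  by (rule l2_eq_bounded_linear[OF bounded_linear_vec_scale])

text \<open>The inner product of \<open>real_inner\<close> is the real part of the Hermitian product
  \<open>cinner\<close>; the two give the same norm.\<close>

lift_definition cinner :: "(complex^'n) l2 \<Rightarrow> (complex^'n) l2 \<Rightarrow> complex"
  is "\<lambda>f g. integral\<^sup>L halfline (\<lambda>t. \<Sum>k\<in>UNIV. f t $ k * cnj (g t $ k))"
proof -
  fix f f' g g' :: "real \<Rightarrow> complex^'n"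
  assume *: "l2_eq f f'" "l2_eq g g'"
  have m: "(\<lambda>t. \<Sum>k\<in>UNIV. u t $ k * cnj (v t $ k)) \<in> borel_measurable halfline"
    if "square_integrable u" "square_integrable v" for u v :: "real \<Rightarrow> complex^'n"
  proof -
    note [measurable] = that[THEN square_integrable_measurable]
    have [measurable]: "(\<lambda>z. z $ k) \<in> borel_measurable borel" for k :: 'n
      by (intro borel_measurable_continuous_onI continuous_intros)
    have [measurable]: "cnj \<in> borel_measurable borel"
      by (intro borel_measurable_continuous_onI continuous_intros)
    show ?thesis by measurable
  qed
  show "integral\<^sup>L halfline (\<lambda>t. \<Sum>k\<in>UNIV. f t $ k * cnj (g t $ k)) =
        integral\<^sup>L halfline (\<lambda>t. \<Sum>k\<in>UNIV. f' t $ k * cnj (g' t $ k))"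
    using * unfolding l2_eq_def by (intro integral_cong_AE m) (auto elim: AE_mp)
qed

global_interpretation l2: vector_space "cscale :: complex \<Rightarrow> (complex^'n) l2 \<Rightarrow> _"
proof
  fix a b :: complex and f g :: "(complex^'n) l2"
  show "cscale a (f + g) = cscale a f + cscale a g"
    by transfer (auto simp: l2_eq_def vec.scale_right_distrib
        intro!: square_integrable_add square_integrable_bounded_linear[OF bounded_linear_vec_scale])
  show "cscale (a + b) f = cscale a f + cscale b f"
    by transfer (auto simp: l2_eq_def vec.scale_left_distrib
        intro!: square_integrable_add square_integrable_bounded_linear[OF bounded_linear_vec_scale])
  show "cscale a (cscale b f) = cscale (a * b) f"
    by transfer (auto simp: l2_eq_def
        intro!: square_integrable_bounded_linear[OF bounded_linear_vec_scale])
  show "cscale 1 f = f"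
    by transfer (auto simp: l2_eq_def)
qed


section \<open>Unbounded operators\<close>

text \<open>An operator is identified with its graph: \<open>(f, g) \<in> T\<close> means
  \<open>f \<in> dom T\<close> and \<open>T f = g\<close>. Thus \<open>A \<subseteq> B\<close> says that \<open>B\<close> extends \<open>A\<close>,
  \<open>Domain T\<close> is the domain, and the closure of an operator is the closure of its graph.\<close>

type_synonym 'n l2_op = "((complex^'n) l2 \<times> (complex^'n) l2) set"

definition linear_op :: "('n::finite) l2_op \<Rightarrow> bool" where
  "linear_op T \<longleftrightarrow> single_valued T \<and> (0, 0) \<in> T \<and>
     (\<forall>f g f' g'. (f, g) \<in> T \<longrightarrow> (f', g') \<in> T \<longrightarrow> (f + f', g + g') \<in> T) \<and>
     (\<forall>c f g. (f, g) \<in> T \<longrightarrow> (cscale c f, cscale c g) \<in> T)"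

definition densely_defined :: "('n::finite) l2_op \<Rightarrow> bool" where
  "densely_defined T \<longleftrightarrow> closure (Domain T) = UNIV"

definition adj :: "('n::finite) l2_op \<Rightarrow> ('n::finite) l2_op" where
  "adj T = {(u, v). \<forall>(f, g)\<in>T. cinner g u = cinner f v}"

definition conjugation :: "((complex^'n) l2 \<Rightarrow> (complex^'n) l2) \<Rightarrow> bool" where
  "conjugation j \<longleftrightarrow>
     (\<forall>u v. j (u + v) = j u + j v) \<and> (\<forall>c u. j (cscale c u) = cscale (cnj c) (j u)) \<and>
     (\<forall>u. j (j u) = u) \<and> (\<forall>u v. cinner (j u) v = cinner (j v) u)"

definition conj_op :: "((complex^'n) l2 \<Rightarrow> (complex^'n) l2) \<Rightarrow> ('n::finite) l2_op \<Rightarrow> ('n::finite) l2_op" where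
  "conj_op j T = {(f, j g) | f g. (j f, g) \<in> T}"

definition j_symmetric :: "((complex^'n) l2 \<Rightarrow> (complex^'n) l2) \<Rightarrow> ('n::finite) l2_op \<Rightarrow> bool" where
  "j_symmetric j A \<longleftrightarrow> linear_op A \<and> densely_defined A \<and> A \<subseteq> conj_op j (adj A)"

definition j_selfadjoint :: "((complex^'n) l2 \<Rightarrow> (complex^'n) l2) \<Rightarrow> ('n::finite) l2_op \<Rightarrow> bool" where
  "j_selfadjoint j A \<longleftrightarrow> linear_op A \<and> densely_defined A \<and> A = conj_op j (adj A)"

definition defect_space :: "complex \<Rightarrow> ('n::finite) l2_op \<Rightarrow> (complex^'n) l2 set" where
  "defect_space z T = {f. (f, cscale z f) \<in> adj T}"

definition rho_hat :: "('n::finite) l2_op \<Rightarrow> complex set" where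
  "rho_hat T = {z. \<exists>\<epsilon>>0. \<forall>(f, g)\<in>T. norm (g - cscale z f) \<ge> \<epsilon> * norm f}"

definition rho_hat_pair :: "('n::finite) l2_op \<Rightarrow> ('n::finite) l2_op \<Rightarrow> complex set" where
  "rho_hat_pair A B = {z. z \<in> rho_hat A \<and> cnj z \<in> rho_hat B}"

text \<open>\<open>l2.dim\<close> is the complex dimension, but it is \<open>0\<close> on infinite-dimensional subspaces:
  only the assertion that it equals some \<open>d > 0\<close> has the usual meaning.\<close>

definition Def_number :: "('n::finite) l2_op \<Rightarrow> nat" where
  "Def_number A = (THE d. \<forall>z\<in>rho_hat A. l2.dim (defect_space (cnj z) A) = d)"

text \<open>The relation on the left is the graph of \<open>(T - z)\<^sup>-\<^sup>1\<close>, the one on the right the graph of an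
  everywhere defined bounded operator \<open>R\<close>.\<close>

definition resolvent_set :: "('n::finite) l2_op \<Rightarrow> complex set" where
  "resolvent_set T = {z. \<exists>R. bounded_linear R \<and>
     {(g - cscale z f, f) | f g. (f, g) \<in> T} = {(h, R h) | h. True}}"

definition l2_holomorphic_on :: "(complex \<Rightarrow> (complex^'n) l2) \<Rightarrow> complex set \<Rightarrow> bool" where
  "l2_holomorphic_on F S \<longleftrightarrow>
     (\<forall>z\<in>S. \<exists>D. ((\<lambda>w. cscale (inverse (w - z)) (F w - F z)) \<longlongrightarrow> D) (at z within S))"


section \<open>The Dirac operator\<close>

text \<open>\<open>\<complex>\<^sup>n\<close> with \<open>n = 2p\<close> is rendered as \<open>complex^('p + 'p)\<close>, where \<open>p = CARD('p)\<close>.\<close>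

definition block_mat ::
  "complex^'p^'p \<Rightarrow> complex^'p^'p \<Rightarrow> complex^'p^'p \<Rightarrow> complex^'p^'p \<Rightarrow> complex^('p::finite + 'p)^('p + 'p)"
where
  "block_mat A B C D = (\<chi> i k.
     case i of
       Inl a \<Rightarrow> (case k of Inl b \<Rightarrow> A $ a $ b | Inr b \<Rightarrow> B $ a $ b)
     | Inr a \<Rightarrow> (case k of Inl b \<Rightarrow> C $ a $ b | Inr b \<Rightarrow> D $ a $ b))"

definition J_mat :: "complex^('p::finite + 'p)^('p + 'p)" where
  "J_mat = block_mat (mat \<i>) 0 0 (mat (- \<i>))"

definition adj_mat :: "complex^'m^'n \<Rightarrow> complex^'n^'m" where
  "adj_mat A = (\<chi> i k. cnj (A $ k $ i))"

definition locally_integrable :: "(real \<Rightarrow> 'b::euclidean_space) \<Rightarrow> bool" where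
  "locally_integrable f \<longleftrightarrow> (\<forall>b\<ge>0. f absolutely_integrable_on {0..b})"

definition AC_on :: "real \<Rightarrow> real \<Rightarrow> (real \<Rightarrow> 'b::real_normed_vector) \<Rightarrow> bool" where
  "AC_on a b f \<longleftrightarrow> (\<forall>\<epsilon>>0. \<exists>\<delta>>0. \<forall>\<D>.
     \<D> division_of \<Union>\<D> \<longrightarrow> \<Union>\<D> \<subseteq> {a..b} \<longrightarrow> (\<Sum>K\<in>\<D>. Sup K - Inf K) < \<delta> \<longrightarrow>
     (\<Sum>K\<in>\<D>. norm (f (Sup K) - f (Inf K))) < \<epsilon>)"

definition AC_loc :: "(real \<Rightarrow> 'b::real_normed_vector) \<Rightarrow> bool" where
  "AC_loc f \<longleftrightarrow> (\<forall>b\<ge>0. AC_on 0 b f)"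

text \<open>For \<open>y \<in> AC_loc\<close> the derivative exists almost everywhere; the value of
  \<open>vector_derivative\<close> on the exceptional null set is irrelevant.\<close>

definition diff_expr ::
  "(real \<Rightarrow> complex^('p::finite + 'p)^('p + 'p)) \<Rightarrow>
   (real \<Rightarrow> complex^('p + 'p)) \<Rightarrow> real \<Rightarrow> complex^('p + 'p)"
where
  "diff_expr Q y = (\<lambda>t. J_mat *v vector_derivative y (at t) + Q t *v y t)"

definition max_domain ::
  "(real \<Rightarrow> complex^('p::finite + 'p)^('p + 'p)) \<Rightarrow> (real \<Rightarrow> complex^('p + 'p)) set"
where
  "max_domain Q = {y. square_integrable y \<and> AC_loc y \<and> square_integrable (diff_expr Q y)}"

definition D_max :: "(real \<Rightarrow> complex^('p::finite + 'p)^('p + 'p)) \<Rightarrow> ('p + 'p) l2_op" where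
  "D_max Q = {(l2_class y, l2_class (diff_expr Q y)) | y. y \<in> max_domain Q}"

definition D_min :: "(real \<Rightarrow> complex^('p::finite + 'p)^('p + 'p)) \<Rightarrow> ('p + 'p) l2_op" where
  "D_min Q = closure {(l2_class y, l2_class (diff_expr Q y)) | y.
     y \<in> max_domain Q \<and> (\<exists>b. \<forall>t>b. y t = 0) \<and> y 0 = 0}"

definition D_bc ::
  "(real \<Rightarrow> complex^('p::finite + 'p)^('p + 'p)) \<Rightarrow> complex^('p + 'p)^'p \<Rightarrow> ('p + 'p) l2_op"
where
  "D_bc Q C = {(l2_class y, l2_class (diff_expr Q y)) | y. y \<in> max_domain Q \<and> C *v y 0 = 0}"

definition swap_mat :: "complex^('p::finite + 'p)^('p + 'p)" where
  "swap_mat = block_mat 0 (mat 1) (mat 1) 0"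

lemma sum_UNIV_Plus:
  "(\<Sum>k\<in>UNIV. F k) = (\<Sum>a\<in>UNIV. F (Inl a)) + (\<Sum>a\<in>(UNIV::'q set). F (Inr a))"
  for F :: "'p::finite + 'q::finite \<Rightarrow> complex"
  by (subst UNIV_Plus_UNIV[symmetric], subst Plus_def, subst sum.union_disjoint)
     (auto simp: sum.reindex)

lemma swap_mat_mult:
  "(swap_mat *v w) $ Inl a = w $ Inr a" "(swap_mat *v w) $ Inr a = w $ Inl a"
  by (simp_all add: swap_mat_def block_mat_def matrix_vector_mult_def sum_UNIV_Plus mat_def
      if_distrib[of "\<lambda>x. x * _"] cong: if_cong)

lemma vec_Plus_eq_iff:
  fixes v w :: "complex^('p::finite + 'p)"
  shows "v = w \<longleftrightarrow> (\<forall>a. v $ Inl a = w $ Inl a \<and> v $ Inr a = w $ Inr a)"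
  unfolding vec_eq_iff by (metis sum.exhaust_sel)

lemma bounded_linear_swap_cnj:
  "bounded_linear (\<lambda>v::complex^('p::finite + 'p). swap_mat *v (\<chi> k. cnj (v $ k)))"
  by (rule linear_conv_bounded_linear[THEN iffD1], rule linearI)
     (auto simp: vec_Plus_eq_iff swap_mat_mult)

lift_definition swap_conj :: "(complex^('p::finite + 'p)) l2 \<Rightarrow> (complex^('p + 'p)) l2"
  is "\<lambda>f t. swap_mat *v (\<chi> k. cnj (f t $ k))"
  by (rule l2_eq_bounded_linear[OF bounded_linear_swap_cnj])

lemma conjugation_swap_conj: "conjugation (swap_conj :: (complex^('p::finite + 'p)) l2 \<Rightarrow> _)"
  unfolding conjugation_def
proof (intro conjI allI)
  note sq = square_integrable_bounded_linear[OF bounded_linear_swap_cnj]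
    square_integrable_bounded_linear[OF bounded_linear_vec_scale] square_integrable_add
  fix u v :: "(complex^('p + 'p)) l2" and c
  show "swap_conj (u + v) = swap_conj u + swap_conj v"
  proof transfer
    fix u v :: "real \<Rightarrow> complex^('p + 'p)"
    assume "l2_eq u u" "l2_eq v v"
    then have "square_integrable u" "square_integrable v" by (simp_all add: l2_eq_def)
    from sq(1)[OF sq(3)[OF this]] sq(3)[OF sq(1)[OF this(1)] sq(1)[OF this(2)]]
    show "l2_eq (\<lambda>t. swap_mat *v (\<chi> k. cnj ((u t + v t) $ k)))
        (\<lambda>t. swap_mat *v (\<chi> k. cnj (u t $ k)) + swap_mat *v (\<chi> k. cnj (v t $ k)))"
      unfolding l2_eq_def by (intro conjI AE_I2) (auto simp: vec_Plus_eq_iff swap_mat_mult)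
  qed
  show "swap_conj (cscale c u) = cscale (cnj c) (swap_conj u)"
  proof transfer
    fix c and u :: "real \<Rightarrow> complex^('p + 'p)"
    assume "l2_eq u u"
    then have "square_integrable u" by (simp add: l2_eq_def)
    from sq(1)[OF sq(2)[OF this]] sq(2)[OF sq(1)[OF this]]
    show "l2_eq (\<lambda>t. swap_mat *v (\<chi> k. cnj ((c *s u t) $ k)))
        (\<lambda>t. cnj c *s (swap_mat *v (\<chi> k. cnj (u t $ k))))"
      unfolding l2_eq_def by (intro conjI AE_I2) (auto simp: vec_Plus_eq_iff swap_mat_mult)
  qed
  show "swap_conj (swap_conj u) = u"
    by transfer (auto simp: l2_eq_def vec_Plus_eq_iff swap_mat_mult intro!: sq AE_I2)
  show "cinner (swap_conj u) v = cinner (swap_conj v) u"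
    by transfer (simp add: sum_UNIV_Plus swap_mat_mult mult.commute add.commute)
qed

text \<open>Elements of \<open>\<^bold>B(\<complex>\<^sup>p, \<complex>\<^sup>n)\<close> are matrices; the Euclidean norm on them is equivalent to the
  operator norm, so \<open>square_integrable\<close> is membership in \<open>L\<^sup>2(\<real>\<^sub>+, \<^bold>B(\<complex>\<^sup>p, \<complex>\<^sup>n))\<close>.\<close>

definition weyl_solution ::
  "(real \<Rightarrow> complex^('p::finite + 'p)^('p + 'p)) \<Rightarrow> complex^('p + 'p)^'p \<Rightarrow> complex \<Rightarrow>
   (real \<Rightarrow> complex^'p^('p + 'p)) \<Rightarrow> bool"
where
  "weyl_solution Q C z \<Psi> \<longleftrightarrow>
     AC_loc \<Psi> \<and>
     (AE t in halfline. J_mat ** vector_derivative \<Psi> (at t) + Q t ** \<Psi> t = mat z ** \<Psi> t) \<and>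
     square_integrable \<Psi> \<and>
     C ** \<Psi> 0 = mat 1"

end

theory Submission
  imports Defs
begin

text \<open>
  Two observations make the system tractable. First, the symmetry of the blocks of \<open>Q\<close> says that \<open>Q\<close> is
  symmetric for a bilinear form \<open>sdot\<close> on \<open>\<complex>\<^sup>n\<close>, and \<open>j T\<^sup>* j\<close> is the transpose of \<open>T\<close> for the induced
  bilinear pairing on \<open>L\<^sup>2\<close>. In these terms \<open>j\<close>-symmetry and \<open>j\<close>-selfadjointness are symmetry
  and selfadjointness without complex conjugates, and the boundary form is the symplectic form
  \<open>symp u v = sdot (J u) v\<close> on \<open>\<complex>\<^sup>n\<close>. Second, the Lagrange identity on the half-line has no boundary term
  at infinity (\<open>lagrange_halfline\<close>): the function \<open>symp y w\<close> is integrable and has a limit, which must be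
  zero. Therefore the transpose of the minimal operator is the maximal operator (\<open>transpose_D_min\<close>), and
  the minimal operator is \<open>j\<close>-symmetric.

  Let \<open>z\<close> be in \<open>rho_hat (D_min Q)\<close>. Then the range of \<open>D_min Q - z\<close> is closed, and it is the annihilator of the
  eigenspace \<open>eig z\<close> of the maximal operator (\<open>range_D_min\<close>). Eigenfunctions are determined by their
  values at \<open>0\<close>. The space of these initial values is isotropic by the Lagrange identity, and it is
  maximal isotropic because a vector \<open>c\<close> orthogonal to it yields a right-hand side in the range of
  \<open>D_min Q - z\<close>, which corrects a cutoff solution starting at \<open>c\<close> to an eigenfunction (\<open>bdry_lagrangian\<close>).
  A Lagrangian subspace of \<open>\<complex>\<^sup>2\<^sup>p\<close> has dimension \<open>p\<close>, so \<open>dim (eig z) = p\<close> (\<open>dim_eig\<close>). Conjugation by \<open>j\<close>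
  exchanges \<open>Q\<close> and \<open>Q\<^sup>*\<close> and transports this to both defect spaces.

  For the second part fix such a \<open>z\<close> and choose a Lagrangian complement of its space of initial values; it is
  the kernel of a matrix \<open>C\<close> (\<open>lagrangian_boundary_matrix\<close>). Restricting the maximal operator by \<open>C y(0) = 0\<close>
  gives a \<open>j\<close>-selfadjoint operator, since the kernel of \<open>C\<close> is Lagrangian (\<open>j_selfadjoint_D_bc\<close>), and \<open>z\<close> is in
  its resolvent set, since the kernel is a complement (\<open>rho_hat_subset_resolvent_set\<close>). For any \<open>\<lambda>\<close> in the
  resolvent set, subtracting a resolvent value from a cutoff solution gives the unique square integrable
  solution with prescribed data \<open>C y(0)\<close>; for the unit vectors of \<open>\<complex>\<^sup>p\<close> these are the columns of the Weyl solution. Its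
  differences for two spectral parameters are expressed by the resolvent (\<open>weyl_elt_diff\<close>), which gives
  holomorphy in \<open>L\<^sup>2\<close>, and also pointwise because point evaluation is continuous for the graph norm
  (\<open>evaluation_bound\<close>).

  The potential is only locally integrable, so the calculus of absolutely continuous functions
  is developed from the \<open>\<epsilon>\<close>-\<open>\<delta>\<close> definition: absolutely continuous functions are exactly the primitives of
  integrable functions (\<open>AC_density\<close>, \<open>AC_on_integral\<close>), and linear systems with locally integrable
  coefficients have solutions (\<open>linear_ode_solution\<close>). Completeness of \<open>L\<^sup>2\<close>
  enters through orthogonal projections, which turn closed ranges into annihilators.
\<close>

section \<open>Increments and total variation\<close>

lemma division_intervalE:
  fixes D :: "real set set"
  assumes "D division_of S" "K \<in> D"
  obtains c d where "c \<le> d" "K = {c..d}" "Inf K = c" "Sup K = d"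
proof -
  obtain c d where K: "K = cbox c d" using division_ofD(4)[OF assms] by blast
  moreover have "K \<noteq> {}" using division_ofD(3)[OF assms] .
  ultimately show ?thesis using that[of c d] by auto
qed

lemma measure_division:
  fixes D :: "real set set"
  assumes "D division_of S"
  shows "(\<Sum>K\<in>D. Sup K - Inf K) = measure lebesgue S"
proof -
  have "measure lebesgue S = (\<Sum>K\<in>D. measure lebesgue K)"
    by (rule content_division[OF assms, symmetric])
  also have "\<dots> = (\<Sum>K\<in>D. Sup K - Inf K)"
  proof (rule sum.cong[OF refl])
    fix K assume "K \<in> D"
    then show "measure lebesgue K = Sup K - Inf K"
      by (rule division_intervalE[OF assms]) auto
  qed
  finally show ?thesis by simp
qed

definition increments :: "(real \<Rightarrow> 'b::real_normed_vector) \<Rightarrow> real set set \<Rightarrow> real" where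
  "increments F D = (\<Sum>K\<in>D. norm (F (Sup K) - F (Inf K)))"

lemma AC_on_iff:
  "AC_on a b F \<longleftrightarrow> (\<forall>\<epsilon>>0. \<exists>\<delta>>0. \<forall>D. D division_of \<Union>D \<longrightarrow> \<Union>D \<subseteq> {a..b} \<longrightarrow>
     measure lebesgue (\<Union>D) < \<delta> \<longrightarrow> increments F D < \<epsilon>)"
  unfolding AC_on_def increments_def by (intro all_cong ex_cong conj_cong imp_cong refl)
    (simp_all add: measure_division)

lemma AC_onE:
  assumes "AC_on a b F" "\<epsilon> > 0"
  obtains \<delta> where "\<delta> > 0" "\<And>D. D division_of \<Union>D \<Longrightarrow> \<Union>D \<subseteq> {a..b} \<Longrightarrow>
     measure lebesgue (\<Union>D) < \<delta> \<Longrightarrow> increments F D < \<epsilon>"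
  using assms unfolding AC_on_iff by blast

lemma increments_Un:
  assumes p: "p division_of S" and q: "q division_of T" and ST: "interior S \<inter> interior T = {}"
  shows "increments F (p \<union> q) = increments F p + increments F q"
  unfolding increments_def
proof (rule sum.union_inter_neutral)
  show "finite p" "finite q" using p q by auto
  show "\<forall>K\<in>p \<inter> q. norm (F (Sup K) - F (Inf K)) = 0"
  proof
    fix K assume K: "K \<in> p \<inter> q"
    then obtain c d where cd: "c \<le> d" "K = {c..d}" "Inf K = c" "Sup K = d"
      using division_intervalE[OF p] by blast
    have "interior K \<subseteq> interior S \<inter> interior T"
      using K division_ofD(2)[OF p] division_ofD(2)[OF q] by (auto intro!: interior_mono)
    with ST cd have "{c<..<d} = {}" by auto
    with cd have "c = d" by auto
    with cd show "norm (F (Sup K) - F (Inf K)) = 0" by simp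
  qed
qed

text \<open>Cutting every interval of a family at \<open>c\<close> does not decrease the sum of increments.\<close>

lemma increments_split:
  fixes F :: "real \<Rightarrow> 'b::real_normed_vector"
  assumes D: "D division_of \<Union>D" and sub: "\<Union>D \<subseteq> {a..b}"
  obtains D1 D2 where "D1 division_of \<Union>D1" "\<Union>D1 \<subseteq> {a..c}"
    "D2 division_of \<Union>D2" "\<Union>D2 \<subseteq> {c..b}" "increments F D \<le> increments F D1 + increments F D2"
proof -
  define A where "A = {K\<in>D. Inf K < c}"
  define B where "B = {K\<in>D. c < Sup K}"
  have fin: "finite D" "finite A" "finite B" using D unfolding A_def B_def by auto
  have form: "\<exists>l r. l \<le> r \<and> K = {l..r} \<and> Inf K = l \<and> Sup K = r" if "K \<in> D" for K
    using division_intervalE[OF D that] by blast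
  have disj: "K = L" if "K \<in> D" "L \<in> D" "interior K \<inter> interior L \<noteq> {}" for K L
    using division_ofD(5)[OF D] that by blast
  have A: "\<exists>l r. l \<le> r \<and> l < c \<and> K = {l..r} \<and> Inf K = l \<and> Sup K = r \<and> K \<inter> {..c} = {l..min r c}" if "K \<in> A" for K
    using form[of K] that unfolding A_def by force
  have B: "\<exists>l r. l \<le> r \<and> c < r \<and> K = {l..r} \<and> Inf K = l \<and> Sup K = r \<and> K \<inter> {c..} = {max l c..r}" if "K \<in> B" for K
    using form[of K] that unfolding B_def by force
  have injA: "inj_on (\<lambda>K. K \<inter> {..c}) A"
  proof (rule inj_onI)
    fix K L assume KL: "K \<in> A" "L \<in> A" and eq: "K \<inter> {..c} = L \<inter> {..c}"
    obtain l r where K: "l \<le> r" "l < c" "K = {l..r}" "K \<inter> {..c} = {l..min r c}" using A[OF KL(1)] by blast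
    obtain l' r' where L: "l' \<le> r'" "l' < c" "L = {l'..r'}" "L \<inter> {..c} = {l'..min r' c}" using A[OF KL(2)] by blast
    have e: "l = l'" "min r c = min r' c" using eq K L by (simp_all add: Icc_eq_Icc)
    show "K = L"
    proof (cases "l < r")
      case True
      with e K L have "(l + min r c)/2 \<in> interior K \<inter> interior L" by (auto simp: min_def split: if_splits)
      then show ?thesis using disj KL unfolding A_def by blast
    next
      case False
      with e K L show ?thesis by (auto simp: min_def split: if_splits)
    qed
  qed
  have injB: "inj_on (\<lambda>K. K \<inter> {c..}) B"
  proof (rule inj_onI)
    fix K L assume KL: "K \<in> B" "L \<in> B" and eq: "K \<inter> {c..} = L \<inter> {c..}"
    obtain l r where K: "l \<le> r" "c < r" "K = {l..r}" "K \<inter> {c..} = {max l c..r}" using B[OF KL(1)] by blast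
    obtain l' r' where L: "l' \<le> r'" "c < r'" "L = {l'..r'}" "L \<inter> {c..} = {max l' c..r'}" using B[OF KL(2)] by blast
    have e: "r = r'" "max l c = max l' c" using eq K L by (simp_all add: Icc_eq_Icc)
    show "K = L"
    proof (cases "l < r")
      case True
      with e K L have "(r + max l c)/2 \<in> interior K \<inter> interior L" by (auto simp: max_def split: if_splits)
      then show ?thesis using disj KL unfolding B_def by blast
    next
      case False
      with e K L show ?thesis by (auto simp: max_def split: if_splits)
    qed
  qed
  define D1 where "D1 = (\<lambda>K. K \<inter> {..c}) ` A"
  define D2 where "D2 = (\<lambda>K. K \<inter> {c..}) ` B"
  have i1: "increments F D1 = (\<Sum>K\<in>A. norm (F (min (Sup K) c) - F (Inf K)))"
    unfolding increments_def D1_def sum.reindex[OF injA] o_def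
  proof (rule sum.cong[OF refl])
    fix K assume "K \<in> A"
    then show "norm (F (Sup (K \<inter> {..c})) - F (Inf (K \<inter> {..c}))) = norm (F (min (Sup K) c) - F (Inf K))"
      using A[of K] by auto
  qed
  have i2: "increments F D2 = (\<Sum>K\<in>B. norm (F (Sup K) - F (max (Inf K) c)))"
    unfolding increments_def D2_def sum.reindex[OF injB] o_def
  proof (rule sum.cong[OF refl])
    fix K assume "K \<in> B"
    then show "norm (F (Sup (K \<inter> {c..})) - F (Inf (K \<inter> {c..}))) = norm (F (Sup K) - F (max (Inf K) c))"
      using B[of K] by auto
  qed
  have "increments F D \<le> (\<Sum>K\<in>D. (if Inf K < c then norm (F (min (Sup K) c) - F (Inf K)) else 0)
      + (if c < Sup K then norm (F (Sup K) - F (max (Inf K) c)) else 0))"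
    unfolding increments_def
  proof (rule sum_mono)
    fix K assume "K \<in> D"
    then obtain l r where "l \<le> r" "Inf K = l" "Sup K = r" using form by blast
    moreover have "norm (F r - F l) \<le> norm (F c - F l) + norm (F r - F c)"
      using norm_triangle_ineq[of "F c - F l" "F r - F c"] by simp
    ultimately show "norm (F (Sup K) - F (Inf K)) \<le> (if Inf K < c then norm (F (min (Sup K) c) - F (Inf K)) else 0)
      + (if c < Sup K then norm (F (Sup K) - F (max (Inf K) c)) else 0)"
      by (cases "l = r") (auto simp: min_def max_def)
  qed
  also have "\<dots> = increments F D1 + increments F D2"
    unfolding i1 i2 A_def B_def using fin by (simp add: sum.distrib sum.inter_filter)
  finally have inc: "increments F D \<le> increments F D1 + increments F D2" .
  have "D1 division_of \<Union>D1"
  proof (rule division_ofI)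
    show "finite D1" using fin unfolding D1_def by auto
    fix K assume "K \<in> D1"
    then obtain K' where K': "K' \<in> A" "K = K' \<inter> {..c}" unfolding D1_def by auto
    obtain l r where lr: "l \<le> r" "l < c" "K' \<inter> {..c} = {l..min r c}" using A[OF K'(1)] by blast
    show "K \<subseteq> \<Union>D1" using \<open>K \<in> D1\<close> by auto
    show "K \<noteq> {}" using lr K' by auto
    show "\<exists>a b. K = cbox a b" using lr K' by auto
    fix L assume "L \<in> D1" and ne: "K \<noteq> L"
    then obtain L' where L': "L' \<in> A" "L = L' \<inter> {..c}" unfolding D1_def by auto
    have "interior K' \<inter> interior L' = {}" using disj K' L' ne unfolding A_def by blast
    then show "interior K \<inter> interior L = {}" using K' L' by auto
  qed simp
  moreover have "D2 division_of \<Union>D2"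
  proof (rule division_ofI)
    show "finite D2" using fin unfolding D2_def by auto
    fix K assume "K \<in> D2"
    then obtain K' where K': "K' \<in> B" "K = K' \<inter> {c..}" unfolding D2_def by auto
    obtain l r where lr: "l \<le> r" "c < r" "K' \<inter> {c..} = {max l c..r}" using B[OF K'(1)] by blast
    show "K \<subseteq> \<Union>D2" using \<open>K \<in> D2\<close> by auto
    show "K \<noteq> {}" using lr K' by auto
    show "\<exists>a b. K = cbox a b" using lr K' by auto
    fix L assume "L \<in> D2" and ne: "K \<noteq> L"
    then obtain L' where L': "L' \<in> B" "L = L' \<inter> {c..}" unfolding D2_def by auto
    have "interior K' \<inter> interior L' = {}" using disj K' L' ne unfolding B_def by blast
    then show "interior K \<inter> interior L = {}" using K' L' by auto
  qed simp
  moreover have "\<Union>D1 \<subseteq> {a..c}" "\<Union>D2 \<subseteq> {c..b}"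
    using sub unfolding D1_def D2_def A_def B_def by fastforce+
  ultimately show ?thesis using inc that by blast
qed

definition variation :: "(real \<Rightarrow> 'b::real_normed_vector) \<Rightarrow> real \<Rightarrow> real \<Rightarrow> real" where
  "variation F a t = (SUP D\<in>{D. D division_of \<Union>D \<and> \<Union>D \<subseteq> {a..t}}. increments F D)"

lemma increments_degenerate:
  assumes "D division_of \<Union>D" "\<Union>D \<subseteq> {a..t}" "t \<le> a"
  shows "increments F D = 0"
  unfolding increments_def
proof (rule sum.neutral, rule ballI)
  fix K assume "K \<in> D"
  then obtain c d where "c \<le> d" "K = {c..d}" "Inf K = c" "Sup K = d"
    using division_intervalE[OF assms(1)] by blast
  moreover have "{c..d} \<subseteq> {a..t}" using assms(2) \<open>K \<in> D\<close> calculation by blast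
  ultimately have "c = d" using assms(3) by auto
  then show "norm (F (Sup K) - F (Inf K)) = 0" using \<open>Inf K = c\<close> \<open>Sup K = d\<close> by simp
qed

lemma measure_le_interval:
  fixes D :: "real set set"
  assumes "D division_of \<Union>D" "\<Union>D \<subseteq> {c..d}" "c \<le> d"
  shows "measure lebesgue (\<Union>D) \<le> d - c"
proof -
  have "measure lebesgue (\<Union>D) \<le> measure lebesgue {c..d}"
  proof (rule measure_mono_fmeasurable)
    have "K \<in> sets lebesgue" if "K \<in> D" for K
      using division_ofD(4)[OF assms(1) that] by auto
    then show "\<Union>D \<in> sets lebesgue"
      using assms(1) by (intro sets.finite_Union) auto
  qed (use assms in auto)
  then show ?thesis using assms by simp
qed

text \<open>An absolutely continuous function varies by less than 1 on every interval of length
  \<open>\<delta>/2\<close>, so that its variation is finite.\<close>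

lemma AC_on_increments_bounded:
  assumes "AC_on a b F"
  obtains M where "\<And>D. D division_of \<Union>D \<Longrightarrow> \<Union>D \<subseteq> {a..b} \<Longrightarrow> increments F D \<le> M"
proof -
  obtain \<delta> where \<delta>: "\<delta> > 0" "\<And>D. D division_of \<Union>D \<Longrightarrow> \<Union>D \<subseteq> {a..b} \<Longrightarrow>
     measure lebesgue (\<Union>D) < \<delta> \<Longrightarrow> increments F D < 1"
    using AC_onE[OF assms zero_less_one] by blast
  have step: "increments F D \<le> real n"
    if "D division_of \<Union>D" "\<Union>D \<subseteq> {a..t}" "t \<le> b" "t \<le> a + real n * (\<delta>/2)" for n D t
    using that
  proof (induction n arbitrary: D t)
    case 0
    then show ?case using increments_degenerate[of D a t F] by simp
  next
    case (Suc n)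
    define c where "c = min t (a + real n * (\<delta>/2))"
    have ac: "a \<le> c" if "a \<le> t" using that \<delta>(1) unfolding c_def by simp
    show ?case
    proof (cases "a \<le> t")
      case False
      then show ?thesis using increments_degenerate[of D a t F] Suc by simp
    next
      case True
      obtain D1 D2 where D: "D1 division_of \<Union>D1" "\<Union>D1 \<subseteq> {a..c}"
        "D2 division_of \<Union>D2" "\<Union>D2 \<subseteq> {c..t}" "increments F D \<le> increments F D1 + increments F D2"
        using increments_split[OF Suc.prems(1,2)] by metis
      have "increments F D1 \<le> real n"
        using Suc.IH[OF D(1,2)] Suc.prems(3) unfolding c_def by simp
      moreover have "increments F D2 < 1"
      proof (rule \<delta>(2)[OF D(3)])
        show "\<Union>D2 \<subseteq> {a..b}" using D(4) ac[OF True] Suc.prems(3) by fastforce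
        have "measure lebesgue (\<Union>D2) \<le> t - c"
          by (rule measure_le_interval[OF D(3,4)]) (simp add: c_def)
        also have "t - c \<le> \<delta>/2"
          using Suc.prems(4) \<delta>(1) unfolding c_def min_def by (auto simp: field_simps)
        finally show "measure lebesgue (\<Union>D2) < \<delta>" using \<delta>(1) by simp
      qed
      ultimately show ?thesis using D(5) by simp
    qed
  qed
  obtain n :: nat where "b - a \<le> real n * (\<delta>/2)"
    using real_arch_simple[of "(b - a) / (\<delta>/2)"] \<delta>(1) by (auto simp: field_simps)
  then show ?thesis using that[of "real n"] step[of _ b n] by auto
qed

context
  fixes F :: "real \<Rightarrow> 'b::real_normed_vector" and a b :: real
  assumes AC: "AC_on a b F"
begin

lemma variation_bdd:
  assumes "t \<le> b"
  shows "bdd_above (increments F ` {D. D division_of \<Union>D \<and> \<Union>D \<subseteq> {a..t}})"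
proof -
  obtain M where M: "\<And>D. D division_of \<Union>D \<Longrightarrow> \<Union>D \<subseteq> {a..b} \<Longrightarrow> increments F D \<le> M"
    using AC_on_increments_bounded[OF AC] by blast
  have "{a..t} \<subseteq> {a..b}" using assms by auto
  show ?thesis
  proof (rule bdd_aboveI2)
    fix D assume "D \<in> {D. D division_of \<Union>D \<and> \<Union>D \<subseteq> {a..t}}"
    then have "D division_of \<Union>D" "\<Union>D \<subseteq> {a..t}" by blast+
    then show "increments F D \<le> M" using M[of D] \<open>{a..t} \<subseteq> {a..b}\<close> by (meson subset_trans)
  qed
qed

lemma increments_le_variation:
  assumes "t \<le> b" "D division_of \<Union>D" "\<Union>D \<subseteq> {a..t}"
  shows "increments F D \<le> variation F a t"
  unfolding variation_def using assms by (intro cSUP_upper variation_bdd) auto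

lemma variation_le:
  assumes "\<And>D. D division_of \<Union>D \<Longrightarrow> \<Union>D \<subseteq> {a..t} \<Longrightarrow> increments F D \<le> M"
  shows "variation F a t \<le> M"
proof -
  have "{} \<in> {D. D division_of \<Union>D \<and> \<Union>D \<subseteq> {a..t}}" by auto
  then have "{D. D division_of \<Union>D \<and> \<Union>D \<subseteq> {a..t}} \<noteq> {}" by blast
  then show ?thesis unfolding variation_def using assms by (intro cSUP_least) auto
qed

lemma variation_increment_ge:
  assumes "a \<le> s" "s \<le> t" "t \<le> b"
  shows "norm (F t - F s) \<le> variation F a t - variation F a s"
proof -
  have "variation F a s \<le> variation F a t - norm (F t - F s)"
  proof (rule variation_le)
    fix D assume D: "D division_of \<Union>D" "\<Union>D \<subseteq> {a..s}"
    have st: "{{s..t}} division_of {s..t}" using division_of_self[of s t] assms by simp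
    have "interior (\<Union>D) \<inter> interior {s..t} \<subseteq> interior {a..s} \<inter> interior {s..t}"
      using D(2) interior_mono by blast
    then have int: "interior (\<Union>D) \<inter> interior {s..t} = {}" by auto
    have "increments F (D \<union> {{s..t}}) = increments F D + increments F {{s..t}}"
      by (rule increments_Un[OF D(1) st int])
    moreover have "increments F (D \<union> {{s..t}}) \<le> variation F a t"
    proof (rule increments_le_variation[OF assms(3)])
      show "D \<union> {{s..t}} division_of \<Union>(D \<union> {{s..t}})"
        using division_disjoint_union[OF D(1) st int] by (simp add: Un_commute)
      show "\<Union>(D \<union> {{s..t}}) \<subseteq> {a..t}" using D(2) assms by fastforce
    qed
    ultimately show "increments F D \<le> variation F a t - norm (F t - F s)"
      using assms by (simp add: increments_def)
  qed
  then show ?thesis by simp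
qed

lemma variation_increment_le:
  assumes "a \<le> c" "c \<le> d" "d \<le> b" "e > 0"
  obtains D where "D division_of \<Union>D" "\<Union>D \<subseteq> {c..d}" "variation F a d - variation F a c \<le> increments F D + e"
proof -
  have "\<exists>D. D division_of \<Union>D \<and> \<Union>D \<subseteq> {a..d} \<and> \<not> increments F D \<le> variation F a d - e"
  proof (rule ccontr)
    assume "\<not> ?thesis"
    then have "variation F a d \<le> variation F a d - e" by (intro variation_le) blast
    with assms show False by simp
  qed
  then obtain D where D: "D division_of \<Union>D" "\<Union>D \<subseteq> {a..d}" "increments F D > variation F a d - e" by auto
  obtain D1 D2 where s: "D1 division_of \<Union>D1" "\<Union>D1 \<subseteq> {a..c}"
        "D2 division_of \<Union>D2" "\<Union>D2 \<subseteq> {c..d}" "increments F D \<le> increments F D1 + increments F D2"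
    using increments_split[OF D(1,2)] by metis
  have "increments F D1 \<le> variation F a c" using increments_le_variation[OF _ s(1,2)] assms by simp
  then show ?thesis using that[OF s(3,4)] D(3) s(5) by simp
qed

text \<open>The sum of the increments of the variation over a family of intervals is approximated by
  sums of increments of \<open>F\<close> over refinements of this family.\<close>

lemma variation_increments_approx:
  assumes "finite D" "D division_of \<Union>D" "\<Union>D \<subseteq> {a..b}" "e > 0"
  shows "\<exists>D'. D' division_of \<Union>D' \<and> \<Union>D' \<subseteq> \<Union>D \<and>
    increments (variation F a) D \<le> increments F D' + real (card D) * e"
  using assms
proof (induction D rule: finite_induct)
  case empty
  then show ?case by (intro exI[of _ "{}"]) (auto simp: increments_def)
next
  case (insert K D)
  have D: "D division_of \<Union>D" using division_of_subset[OF insert.prems(1)] by blast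
  obtain D' where D': "D' division_of \<Union>D'" "\<Union>D' \<subseteq> \<Union>D"
    "increments (variation F a) D \<le> increments F D' + real (card D) * e"
    using insert.IH[OF D] insert.prems by auto
  obtain c d where K: "c \<le> d" "K = {c..d}" "Inf K = c" "Sup K = d"
    using division_intervalE[OF insert.prems(1)] by blast
  have cd: "a \<le> c" "d \<le> b" using insert.prems(2) K by auto
  obtain E where E: "E division_of \<Union>E" "\<Union>E \<subseteq> {c..d}"
    "variation F a d - variation F a c \<le> increments F E + e"
    using variation_increment_le[OF cd(1) K(1) cd(2) insert.prems(3)] by metis
  have "interior K \<inter> interior (\<Union>D) = {}"
  proof (rule Int_interior_Union_intervals)
    show "finite D" "open (interior K)" using insert by auto
    show "\<And>L. L \<in> D \<Longrightarrow> \<exists>a b. L = cbox a b" using division_ofD(4)[OF D] .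
    show "\<And>L. L \<in> D \<Longrightarrow> interior K \<inter> interior L = {}"
      using division_ofD(5)[OF insert.prems(1)] insert.hyps by auto
  qed
  then have int: "interior (\<Union>E) \<inter> interior (\<Union>D') = {}"
    using interior_mono[OF E(2)] interior_mono[OF D'(2)] K by blast
  show ?case
  proof (intro exI conjI)
    show "E \<union> D' division_of \<Union>(E \<union> D')"
      using division_disjoint_union[OF E(1) D'(1) int] by simp
    show "\<Union>(E \<union> D') \<subseteq> \<Union>(insert K D)" using E(2) D'(2) K by auto
    have "increments (variation F a) (insert K D) = (variation F a d - variation F a c) + increments (variation F a) D"
      using insert.hyps K order_trans[OF norm_ge_zero variation_increment_ge[OF cd(1) K(1) cd(2)]]
      unfolding increments_def by simp
    then show "increments (variation F a) (insert K D) \<le> increments F (E \<union> D') + real (card (insert K D)) * e"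
      unfolding increments_Un[OF E(1) D'(1) int] using E(3) D'(3) insert.hyps by (simp add: algebra_simps)
  qed
qed

text \<open>Given a family of total length less than \<open>\<delta>\<close>, all refinements of it are also of total length less
  than \<open>\<delta>\<close>, and the increments of \<open>F\<close> over these refinements approximate the increment of the variation.\<close>

lemma AC_on_variation: "AC_on a b (variation F a)"
  unfolding AC_on_iff
proof (intro allI impI)
  fix e :: real assume "e > 0"
  then have "e/2 > 0" by simp
  from AC_onE[OF AC this] obtain \<delta> where \<delta>: "\<delta> > 0" "\<And>D. D division_of \<Union>D \<Longrightarrow> \<Union>D \<subseteq> {a..b} \<Longrightarrow>
     measure lebesgue (\<Union>D) < \<delta> \<Longrightarrow> increments F D < e/2"
    by blast
  have "increments (variation F a) D < e"
    if D: "D division_of \<Union>D" "\<Union>D \<subseteq> {a..b}" "measure lebesgue (\<Union>D) < \<delta>" for D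
  proof -
    define h where "h = (e/2) / (real (card D) + 1)"
    have h: "h > 0" "real (card D) * h < e/2" using \<open>e > 0\<close> unfolding h_def by (auto simp: field_simps)
    have "finite D" using D(1) by auto
    from variation_increments_approx[OF this D(1,2) h(1)]
    obtain D' where D': "D' division_of \<Union>D'" "\<Union>D' \<subseteq> \<Union>D"
      "increments (variation F a) D \<le> increments F D' + real (card D) * h" by blast
    have m: "\<Union>D \<in> lmeasurable" "\<Union>D' \<in> lmeasurable"
      using D(1) D'(1) lmeasurable_division by blast+
    have "measure lebesgue (\<Union>D') \<le> measure lebesgue (\<Union>D)"
      using D'(2) m by (intro measure_mono_fmeasurable) auto
    then have "increments F D' < e/2" using \<delta>(2)[OF D'(1)] D' D by auto
    then show ?thesis using D'(3) h by simp
  qed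
  then show "\<exists>\<delta>>0. \<forall>D. D division_of \<Union>D \<longrightarrow> \<Union>D \<subseteq> {a..b} \<longrightarrow>
     measure lebesgue (\<Union>D) < \<delta> \<longrightarrow> increments (variation F a) D < e"
    using \<delta>(1) by blast
qed

end

lemma AC_on_diff:
  fixes F G :: "real \<Rightarrow> 'b::real_normed_vector"
  assumes "AC_on a b F" "AC_on a b G"
  shows "AC_on a b (\<lambda>t. F t - G t)"
  unfolding AC_on_iff
proof (intro allI impI)
  fix e :: real assume "e > 0"
  then have "e/2 > 0" by simp
  obtain d1 d2 where d: "d1 > 0" "\<And>D. D division_of \<Union>D \<Longrightarrow> \<Union>D \<subseteq> {a..b} \<Longrightarrow>
     measure lebesgue (\<Union>D) < d1 \<Longrightarrow> increments F D < e/2"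
    "d2 > 0" "\<And>D. D division_of \<Union>D \<Longrightarrow> \<Union>D \<subseteq> {a..b} \<Longrightarrow>
     measure lebesgue (\<Union>D) < d2 \<Longrightarrow> increments G D < e/2"
    using AC_onE[OF assms(1) \<open>e/2 > 0\<close>] AC_onE[OF assms(2) \<open>e/2 > 0\<close>] by metis
  have tri: "increments (\<lambda>t. F t - G t) D \<le> increments F D + increments G D" for D
    unfolding increments_def sum.distrib[symmetric]
  proof (rule sum_mono)
    fix K
    have eq: "F (Sup K) - G (Sup K) - (F (Inf K) - G (Inf K)) = (F (Sup K) - F (Inf K)) - (G (Sup K) - G (Inf K))"
      by simp
    show "norm (F (Sup K) - G (Sup K) - (F (Inf K) - G (Inf K))) \<le> norm (F (Sup K) - F (Inf K)) + norm (G (Sup K) - G (Inf K))"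
      unfolding eq by (rule norm_triangle_ineq4)
  qed
  have "increments (\<lambda>t. F t - G t) D < e"
    if "D division_of \<Union>D" "\<Union>D \<subseteq> {a..b}" "measure lebesgue (\<Union>D) < min d1 d2" for D
    using d(2)[OF that(1,2)] d(4)[OF that(1,2)] that(3) tri[of D] by linarith
  then show "\<exists>\<delta>>0. \<forall>D. D division_of \<Union>D \<longrightarrow> \<Union>D \<subseteq> {a..b} \<longrightarrow>
     measure lebesgue (\<Union>D) < \<delta> \<longrightarrow> increments (\<lambda>t. F t - G t) D < e"
    using d(1,3) by (intro exI[of _ "min d1 d2"]) auto
qed

section \<open>Densities of monotone absolutely continuous functions\<close>

text \<open>The Stieltjes measure of a monotone absolutely continuous function vanishes on Lebesgue null sets,
  since open sets of small measure are exhausted by finite families of intervals of small total length.\<close>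

lemma interval_measure_clamp_AC_null:
  fixes G :: "real \<Rightarrow> real" and a b :: real
  defines "H \<equiv> \<lambda>t. G (max a (min b t))"
  assumes ab: "a \<le> b" and AC: "AC_on a b G" and mono: "\<And>s t. a \<le> s \<Longrightarrow> s \<le> t \<Longrightarrow> t \<le> b \<Longrightarrow> G s \<le> G t"
  shows "continuous_on UNIV H" "\<And>s t. s \<le> t \<Longrightarrow> H s \<le> H t"
    "absolutely_continuous lborel (interval_measure H)"
proof -
  show monoH: "H s \<le> H t" if "s \<le> t" for s t
    unfolding H_def using that ab by (intro mono) auto
  have "continuous_on {a..b} G"
    unfolding continuous_on_iff
  proof (intro ballI allI impI)
    fix x e :: real assume x: "x \<in> {a..b}" and "e > 0"
    from AC_onE[OF AC this(2)] obtain \<delta> where \<delta>: "\<delta> > 0" "\<And>D. D division_of \<Union>D \<Longrightarrow> \<Union>D \<subseteq> {a..b} \<Longrightarrow>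
     measure lebesgue (\<Union>D) < \<delta> \<Longrightarrow> increments G D < e" by blast
    have "dist (G y) (G x) < e" if y: "y \<in> {a..b}" "dist y x < \<delta>" for y
    proof -
      have "{{min x y..max x y}} division_of {min x y..max x y}"
        using division_of_self[of "min x y" "max x y"] by simp
      then have "increments G {{min x y..max x y}} < e"
        using x y by (intro \<delta>(2)) (auto simp: dist_real_def abs_if min_def max_def split: if_splits)
      then show ?thesis
        by (simp add: increments_def dist_real_def min_def max_def abs_minus_commute split: if_splits)
    qed
    then show "\<exists>d>0. \<forall>y\<in>{a..b}. dist y x < d \<longrightarrow> dist (G y) (G x) < e" using \<delta>(1) by blast
  qed
  then have "continuous_on UNIV (G \<circ> (\<lambda>t. max a (min b t)))"
    using ab by (intro continuous_on_compose continuous_intros) (auto elim!: continuous_on_subset)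
  then show contH: "continuous_on UNIV H" by (simp add: H_def o_def)
  then have rc: "continuous (at_right x) H" for x
    by (meson UNIV_I continuous_on_eq_continuous_within continuous_within_subset subset_UNIV)
  let ?N = "interval_measure H"
  have Ioc: "emeasure ?N {c<..d} = ennreal (H d - H c)" if "c \<le> d" for c d
    by (rule emeasure_interval_measure_Ioc[OF that monoH rc])
  have Icc: "emeasure ?N {c..d} = ennreal (H d - H c)" if "c \<le> d" for c d
    by (rule emeasure_interval_measure_Icc[OF that monoH contH])
  have left: "emeasure ?N {..a} = 0"
  proof -
    have "{..a} = (\<Union>n. {a - real n<..a})"
    proof (intro set_eqI iffI)
      fix x assume x: "x \<in> {..a}"
      obtain n where "a - x < real n" using reals_Archimedean2 by blast
      with x show "x \<in> (\<Union>n. {a - real n<..a})" by (auto intro!: exI[of _ n])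
    qed auto
    moreover have "emeasure ?N (\<Union>n. {a - real n<..a}) = 0"
      using ab by (intro emeasure_UN_eq_0) (subst Ioc, auto simp: H_def)
    ultimately show ?thesis by simp
  qed
  have right: "emeasure ?N {b<..} = 0"
  proof -
    have "{b<..} = (\<Union>n. {b<..b + real n})"
    proof (intro set_eqI iffI)
      fix x assume x: "x \<in> {b<..}"
      obtain n where "x - b \<le> real n" using real_arch_simple by blast
      with x show "x \<in> (\<Union>n. {b<..b + real n})" by (auto intro!: exI[of _ n])
    qed auto
    moreover have "emeasure ?N (\<Union>n. {b<..b + real n}) = 0"
      using ab by (intro emeasure_UN_eq_0) (subst Ioc, auto simp: H_def)
    ultimately show ?thesis by simp
  qed
  have rightb: "emeasure ?N {b..} = 0"
  proof -
    have "{b..} = {b..b} \<union> {b<..}" by auto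
    moreover have "emeasure ?N ({b..b} \<union> {b<..}) \<le> emeasure ?N {b..b} + emeasure ?N {b<..}"
      by (intro emeasure_subadditive) auto
    ultimately show ?thesis using Icc[of b b] right by simp
  qed
  show "absolutely_continuous lborel ?N"
    unfolding absolutely_continuous_def
  proof
    fix A :: "real set" assume A: "A \<in> null_sets lborel"
    then have [measurable]: "A \<in> sets borel" by auto
    have small: "emeasure ?N (A \<inter> {a<..<b}) \<le> ennreal e" if "e > 0" for e
    proof -
      from AC_onE[OF AC that] obtain \<delta> where \<delta>: "\<delta> > 0" "\<And>D. D division_of \<Union>D \<Longrightarrow> \<Union>D \<subseteq> {a..b} \<Longrightarrow>
         measure lebesgue (\<Union>D) < \<delta> \<Longrightarrow> increments G D < e" by blast
      obtain U where U: "open U" "A \<inter> {a<..<b} \<subseteq> U" "emeasure lborel (U - A \<inter> {a<..<b}) < \<delta>"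
        using outer_regular_lborel[of "A \<inter> {a<..<b}" \<delta>] \<delta>(1) by auto
      have "emeasure lborel (A \<inter> {a<..<b}) = 0"
        using A by (metis Int_lower1 \<open>A \<in> sets borel\<close> emeasure_mono le_zero_eq null_setsD1 sets_lborel)
      have "emeasure lborel U \<le> emeasure lborel ((U - A \<inter> {a<..<b}) \<union> (A \<inter> {a<..<b}))"
        using U by (intro emeasure_mono) auto
      also have "\<dots> \<le> emeasure lborel (U - A \<inter> {a<..<b}) + emeasure lborel (A \<inter> {a<..<b})"
        using U by (intro emeasure_subadditive) auto
      also have "\<dots> < \<delta>" using \<open>emeasure lborel (A \<inter> {a<..<b}) = 0\<close> U(3) by simp
      finally have Ud: "emeasure lborel U < \<delta>" .
      define W where "W = U \<inter> {a<..<b}"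
      have W: "open W" "A \<inter> {a<..<b} \<subseteq> W" "W \<subseteq> {a..b}" using U unfolding W_def by auto
      have Wd: "emeasure lborel W < \<delta>"
        by (rule le_less_trans[OF emeasure_mono Ud]) (auto simp: W_def U(1))
      obtain C where C: "countable C" "C \<subseteq> Pow W" "\<And>X. X \<in> C \<Longrightarrow> \<exists>a b. X = cbox a b" "\<Union>C = W"
        using open_countable_Union_open_cbox[OF W(1)] by blast
      show ?thesis
      proof (cases "C = {}")
        case True
        then have "A \<inter> {a<..<b} = {}" using C W by auto
        then show ?thesis by simp
      next
        case False
        define X where "X n = (\<Union>i\<le>n. from_nat_into C i)" for n :: nat
        have XC: "from_nat_into C i \<in> C" for i using False by (rule from_nat_into)
        have X_bor: "X n \<in> sets borel" for n unfolding X_def using C(3)[OF XC]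
          by (intro sets.finite_UN) (simp, metis borel_closed closed_cbox)
        have "(\<Union>n. X n) = (\<Union>i. from_nat_into C i)" unfolding X_def by blast
        then have "W = (\<Union>n. X n)"
          using range_from_nat_into[OF False C(1)] C(4) by simp
        have "incseq X" unfolding X_def incseq_def by (auto intro: order_trans)
        have Xe: "emeasure ?N (X n) \<le> ennreal e" for n
        proof -
          obtain D where D: "D division_of X n"
          proof (rule elementary_unions_intervals[of "from_nat_into C ` {..n}"])
            show "\<exists>a b. s = cbox a b" if "s \<in> from_nat_into C ` {..n}" for s
              using that C(3)[OF XC] by blast
          qed (auto simp: X_def)
          then have UD: "\<Union>D = X n" by auto
          have XW: "X n \<subseteq> W" using C(2) XC unfolding X_def by fastforce
          have "emeasure lebesgue (X n) < ennreal \<delta>"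
            using X_bor[of n] W(1) XW Wd
            by (auto simp: emeasure_completion intro: le_less_trans[OF emeasure_mono])
          then have "measure lebesgue (X n) < \<delta>"
            using lmeasurable_division[OF D] by (simp add: emeasure_eq_measure2 ennreal_less_iff)
          then have inc: "increments G D < e"
            using D UD XW W(3) by (intro \<delta>(2)) auto
          have "emeasure ?N (X n) \<le> (\<Sum>K\<in>D. emeasure ?N K)"
            unfolding UD[symmetric] using D division_ofD(4)[OF D]
            by (intro emeasure_subadditive_finite[where A="\<lambda>x. x", simplified]) fastforce+
          also have "\<dots> = (\<Sum>K\<in>D. ennreal (norm (G (Sup K) - G (Inf K))))"
          proof (rule sum.cong[OF refl])
            fix K assume K: "K \<in> D"
            then obtain c d where cd: "c \<le> d" "K = {c..d}" "Inf K = c" "Sup K = d"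
              using division_intervalE[OF D] by blast
            have "K \<subseteq> {a..b}" using K UD XW W(3) by (metis Union_upper subset_trans)
            then have "a \<le> c" "d \<le> b" using cd by auto
            then show "emeasure ?N K = ennreal (norm (G (Sup K) - G (Inf K)))"
              using cd mono[of c d] Icc[of c d] by (simp add: H_def)
          qed
          also have "\<dots> = ennreal (increments G D)"
            unfolding increments_def by (simp add: sum_ennreal)
          also have "\<dots> \<le> ennreal e" using inc by (simp add: ennreal_leI)
          finally show ?thesis .
        qed
        have "emeasure ?N (A \<inter> {a<..<b}) \<le> emeasure ?N W"
          using W by (intro emeasure_mono) auto
        also have "emeasure ?N W = (SUP n. emeasure ?N (X n))"
          unfolding \<open>W = (\<Union>n. X n)\<close> using X_bor \<open>incseq X\<close>
          by (intro SUP_emeasure_incseq[symmetric]) auto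
        also have "\<dots> \<le> ennreal e" using Xe by (intro SUP_least)
        finally show ?thesis .
      qed
    qed
    have "emeasure ?N (A \<inter> {a<..<b}) \<le> 0"
      by (rule ennreal_le_epsilon) (simp add: small)
    then have "emeasure ?N (A \<inter> {a<..<b}) = 0" by simp
    moreover have "emeasure ?N A \<le> emeasure ?N ((A \<inter> {a<..<b}) \<union> ({..a} \<union> {b..}))"
      by (intro emeasure_mono) auto
    moreover have "emeasure ?N ((A \<inter> {a<..<b}) \<union> ({..a} \<union> {b..})) \<le> emeasure ?N (A \<inter> {a<..<b}) + emeasure ?N ({..a} \<union> {b..})"
      by (intro emeasure_subadditive) auto
    moreover have "emeasure ?N ({..a} \<union> {b..}) \<le> emeasure ?N {..a} + emeasure ?N {b..}"
      by (intro emeasure_subadditive) auto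
    ultimately have "emeasure ?N A = 0" using left rightb by simp
    then show "A \<in> null_sets ?N" by (intro null_setsI) auto
  qed
qed

text \<open>The density is the Radon--Nikodym derivative of the Stieltjes measure.\<close>

lemma monotone_AC_density:
  fixes G :: "real \<Rightarrow> real"
  assumes ab: "a \<le> b" and AC: "AC_on a b G" and mono: "\<And>s t. a \<le> s \<Longrightarrow> s \<le> t \<Longrightarrow> t \<le> b \<Longrightarrow> G s \<le> G t"
  obtains f where "f absolutely_integrable_on {a..b}" "\<And>t. t \<in> {a..b} \<Longrightarrow> integral {a..t} f = G t - G a"
proof -
  define H where "H = (\<lambda>t. G (max a (min b t)))"
  have H: "continuous_on UNIV H" "\<And>s t. s \<le> t \<Longrightarrow> H s \<le> H t"
    "absolutely_continuous lborel (interval_measure H)"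
    unfolding H_def by (rule interval_measure_clamp_AC_null[OF ab AC]; use mono in blast)+
  let ?N = "interval_measure H"
  have "\<exists>f \<in> borel_measurable lborel. density lborel f = ?N"
    using sigma_finite_measure.Radon_Nikodym[OF sigma_finite_lborel H(3)] sets_interval_measure[of H] sets_lborel by blast
  then obtain f where f[measurable]: "f \<in> borel_measurable borel" and dens: "density lborel f = ?N" by auto
  have nn: "(\<integral>\<^sup>+x. f x * indicator {a..t} x \<partial>lborel) = ennreal (G t - G a)" if "t \<in> {a..b}" for t
  proof -
    have "(\<integral>\<^sup>+x. f x * indicator {a..t} x \<partial>lborel) = emeasure ?N {a..t}"
      unfolding dens[symmetric] by (simp add: emeasure_density)
    also have "\<dots> = ennreal (G t - G a)"
      using that by (subst emeasure_interval_measure_Icc[OF _ H(2,1)]) (auto simp: H_def)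
    finally show ?thesis .
  qed
  define g where "g x = enn2real (f x)" for x
  have [measurable]: "g \<in> borel_measurable borel" unfolding g_def by measurable
  have fin: "AE x in lborel. x \<in> {a..b} \<longrightarrow> f x \<noteq> \<infinity>"
  proof -
    have "AE x in lborel. f x * indicator {a..b} x \<noteq> \<infinity>"
      using nn[of b] ab by (intro nn_integral_PInf_AE) auto
    then show ?thesis by eventually_elim auto
  qed
  have gnn: "(\<integral>\<^sup>+x. ennreal (indicator {a..t} x * g x) \<partial>lborel) = ennreal (G t - G a)" if t: "t \<in> {a..b}" for t
    unfolding nn[OF t, symmetric]
  proof (rule nn_integral_cong_AE)
    show "AE x in lborel. ennreal (indicator {a..t} x * g x) = f x * indicator {a..t} x"
      using fin by eventually_elim (use t in \<open>auto simp: g_def indicator_def ennreal_enn2real_if\<close>)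
  qed
  have hbi: "(g has_integral (G t - G a)) {a..t}" if t: "t \<in> {a..b}" for t
  proof -
    have "((\<lambda>x. indicator {a..t} x * g x) has_integral (G t - G a)) UNIV"
      using gnn[OF t] mono[of a t] t by (intro has_integral_iff_nn_integral_lebesgue[THEN iffD2] nn_integral_has_integral) (auto simp: g_def)
    also have "(\<lambda>x. indicator {a..t} x * g x) = (\<lambda>x. if x \<in> {a..t} then g x else 0)"
      by (simp add: fun_eq_iff indicator_def)
    finally show ?thesis by (simp only: has_integral_restrict_UNIV)
  qed
  show ?thesis
  proof
    show "g absolutely_integrable_on {a..b}"
      using hbi[of b] ab by (subst absolutely_integrable_on_iff_nonneg) (auto simp: g_def integrable_on_def)
    show "integral {a..t} g = G t - G a" if "t \<in> {a..b}" for t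
      using hbi[OF that] by (rule integral_unique)
  qed
qed

text \<open>The indefinite integral has the integrand as its derivative almost everywhere: the right
  derivative is the almost everywhere convergence of one-sided averages, and the left derivative follows
  by applying this to the reflected function.\<close>

lemma indefinite_integral_derivative_AE:
  fixes f :: "real \<Rightarrow> 'b::euclidean_space"
  assumes f: "f integrable_on {a..b}"
  shows "AE t in lebesgue. t \<in> {a<..<b} \<longrightarrow> ((\<lambda>u. integral {a..u} f) has_vector_derivative f t) (at t)"
proof -
  define h where "h x = (if x \<in> {a..b} then f x else 0)" for x
  have hint: "h integrable_on cbox c d" for c d :: real
  proof -
    have "h integrable_on UNIV" unfolding h_def integrable_restrict_UNIV by (rule f)
    then show ?thesis by (rule integrable_on_subcbox) simp
  qed
  have hmint: "(\<lambda>x. h (- x)) integrable_on cbox c d" for c d :: real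
    using hint[of "-d" "-c"] integrable_reflect[of h "-c" "-d"] by simp
  obtain N1 where N1: "negligible N1" "\<And>x e. x \<notin> N1 \<Longrightarrow> 0 < e \<Longrightarrow>
      \<exists>d>0. \<forall>k. 0 < k \<and> k < d \<longrightarrow> norm (integral (cbox x (x + k *\<^sub>R One)) h /\<^sub>R k ^ DIM(real) - h x) < e"
    using integrable_ccontinuous_explicit[of h] hint by blast
  obtain N2 where N2: "negligible N2" "\<And>x e. x \<notin> N2 \<Longrightarrow> 0 < e \<Longrightarrow>
      \<exists>d>0. \<forall>k. 0 < k \<and> k < d \<longrightarrow> norm (integral (cbox x (x + k *\<^sub>R One)) (\<lambda>x. h (- x)) /\<^sub>R k ^ DIM(real) - h (- x)) < e"
    using integrable_ccontinuous_explicit[of "\<lambda>x. h (- x)"] hmint by blast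
  have deriv: "((\<lambda>u. integral {a..u} f) has_vector_derivative f t) (at t)"
    if t: "a < t" "t < b" "t \<notin> N1" "- t \<notin> N2" for t
    unfolding has_vector_derivative_def has_derivative_at_alt
  proof (intro conjI allI impI)
    fix e :: real assume "0 < e"
    obtain d1 where d1: "d1 > 0" "\<And>k. 0 < k \<Longrightarrow> k < d1 \<Longrightarrow> norm (integral {t..t + k} h /\<^sub>R k - h t) < e"
      using N1(2)[OF t(3) \<open>0 < e\<close>] by auto
    obtain d2 where d2: "d2 > 0" "\<And>k. 0 < k \<Longrightarrow> k < d2 \<Longrightarrow> norm (integral {-t..-t + k} (\<lambda>x. h (- x)) /\<^sub>R k - h t) < e"
      using N2(2)[OF t(4) \<open>0 < e\<close>] by auto
    define d where "d = Min {d1, d2, t - a, b - t}"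
    have d: "d > 0" "d \<le> d1" "d \<le> d2" "d \<le> t - a" "d \<le> b - t" unfolding d_def using d1 d2 t by auto
    have fint: "f integrable_on {c..u}" if "a \<le> c" "u \<le> b" for c u
      using integrable_on_subinterval[OF f, of c u] that by auto
    have sc: "norm (I - k *\<^sub>R c) < e * k" if "0 < k" "norm (I /\<^sub>R k - c) < e" for k and I c :: 'b
    proof -
      have "I - k *\<^sub>R c = k *\<^sub>R (I /\<^sub>R k - c)" using that by (simp add: algebra_simps)
      then show ?thesis using that by (simp add: mult.commute)
    qed
    have "norm (integral {a..y} f - integral {a..t} f - (y - t) *\<^sub>R f t) \<le> e * norm (y - t)" if y: "norm (y - t) < d" for y
    proof (cases y t rule: linorder_cases)
      case equal
      then show ?thesis by simp
    next
      case greater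
      define k where "k = y - t"
      have k: "0 < k" "k < d1" "y = t + k" using greater y d unfolding k_def by auto
      have "integral {t..y} h = integral {t..y} f"
        using greater y d t by (intro integral_cong) (auto simp: h_def)
      moreover have "integral {a..t} f + integral {t..y} f = integral {a..y} f"
        using greater y d t fint[of a y] by (intro Henstock_Kurzweil_Integration.integral_combine) auto
      ultimately have "integral {t..y} h = integral {a..y} f - integral {a..t} f"
        by (simp add: algebra_simps)
      with sc[OF k(1) d1(2)[OF k(1,2)]] show ?thesis using k t by (simp add: h_def)
    next
      case less
      define k where "k = t - y"
      have k: "0 < k" "k < d2" "y = t - k" using less y d unfolding k_def by auto
      have "integral {-t..-t+k} (\<lambda>x. h (- x)) = integral {y..t} h"
        using Henstock_Kurzweil_Integration.integral_reflect_real[of t y h] k by simp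
      also have "\<dots> = integral {y..t} f"
        using less y d t by (intro integral_cong) (auto simp: h_def)
      also have "integral {a..y} f + \<dots> = integral {a..t} f"
        using less y d t fint[of a t] by (intro Henstock_Kurzweil_Integration.integral_combine) auto
      finally have I: "integral {-t..-t+k} (\<lambda>x. h (- x)) = integral {a..t} f - integral {a..y} f"
        by (simp add: algebra_simps)
      have "norm (integral {a..y} f - integral {a..t} f - (y - t) *\<^sub>R f t)
          = norm ((integral {a..t} f - integral {a..y} f) - k *\<^sub>R f t)"
        by (subst norm_minus_cancel[symmetric]) (simp add: k_def algebra_simps)
      with sc[OF k(1) d2(2)[OF k(1,2)]] show ?thesis using k t unfolding I by (simp add: h_def)
    qed
    then show "\<exists>d>0. \<forall>y. norm (y - t) < d \<longrightarrow>
        norm (integral {a..y} f - integral {a..t} f - (y - t) *\<^sub>R f t) \<le> e * norm (y - t)"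
      using d(1) by blast
  qed (rule bounded_linear_scaleR_left)
  have "negligible (N1 \<union> uminus ` N2)"
    using N1(1) N2(1) by (simp add: negligible_Un negligible_linear_singular_image negligible_differentiable_image_negligible
      differentiable_on_minus)
  then have "AE t in lebesgue. t \<notin> N1 \<union> uminus ` N2"
    by (intro AE_not_in) (simp add: negligible_iff_null_sets)
  then show ?thesis
  proof eventually_elim
    case (elim t)
    then have "- t \<notin> N2" by (metis UnCI image_eqI minus_minus)
    with elim show ?case using deriv[of t] by auto
  qed
qed

section \<open>Densities and primitives\<close>

lemma absolutely_integrable_imp_integrable_sub:
  fixes f :: "real \<Rightarrow> 'b::euclidean_space"
  assumes "f absolutely_integrable_on {a..b}" "a \<le> c" "d \<le> b"
  shows "f integrable_on {c..d}"
proof (rule integrable_on_subinterval[OF set_lebesgue_integral_eq_integral(1)[OF assms(1)]])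
  show "{c..d} \<subseteq> {a..b}" using assms(2,3) by auto
qed

lemma division_interval_boundsE:
  fixes D :: "real set set"
  assumes "D division_of \<Union>D" "\<Union>D \<subseteq> {a..b}" "K \<in> D"
  obtains c d where "a \<le> c" "c \<le> d" "d \<le> b" "K = {c..d}" "Inf K = c" "Sup K = d"
proof (rule division_intervalE[OF assms(1,3)])
  fix c d assume cd: "c \<le> d" "K = {c..d}" "Inf K = c" "Sup K = d"
  have "K \<subseteq> {a..b}" using assms(2,3) by blast
  then show ?thesis using that cd by auto
qed

text \<open>By Jordan decomposition: \<open>F\<close> is the difference of its variation and of the monotone function
  \<open>variation F a - F\<close>, both absolutely continuous.\<close>

lemma real_AC_density:
  fixes F :: "real \<Rightarrow> real"
  assumes ab: "a \<le> b" and AC: "AC_on a b F"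
  obtains f where "f absolutely_integrable_on {a..b}" "\<And>t. t \<in> {a..b} \<Longrightarrow> integral {a..t} f = F t - F a"
proof -
  let ?V = "variation F a"
  have V: "\<bar>F t - F s\<bar> \<le> ?V t - ?V s" if "a \<le> s" "s \<le> t" "t \<le> b" for s t
    using variation_increment_ge[OF AC that] by simp
  have m1: "?V s \<le> ?V t" and m2: "?V s - F s \<le> ?V t - F t" if "a \<le> s" "s \<le> t" "t \<le> b" for s t
    using V[OF that] by linarith+
  obtain f1 where f1: "f1 absolutely_integrable_on {a..b}" "\<And>t. t \<in> {a..b} \<Longrightarrow> integral {a..t} f1 = ?V t - ?V a"
    using monotone_AC_density[OF ab AC_on_variation[OF AC] m1] by blast
  obtain f2 where f2: "f2 absolutely_integrable_on {a..b}"
    "\<And>t. t \<in> {a..b} \<Longrightarrow> integral {a..t} f2 = (?V t - F t) - (?V a - F a)"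
    using monotone_AC_density[OF ab AC_on_diff[OF AC_on_variation[OF AC] AC] m2] by blast
  show ?thesis
  proof
    show "(\<lambda>x. f1 x - f2 x) absolutely_integrable_on {a..b}"
      using f1(1) f2(1) by (rule set_integral_diff)
    fix t assume t: "t \<in> {a..b}"
    have "f1 integrable_on {a..t}" "f2 integrable_on {a..t}"
      using t absolutely_integrable_imp_integrable_sub[OF f1(1)] absolutely_integrable_imp_integrable_sub[OF f2(1)] by auto
    then show "integral {a..t} (\<lambda>x. f1 x - f2 x) = F t - F a"
      using f1(2)[OF t] f2(2)[OF t] by (simp add: Henstock_Kurzweil_Integration.integral_diff)
  qed
qed

lemma AC_on_bounded_image:
  assumes AC: "AC_on a b F" and K: "K \<ge> 0"
    and le: "\<And>s t. a \<le> s \<Longrightarrow> s \<le> t \<Longrightarrow> t \<le> b \<Longrightarrow> norm (G t - G s) \<le> K * norm (F t - F s)"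
  shows "AC_on a b G"
  unfolding AC_on_iff
proof (intro allI impI)
  fix e :: real assume e: "e > 0"
  then have "e / (K + 1) > 0" using K by simp
  from AC_onE[OF AC this] obtain d where d: "d > 0" "\<And>D. D division_of \<Union>D \<Longrightarrow> \<Union>D \<subseteq> {a..b} \<Longrightarrow>
     measure lebesgue (\<Union>D) < d \<Longrightarrow> increments F D < e / (K + 1)" by blast
  have "increments G D < e" if D: "D division_of \<Union>D" "\<Union>D \<subseteq> {a..b}" "measure lebesgue (\<Union>D) < d" for D
  proof -
    have "increments G D \<le> K * increments F D"
      unfolding increments_def sum_distrib_left
    proof (rule sum_mono)
      fix K' assume K': "K' \<in> D"
      then obtain c r where cr: "a \<le> c" "c \<le> r" "r \<le> b" "Inf K' = c" "Sup K' = r"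
        using division_interval_boundsE[OF D(1,2)] by blast
      then show "norm (G (Sup K') - G (Inf K')) \<le> K * norm (F (Sup K') - F (Inf K'))"
        using le cr by simp
    qed
    also have "\<dots> \<le> K * (e / (K + 1))"
      using d(2)[OF D] K by (intro mult_left_mono) auto
    also have "\<dots> < e" using e K by (simp add: field_simps)
    finally show ?thesis .
  qed
  then show "\<exists>\<delta>>0. \<forall>D. D division_of \<Union>D \<longrightarrow> \<Union>D \<subseteq> {a..b} \<longrightarrow>
     measure lebesgue (\<Union>D) < \<delta> \<longrightarrow> increments G D < e" using d(1) by blast
qed

lemma AC_density:
  fixes F :: "real \<Rightarrow> 'b::euclidean_space"
  assumes ab: "a \<le> b" and AC: "AC_on a b F"
  obtains f where "f absolutely_integrable_on {a..b}" "\<And>t. t \<in> {a..b} \<Longrightarrow> integral {a..t} f = F t - F a"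
proof -
  have "\<exists>f. f absolutely_integrable_on {a..b} \<and> (\<forall>t\<in>{a..b}. integral {a..t} f = F t \<bullet> i - F a \<bullet> i)" if "i \<in> Basis" for i :: 'b
  proof -
    have "AC_on a b (\<lambda>t. F t \<bullet> i)"
      by (rule AC_on_bounded_image[OF AC, of 1]) (auto simp: inner_diff_left[symmetric] Basis_le_norm that)
    from real_AC_density[OF ab this] show ?thesis by metis
  qed
  then obtain f where f: "\<And>i. i \<in> Basis \<Longrightarrow> f i absolutely_integrable_on {a..b}"
    "\<And>i t. i \<in> Basis \<Longrightarrow> t \<in> {a..b} \<Longrightarrow> integral {a..t} (f i) = F t \<bullet> i - F a \<bullet> (i::'b)"
    by metis
  show ?thesis
  proof
    show "(\<lambda>x. \<Sum>i\<in>Basis. f i x *\<^sub>R i) absolutely_integrable_on {a..b}"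
    proof (intro absolutely_integrable_sum finite_Basis)
      fix i :: 'b assume "i \<in> Basis"
      from absolutely_integrable_linear[OF f(1)[OF this] bounded_linear_scaleR_left[of i]]
      show "(\<lambda>x. f i x *\<^sub>R i) absolutely_integrable_on {a..b}" by (simp add: o_def)
    qed
    fix t assume t: "t \<in> {a..b}"
    have fi: "(f i has_integral (F t \<bullet> i - F a \<bullet> i)) {a..t}" if "i \<in> Basis" for i :: 'b
    proof -
      have "f i integrable_on {a..t}"
        using t absolutely_integrable_imp_integrable_sub[OF f(1)[OF that]] by auto
      then show ?thesis using f(2)[OF that t] by (simp add: has_integral_integral)
    qed
    have "((\<lambda>x. \<Sum>i\<in>Basis. f i x *\<^sub>R i) has_integral (\<Sum>i\<in>Basis. (F t \<bullet> i - F a \<bullet> i) *\<^sub>R i)) {a..t}"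
      by (intro has_integral_sum finite_Basis has_integral_scaleR_left fi)
    also have "(\<Sum>i\<in>Basis. (F t \<bullet> i - F a \<bullet> i) *\<^sub>R i) = F t - F a"
      by (simp add: inner_diff_left[symmetric] euclidean_representation)
    finally show "integral {a..t} (\<lambda>x. \<Sum>i\<in>Basis. f i x *\<^sub>R i) = F t - F a" by (rule integral_unique)
  qed
qed

text \<open>Truncating the integrand at a large height costs little, and the truncated integrand has a
  Lipschitz primitive.\<close>

lemma AC_on_integral:
  fixes f :: "real \<Rightarrow> 'b::euclidean_space"
  assumes f: "f absolutely_integrable_on {a..b}"
  shows "AC_on a b (\<lambda>t. integral {a..t} f)"
  unfolding AC_on_iff
proof (intro allI impI)
  fix e :: real assume e: "e > 0"
  define g where "g x = norm (f x)" for x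
  have g: "g absolutely_integrable_on {a..b}" unfolding g_def using f by (rule absolutely_integrable_norm[unfolded o_def])
  then have gi: "g integrable_on {a..b}" by (rule set_lebesgue_integral_eq_integral(1))
  define h where "h k x = min (g x) (real k)" for k x
  have h: "h k absolutely_integrable_on {a..b}" for k
    unfolding h_def by (intro absolutely_integrable_min_1 g absolutely_integrable_on_const) auto
  then have hi: "h k integrable_on {a..b}" for k by (rule set_lebesgue_integral_eq_integral(1))
  have "(\<lambda>k. integral {a..b} (h k)) \<longlonglongrightarrow> integral {a..b} g"
  proof (rule dominated_convergence(2)[OF hi gi])
    show "norm (h k x) \<le> g x" for k x by (simp add: h_def g_def)
    fix x
    obtain N where N: "g x \<le> real N" using real_arch_simple by blast
    have "\<forall>\<^sub>F k in sequentially. h k x = g x"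
      using eventually_ge_at_top[of N] by eventually_elim (use N in \<open>auto simp: h_def min_def\<close>)
    then show "(\<lambda>k. h k x) \<longlonglongrightarrow> g x" by (rule tendsto_eventually)
  qed
  then have "\<forall>\<^sub>F k in sequentially. dist (integral {a..b} (h k)) (integral {a..b} g) < e/2"
    using e by (intro tendstoD) auto
  then obtain k where k: "dist (integral {a..b} (h k)) (integral {a..b} g) < e/2"
    by (meson eventually_sequentially order_refl)
  have "increments (\<lambda>t. integral {a..t} f) D < e"
    if D: "D division_of \<Union>D" "\<Union>D \<subseteq> {a..b}" "measure lebesgue (\<Union>D) < e / (2 * (real k + 1))" for D
  proof -
    have sub: "f integrable_on K" "g integrable_on K" "h k integrable_on K" if KD: "K \<in> D" for K
    proof -
      obtain c d where "a \<le> c" "c \<le> d" "d \<le> b" "K = {c..d}" "Inf K = c" "Sup K = d"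
        by (rule division_interval_boundsE[OF D(1,2) KD])
      then show "f integrable_on K" "g integrable_on K" "h k integrable_on K"
        using f g h by (auto intro: absolutely_integrable_imp_integrable_sub)
    qed
    have "increments (\<lambda>t. integral {a..t} f) D \<le> (\<Sum>K\<in>D. integral K g)"
      unfolding increments_def
    proof (rule sum_mono)
      fix K assume K: "K \<in> D"
      then obtain c d where cd: "a \<le> c" "c \<le> d" "d \<le> b" "K = {c..d}" "Inf K = c" "Sup K = d"
        using division_interval_boundsE[OF D(1,2)] by blast
      have "f integrable_on {a..d}"
        using cd f by (auto intro: absolutely_integrable_imp_integrable_sub)
      then have "integral {a..c} f + integral {c..d} f = integral {a..d} f"
        using cd by (intro Henstock_Kurzweil_Integration.integral_combine) auto
      then have "integral {a..d} f - integral {a..c} f = integral K f" using cd by (simp add: algebra_simps)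
      moreover have "norm (integral K f) \<le> integral K g"
        using sub[OF K] by (intro Henstock_Kurzweil_Integration.integral_norm_bound_integral) (auto simp: g_def)
      ultimately show "norm (integral {a..Sup K} f - integral {a..Inf K} f) \<le> integral K g" using cd by simp
    qed
    also have "\<dots> = (\<Sum>K\<in>D. integral K (\<lambda>x. g x - h k x)) + (\<Sum>K\<in>D. integral K (h k))"
      using sub by (simp add: Henstock_Kurzweil_Integration.integral_diff sum_subtractf)
    finally have le: "increments (\<lambda>t. integral {a..t} f) D
      \<le> (\<Sum>K\<in>D. integral K (\<lambda>x. g x - h k x)) + (\<Sum>K\<in>D. integral K (h k))" .
    have "(\<Sum>K\<in>D. integral K (\<lambda>x. g x - h k x)) = integral (\<Union>D) (\<lambda>x. g x - h k x)"
      using sub by (intro integral_combine_division_bottomup[OF D(1), symmetric] integrable_diff)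
    moreover have "integral (\<Union>D) (\<lambda>x. g x - h k x) \<le> integral {a..b} (\<lambda>x. g x - h k x)"
    proof (rule integral_subset_le[OF D(2)])
      show "(\<lambda>x. g x - h k x) integrable_on \<Union>D"
      proof (rule integrable_combine_division[OF D(1)])
        show "(\<lambda>x. g x - h k x) integrable_on K" if "K \<in> D" for K
          by (rule integrable_diff[OF sub(2,3)[OF that]])
      qed
      show "(\<lambda>x. g x - h k x) integrable_on {a..b}" by (rule integrable_diff[OF gi hi])
      show "\<forall>x\<in>{a..b}. 0 \<le> g x - h k x" unfolding h_def by auto
    qed
    moreover have "integral {a..b} (\<lambda>x. g x - h k x) = integral {a..b} g - integral {a..b} (h k)"
      by (rule Henstock_Kurzweil_Integration.integral_diff[OF gi hi])
    moreover have "integral {a..b} g - integral {a..b} (h k) < e/2" using k unfolding dist_real_def by linarith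
    ultimately have 1: "(\<Sum>K\<in>D. integral K (\<lambda>x. g x - h k x)) < e/2" by linarith
    have "(\<Sum>K\<in>D. integral K (h k)) \<le> (\<Sum>K\<in>D. real k * (Sup K - Inf K))"
    proof (rule sum_mono)
      fix K assume K: "K \<in> D"
      obtain c d where cd: "c \<le> d" "K = {c..d}" "Inf K = c" "Sup K = d"
        by (rule division_intervalE[OF D(1) K])
      have "integral K (h k) \<le> integral K (\<lambda>x. real k)"
        using sub(3)[OF K] cd by (intro integral_le) (auto simp: h_def)
      then show "integral K (h k) \<le> real k * (Sup K - Inf K)" using cd by (simp add: mult.commute)
    qed
    also have "\<dots> = real k * measure lebesgue (\<Union>D)"
      using measure_division[OF D(1)] by (simp add: sum_distrib_left[symmetric])
    also have "\<dots> \<le> real k * (e / (2 * (real k + 1)))" using D(3) by (intro mult_left_mono) auto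
    also have "\<dots> \<le> e/2" using e by (simp add: field_simps)
    finally show ?thesis using le 1 by simp
  qed
  moreover have "e / (2 * (real k + 1)) > 0" using e by simp
  ultimately show "\<exists>\<delta>>0. \<forall>D. D division_of \<Union>D \<longrightarrow> \<Union>D \<subseteq> {a..b} \<longrightarrow>
     measure lebesgue (\<Union>D) < \<delta> \<longrightarrow> increments (\<lambda>t. integral {a..t} f) D < e" by blast
qed

section \<open>Absolutely continuous functions on the half-line\<close>

lemma sets_lebesgue_halfline [simp]: "{0::real..} \<in> sets lebesgue"
  by (rule sets_completionI_sets) simp

lemma AE_halfline_iff: "(AE t in halfline. P t) \<longleftrightarrow> (AE t in lebesgue. 0 < t \<longrightarrow> P t)"
proof -
  have "(AE t in halfline. P t) \<longleftrightarrow> (AE t in lebesgue. t \<in> {0..} \<longrightarrow> P t)"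
    by (rule AE_restrict_space_iff) simp
  also have "\<dots> \<longleftrightarrow> (AE t in lebesgue. 0 < t \<longrightarrow> P t)"
  proof -
    have "{0::real} \<in> null_sets lebesgue" using negligible_sing negligible_iff_null_sets by blast
    from AE_not_in[OF this] have *: "AE t in lebesgue. t \<noteq> (0::real)" by simp
    show ?thesis
    proof
      assume "AE t in lebesgue. t \<in> {0..} \<longrightarrow> P t"
      then show "AE t in lebesgue. 0 < t \<longrightarrow> P t" by eventually_elim auto
    next
      assume "AE t in lebesgue. 0 < t \<longrightarrow> P t"
      with * show "AE t in lebesgue. t \<in> {0..} \<longrightarrow> P t" by eventually_elim auto
    qed
  qed
  finally show ?thesis .
qed

lemma AE_halfline_negligibleE:
  assumes "AE t in halfline. P t"
  obtains N where "negligible N" "\<And>t. t \<ge> 0 \<Longrightarrow> t \<notin> N \<Longrightarrow> P t"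
proof -
  obtain N where N: "\<And>t. t \<in> space lebesgue - N \<Longrightarrow> 0 < t \<longrightarrow> P t" "N \<in> null_sets lebesgue"
    using AE_E3[OF assms[unfolded AE_halfline_iff]] by blast
  show ?thesis
  proof (rule that)
    show "negligible (insert 0 N)" using N(2) by (simp add: negligible_iff_null_sets)
    show "P t" if "t \<ge> 0" "t \<notin> insert 0 N" for t
      using that N(1)[of t] by simp
  qed
qed

lemma integral_cong_AE_halfline:
  fixes f g :: "real \<Rightarrow> 'b::euclidean_space"
  assumes "AE t in halfline. f t = g t" "0 \<le> a"
  shows "integral {a..b} f = integral {a..b} g"
proof -
  obtain N where N: "negligible N" "\<And>t. t \<ge> 0 \<Longrightarrow> t \<notin> N \<Longrightarrow> f t = g t"
    using AE_halfline_negligibleE[OF assms(1)] by blast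
  show ?thesis using N assms(2) by (intro integral_spike[OF N(1)]) auto
qed

lemma locally_integrable_cong_AE:
  fixes f g :: "real \<Rightarrow> 'b::euclidean_space"
  assumes "AE t in halfline. f t = g t" "locally_integrable f"
  shows "locally_integrable g"
proof -
  obtain N where N: "negligible N" "\<And>t. t \<ge> 0 \<Longrightarrow> t \<notin> N \<Longrightarrow> f t = g t"
    using AE_halfline_negligibleE[OF assms(1)] by blast
  show ?thesis
    unfolding locally_integrable_def
  proof (intro allI impI)
    fix b :: real assume "0 \<le> b"
    then have "f absolutely_integrable_on {0..b}" using assms(2) unfolding locally_integrable_def by blast
    then show "g absolutely_integrable_on {0..b}"
      by (rule absolutely_integrable_spike[OF _ N(1)]) (simp add: N(2))
  qed
qed

lemma locally_integrable_integrable: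
  assumes "locally_integrable f" "0 \<le> a"
  shows "f integrable_on {a..b}"
proof (cases "0 \<le> b")
  case True
  with assms(1) have "f absolutely_integrable_on {0..b}" unfolding locally_integrable_def by blast
  then show ?thesis using assms(2) by (rule absolutely_integrable_imp_integrable_sub) simp
qed (use assms in \<open>auto simp: integrable_on_empty\<close>)

text \<open>Local absolute continuity is used only in this integrated form: \<open>AC_loc F\<close> is equivalent to
  \<open>F\<close> being a primitive of a locally integrable function, namely of its derivative.\<close>

definition primitive :: "(real \<Rightarrow> 'b::euclidean_space) \<Rightarrow> (real \<Rightarrow> 'b) \<Rightarrow> bool" where
  "primitive F f \<longleftrightarrow> locally_integrable f \<and> (\<forall>t\<ge>0. F t = F 0 + integral {0..t} f)"

lemma
  assumes "primitive F f"
  shows primitive_locally_integrable: "locally_integrable f"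
    and primitive_eq: "0 \<le> t \<Longrightarrow> F t = F 0 + integral {0..t} f"
  using assms unfolding primitive_def by blast+

lemma primitive_increment:
  assumes "primitive F f" "0 \<le> s" "s \<le> t"
  shows "F t - F s = integral {s..t} f"
proof -
  have "integral {0..s} f + integral {s..t} f = integral {0..t} f"
    using assms locally_integrable_integrable[OF primitive_locally_integrable[OF assms(1)]]
    by (intro Henstock_Kurzweil_Integration.integral_combine) auto
  moreover have "F s = F 0 + integral {0..s} f" "F t = F 0 + integral {0..t} f"
    using assms primitive_eq[OF assms(1), of s] primitive_eq[OF assms(1), of t] by linarith+
  ultimately show ?thesis by (simp add: algebra_simps)
qed

lemma primitive_imp_AC_loc:
  assumes "primitive F f"
  shows "AC_loc F"
  unfolding AC_loc_def
proof (intro allI impI)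
  fix b :: real assume "0 \<le> b"
  then have 1: "AC_on 0 b (\<lambda>t. integral {0..t} f)"
    using primitive_locally_integrable[OF assms] unfolding locally_integrable_def by (intro AC_on_integral) blast
  have 2: "norm (F t - F s) \<le> 1 * norm (integral {0..t} f - integral {0..s} f)" if "0 \<le> s" "s \<le> t" for s t
    using primitive_eq[OF assms, of s] primitive_eq[OF assms, of t] that by simp
  show "AC_on 0 b F" by (rule AC_on_bounded_image[OF 1 zero_le_one]) (rule 2)
qed

lemma primitive_derivative_AE:
  assumes "primitive F f"
  shows "AE t in halfline. (F has_vector_derivative f t) (at t)"
proof -
  have "AE t in lebesgue. \<forall>n::nat. t \<in> {0<..<real n} \<longrightarrow> ((\<lambda>u. integral {0..u} f) has_vector_derivative f t) (at t)"
    unfolding AE_all_countable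
    by (intro allI indefinite_integral_derivative_AE locally_integrable_integrable
        primitive_locally_integrable[OF assms]) simp
  then show ?thesis
    unfolding AE_halfline_iff
  proof eventually_elim
    case (elim t)
    show ?case
    proof
      assume t: "0 < t"
      obtain n :: nat where "t < real n" using reals_Archimedean2 by blast
      with elim t have "((\<lambda>u. integral {0..u} f) has_vector_derivative f t) (at t)" by auto
      then have "((\<lambda>u. F 0 + integral {0..u} f) has_vector_derivative f t) (at t)"
        by (auto intro!: derivative_eq_intros)
      then show "(F has_vector_derivative f t) (at t)"
      proof (rule has_vector_derivative_transform_within_open[of _ _ _ "{0<..}"])
        show "open {0::real<..}" "t \<in> {0<..}" using t by auto
        show "F 0 + integral {0..u} f = F u" if "u \<in> {0<..}" for u
          using that primitive_eq[OF assms, of u] by simp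
      qed
    qed
  qed
qed

text \<open>The density of \<open>F\<close> on \<open>{0..b}\<close> agrees almost everywhere with the derivative of \<open>F\<close>, which does not
  depend on \<open>b\<close>; this glues the densities on bounded intervals to one function on the half-line.\<close>

lemma AC_loc_imp_derivative:
  fixes F :: "real \<Rightarrow> 'b::euclidean_space"
  assumes "AC_loc F"
  shows AC_loc_primitive: "primitive F (\<lambda>t. vector_derivative F (at t))"
    and AC_loc_derivative_AE: "AE t in halfline. (F has_vector_derivative vector_derivative F (at t)) (at t)"
proof -
  let ?f = "\<lambda>t. vector_derivative F (at t)"
  have part: "(\<forall>t\<in>{0..b}. F t = F 0 + integral {0..t} ?f) \<and> ?f absolutely_integrable_on {0..b} \<and>
     (AE t in lebesgue. t \<in> {0<..<b} \<longrightarrow> (F has_vector_derivative ?f t) (at t))" if b: "0 \<le> b" for b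
  proof -
    obtain f where f: "f absolutely_integrable_on {0..b}" "\<And>t. t \<in> {0..b} \<Longrightarrow> integral {0..t} f = F t - F 0"
      using AC_density[OF b] assms b unfolding AC_loc_def by blast
    have "AE t in lebesgue. t \<in> {0<..<b} \<longrightarrow> ((\<lambda>u. integral {0..u} f) has_vector_derivative f t) (at t)"
      by (intro indefinite_integral_derivative_AE set_lebesgue_integral_eq_integral(1) f(1))
    then have D: "AE t in lebesgue. t \<in> {0<..<b} \<longrightarrow> (F has_vector_derivative f t) (at t)"
    proof eventually_elim
      case (elim t)
      show ?case
      proof
        assume t: "t \<in> {0<..<b}"
        with elim have "((\<lambda>u. F 0 + integral {0..u} f) has_vector_derivative f t) (at t)"
          by (auto intro!: derivative_eq_intros)
        then show "(F has_vector_derivative f t) (at t)"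
          by (rule has_vector_derivative_transform_within_open[of _ _ _ "{0<..<b}"]) (use t f(2) in auto)
      qed
    qed
    then obtain N where N: "\<And>t. t \<in> space lebesgue - N \<Longrightarrow> t \<in> {0<..<b} \<longrightarrow> (F has_vector_derivative f t) (at t)"
        "N \<in> null_sets lebesgue"
      using AE_E3 by blast
    define M where "M = N \<union> {0, b}"
    have M: "negligible M" using N(2) by (simp add: negligible_iff_null_sets[symmetric] M_def negligible_Un)
    have eq: "?f t = f t" if "t \<in> {0..b} - M" for t
      using that N(1)[of t] unfolding M_def by (intro vector_derivative_at) auto
    have "?f absolutely_integrable_on {0..b}"
      by (rule absolutely_integrable_spike[OF f(1) M eq])
    moreover have "F t = F 0 + integral {0..t} ?f" if "t \<in> {0..b}" for t
    proof -
      have "integral {0..t} ?f = integral {0..t} f"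
        using that by (intro integral_spike[OF M]) (simp add: eq)
      then show ?thesis using f(2)[OF that] by simp
    qed
    moreover have "AE t in lebesgue. t \<in> {0<..<b} \<longrightarrow> (F has_vector_derivative ?f t) (at t)"
      using D by eventually_elim (auto simp: vector_derivative_at)
    ultimately show ?thesis by blast
  qed
  show "primitive F ?f"
    unfolding primitive_def locally_integrable_def
  proof (intro conjI allI impI)
    show "?f absolutely_integrable_on {0..b}" if "0 \<le> b" for b using part[OF that] by blast
    show "F t = F 0 + integral {0..t} ?f" if "0 \<le> t" for t using part[OF that] that by (meson atLeastAtMost_iff order_refl)
  qed
  have "AE t in lebesgue. \<forall>n::nat. t \<in> {0<..<real n} \<longrightarrow> (F has_vector_derivative ?f t) (at t)"
    unfolding AE_all_countable using part[OF of_nat_0_le_iff] by blast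
  then show "AE t in halfline. (F has_vector_derivative ?f t) (at t)"
    unfolding AE_halfline_iff
  proof eventually_elim
    case (elim t)
    obtain n :: nat where "t < real n" using reals_Archimedean2 by blast
    with elim show ?case by auto
  qed
qed

lemma primitiveI:
  assumes F: "AC_loc F" and D: "AE t in halfline. (F has_vector_derivative f t) (at t)"
  shows "primitive F f"
proof -
  have eq: "AE t in halfline. vector_derivative F (at t) = f t"
    using D by eventually_elim (rule vector_derivative_at)
  note P = AC_loc_primitive[OF F]
  show ?thesis
    unfolding primitive_def
  proof (intro conjI allI impI)
    show "locally_integrable f" by (rule locally_integrable_cong_AE[OF eq primitive_locally_integrable[OF P]])
    show "F t = F 0 + integral {0..t} f" if "0 \<le> t" for t
      unfolding integral_cong_AE_halfline[OF eq order_refl, symmetric] by (rule primitive_eq[OF P that])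
  qed
qed

lemma AC_loc_continuous_on:
  fixes F :: "real \<Rightarrow> 'b::euclidean_space"
  assumes "AC_loc F"
  shows "continuous_on {0..} F"
proof -
  have P: "primitive F (\<lambda>t. vector_derivative F (at t))" by (rule AC_loc_primitive[OF assms])
  have c: "continuous_on {0..b} F" if "0 \<le> b" for b
  proof (rule continuous_on_eq)
    show "continuous_on {0..b} (\<lambda>t. F 0 + integral {0..t} (\<lambda>t. vector_derivative F (at t)))"
      by (intro continuous_intros indefinite_integral_continuous_1 locally_integrable_integrable
          primitive_locally_integrable[OF P]) simp
    show "F 0 + integral {0..t} (\<lambda>t. vector_derivative F (at t)) = F t" if "t \<in> {0..b}" for t
      using primitive_eq[OF P, of t] that by simp
  qed
  show ?thesis
    unfolding continuous_on_eq_continuous_within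
  proof
    fix t :: real assume t: "t \<in> {0..}"
    then have "continuous (at t within {0..t+1}) F"
      using c[of "t+1"] by (simp add: continuous_on_eq_continuous_within)
    moreover have "at t within {0..} = at t within {0..t+1}"
      by (rule at_within_nhd[of _ "{..<t+1}"]) auto
    ultimately show "continuous (at t within {0..}) F" by simp
  qed
qed

lemma AC_loc_bounded_image:
  assumes AC: "AC_loc F" and K: "K \<ge> 0"
    and le: "\<And>s t. 0 \<le> s \<Longrightarrow> s \<le> t \<Longrightarrow> norm (G t - G s) \<le> K * norm (F t - F s)"
  shows "AC_loc G"
  unfolding AC_loc_def
proof (intro allI impI)
  fix b :: real assume "0 \<le> b"
  with AC have "AC_on 0 b F" unfolding AC_loc_def by blast
  then show "AC_on 0 b G" by (rule AC_on_bounded_image[OF _ K]) (rule le)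
qed

lemma AC_loc_const: "AC_loc (\<lambda>t. c)"
  unfolding AC_loc_def AC_on_iff increments_def by (simp add: exI[of _ 1])

lemma AC_loc_cong:
  assumes "AC_loc F" "\<And>t. t \<ge> 0 \<Longrightarrow> F t = G t"
  shows "AC_loc G"
proof (rule AC_loc_bounded_image[OF assms(1) zero_le_one])
  fix s t :: real assume "0 \<le> s" "s \<le> t"
  then show "norm (G t - G s) \<le> 1 * norm (F t - F s)" using assms(2)[of s] assms(2)[of t] by simp
qed

lemma AC_loc_linear:
  assumes "bounded_linear h" "AC_loc F"
  shows "AC_loc (\<lambda>t. h (F t))"
proof -
  obtain K where K: "K > 0" "\<And>x. norm (h x) \<le> norm x * K" using bounded_linear.pos_bounded[OF assms(1)] by blast
  show ?thesis
  proof (rule AC_loc_bounded_image[OF assms(2), of K])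
    show "norm (h (F t) - h (F s)) \<le> K * norm (F t - F s)" for s t
      using K(2)[of "F t - F s"] by (simp add: linear_simps[OF assms(1)] mult.commute)
  qed (use K in simp)
qed

lemma AC_loc_bilinear:
  fixes F :: "real \<Rightarrow> 'b::euclidean_space" and G :: "real \<Rightarrow> 'c::euclidean_space"
  assumes h: "bounded_bilinear h" and F: "AC_loc F" and G: "AC_loc G"
  shows "AC_loc (\<lambda>t. h (F t) (G t))"
  unfolding AC_loc_def
proof (intro allI impI)
  fix b :: real assume b: "0 \<le> b"
  obtain K where K: "K > 0" "\<And>x y. norm (h x y) \<le> norm x * norm y * K"
    using bounded_bilinear.pos_bounded[OF h] by blast
  have bnd: "\<exists>M>0. \<forall>t\<in>{0..b}. norm (H t) \<le> M" if "AC_loc H" for H :: "real \<Rightarrow> 'd::euclidean_space"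
  proof -
    have "continuous_on {0..b} H" using AC_loc_continuous_on[OF that] by (rule continuous_on_subset) auto
    then have "bounded (H ` {0..b})" by (intro compact_imp_bounded compact_continuous_image) auto
    then show ?thesis unfolding bounded_pos by auto
  qed
  obtain M1 where M1: "M1 > 0" "\<And>t. t \<in> {0..b} \<Longrightarrow> norm (F t) \<le> M1" using bnd[OF F] by blast
  obtain M2 where M2: "M2 > 0" "\<And>t. t \<in> {0..b} \<Longrightarrow> norm (G t) \<le> M2" using bnd[OF G] by blast
  have Lip: "norm (h (F t) (G t) - h (F s) (G s)) \<le> K * M2 * norm (F t - F s) + K * M1 * norm (G t - G s)"
    if "s \<in> {0..b}" "t \<in> {0..b}" for s t
  proof -
    have "h (F t) (G t) - h (F s) (G s) = h (F t - F s) (G t) + h (F s) (G t - G s)"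
      by (simp add: bounded_bilinear.diff_left[OF h] bounded_bilinear.diff_right[OF h])
    also have "norm \<dots> \<le> norm (F t - F s) * norm (G t) * K + norm (F s) * norm (G t - G s) * K"
      by (intro norm_triangle_le add_mono K(2))
    also have "\<dots> \<le> norm (F t - F s) * M2 * K + M1 * norm (G t - G s) * K"
      using M1(2)[OF that(1)] M2(2)[OF that(2)] K(1)
      by (intro add_mono mult_right_mono mult_left_mono) auto
    finally show ?thesis by (simp add: mult_ac)
  qed
  show "AC_on 0 b (\<lambda>t. h (F t) (G t))"
    unfolding AC_on_iff
  proof (intro allI impI)
    fix e :: real assume e: "e > 0"
    have e1: "e / (2 * (K * M2)) > 0" and e2: "e / (2 * (K * M1)) > 0" using e K M1 M2 by auto
    obtain d1 d2 where d: "d1 > 0" "\<And>D. D division_of \<Union>D \<Longrightarrow> \<Union>D \<subseteq> {0..b} \<Longrightarrow>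
        measure lebesgue (\<Union>D) < d1 \<Longrightarrow> increments F D < e / (2 * (K * M2))"
      "d2 > 0" "\<And>D. D division_of \<Union>D \<Longrightarrow> \<Union>D \<subseteq> {0..b} \<Longrightarrow>
        measure lebesgue (\<Union>D) < d2 \<Longrightarrow> increments G D < e / (2 * (K * M1))"
      using AC_onE[OF F[unfolded AC_loc_def, rule_format, OF b] e1]
        AC_onE[OF G[unfolded AC_loc_def, rule_format, OF b] e2] by metis
    have "increments (\<lambda>t. h (F t) (G t)) D < e"
      if D: "D division_of \<Union>D" "\<Union>D \<subseteq> {0..b}" "measure lebesgue (\<Union>D) < min d1 d2" for D
    proof -
      have "increments (\<lambda>t. h (F t) (G t)) D \<le> K * M2 * increments F D + K * M1 * increments G D"
        unfolding increments_def sum_distrib_left sum.distrib[symmetric]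
      proof (rule sum_mono)
        fix L assume "L \<in> D"
        then obtain c d where "0 \<le> c" "c \<le> d" "d \<le> b" "Inf L = c" "Sup L = d"
          using division_interval_boundsE[OF D(1,2)] by blast
        then show "norm (h (F (Sup L)) (G (Sup L)) - h (F (Inf L)) (G (Inf L)))
            \<le> K * M2 * norm (F (Sup L) - F (Inf L)) + K * M1 * norm (G (Sup L) - G (Inf L))"
          by (intro Lip) auto
      qed
      also have "\<dots> < K * M2 * (e / (2 * (K * M2))) + K * M1 * (e / (2 * (K * M1)))"
        using d(2)[OF D(1,2)] d(4)[OF D(1,2)] D(3) K(1) M1(1) M2(1)
        by (intro add_strict_mono mult_strict_left_mono) auto
      also have "\<dots> = e" using K(1) M1(1) M2(1) by (simp add: field_simps)
      finally show ?thesis .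
    qed
    then show "\<exists>\<delta>>0. \<forall>D. D division_of \<Union>D \<longrightarrow> \<Union>D \<subseteq> {0..b} \<longrightarrow>
       measure lebesgue (\<Union>D) < \<delta> \<longrightarrow> increments (\<lambda>t. h (F t) (G t)) D < e"
      using d(1,3) by (intro exI[of _ "min d1 d2"]) auto
  qed
qed

lemma AC_loc_add:
  fixes F G :: "real \<Rightarrow> 'b::euclidean_space"
  assumes "AC_loc F" "AC_loc G"
  shows "AC_loc (\<lambda>t. F t + G t)"
proof -
  note G = AC_loc_linear[OF bounded_linear_minus[OF bounded_linear_ident] assms(2)]
  have "AC_loc (\<lambda>t. F t - (- G t))"
    unfolding AC_loc_def
  proof (intro allI impI)
    fix b :: real assume "0 \<le> b"
    with assms(1) G show "AC_on 0 b (\<lambda>t. F t - - G t)" unfolding AC_loc_def by (intro AC_on_diff) blast+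
  qed
  then show ?thesis by simp
qed

section \<open>Linear differential equations with integrable coefficients\<close>

lemma continuous_bounded_on_interval:
  fixes F :: "real \<Rightarrow> 'b::real_normed_vector"
  assumes "continuous_on {0..} F"
  obtains M where "M > 0" "\<And>t. 0 \<le> t \<Longrightarrow> t \<le> b \<Longrightarrow> norm (F t) \<le> M"
proof -
  have "continuous_on {0..b} F" using assms by (rule continuous_on_subset) auto
  then have "bounded (F ` {0..b})" by (intro compact_imp_bounded compact_continuous_image) auto
  then obtain M where "M > 0" "\<forall>x\<in>F ` {0..b}. norm x \<le> M" unfolding bounded_pos by blast
  then show ?thesis using that[of M] by simp
qed

lemma locally_integrable_bilinear:
  fixes f :: "real \<Rightarrow> 'a::euclidean_space" and g :: "real \<Rightarrow> 'b::euclidean_space"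
    and h :: "'a \<Rightarrow> 'b \<Rightarrow> 'c::euclidean_space"
  assumes h: "bounded_bilinear h" and f: "continuous_on {0..} f" and g: "locally_integrable g"
  shows "locally_integrable (\<lambda>t. h (f t) (g t))"
  unfolding locally_integrable_def
proof (intro allI impI)
  fix b :: real assume b: "0 \<le> b"
  have fb: "continuous_on {0..b} f" using f by (rule continuous_on_subset) auto
  show "(\<lambda>t. h (f t) (g t)) absolutely_integrable_on {0..b}"
  proof (rule absolutely_integrable_bounded_measurable_product[where h=h and f=f and g=g])
    show "bilinear h" using h by (simp add: bilinear_conv_bounded_bilinear)
    show "f \<in> borel_measurable (lebesgue_on {0..b})"
      by (rule continuous_imp_measurable_on_sets_lebesgue[OF fb]) simp
    show "bounded (f ` {0..b})"
      using fb by (intro compact_imp_bounded compact_continuous_image) auto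
    show "g absolutely_integrable_on {0..b}" using g b unfolding locally_integrable_def by blast
  qed simp
qed

lemma locally_integrable_bilinear_right:
  fixes f :: "real \<Rightarrow> 'a::euclidean_space" and g :: "real \<Rightarrow> 'b::euclidean_space"
    and h :: "'b \<Rightarrow> 'a \<Rightarrow> 'c::euclidean_space"
  assumes "bounded_bilinear h" "locally_integrable g" "continuous_on {0..} f"
  shows "locally_integrable (\<lambda>t. h (g t) (f t))"
  using locally_integrable_bilinear[OF bounded_bilinear.flip[OF assms(1)] assms(3,2)] .

lemma locally_integrable_norm:
  assumes "locally_integrable g"
  shows "locally_integrable (\<lambda>t. norm (g t))"
  unfolding locally_integrable_def
proof (intro allI impI)
  fix b :: real assume "0 \<le> b"
  with assms have "g absolutely_integrable_on {0..b}" unfolding locally_integrable_def by blast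
  then show "(\<lambda>t. norm (g t)) absolutely_integrable_on {0..b}" by (rule absolutely_integrable_norm[unfolded o_def])
qed

lemma locally_integrable_linear:
  assumes "bounded_linear h" "locally_integrable g"
  shows "locally_integrable (\<lambda>t. h (g t))"
  unfolding locally_integrable_def
proof (intro allI impI)
  fix b :: real assume "0 \<le> b"
  with assms(2) have "g absolutely_integrable_on {0..b}" unfolding locally_integrable_def by blast
  from absolutely_integrable_linear[OF this assms(1)]
  show "(\<lambda>t. h (g t)) absolutely_integrable_on {0..b}" by (simp add: o_def)
qed

lemma primitive_integral:
  assumes "locally_integrable f"
  shows "primitive (\<lambda>t. c + integral {0..t} f) f"
  unfolding primitive_def using assms by simp

lemma primitive_continuous_on:
  "primitive F f \<Longrightarrow> continuous_on {0..} F"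
  by (rule AC_loc_continuous_on[OF primitive_imp_AC_loc])

text \<open>The weight \<open>exp (- \<kappa> \<integral>\<bar>A\<bar>)\<close> makes the Picard operator contractive on the whole half-line,
  because of the following estimate.\<close>

lemma integral_exp_primitive:
  fixes \<alpha> :: "real \<Rightarrow> real"
  assumes a: "primitive a \<alpha>" and \<alpha>: "\<And>t. \<alpha> t \<ge> 0" and a0: "a 0 = 0" and \<kappa>: "\<kappa> > 0" and t: "0 \<le> t"
  shows "((\<lambda>r. \<alpha> r * exp (\<kappa> * a r)) has_integral (exp (\<kappa> * a t) - 1) / \<kappa>) {0..t}"
proof -
  have mono: "a r \<le> a s" if "0 \<le> r" "r \<le> s" for r s
  proof -
    have "0 \<le> integral {r..s} \<alpha>"
      using that \<alpha> by (intro Henstock_Kurzweil_Integration.integral_nonneg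
          locally_integrable_integrable[OF primitive_locally_integrable[OF a]]) auto
    then show ?thesis using primitive_increment[OF a that] by simp
  qed
  have "AC_loc (\<lambda>r. exp (\<kappa> * a r))"
    unfolding AC_loc_def
  proof (intro allI impI)
    fix b :: real assume b: "0 \<le> b"
    show "AC_on 0 b (\<lambda>r. exp (\<kappa> * a r))"
    proof (rule AC_on_bounded_image)
      show "AC_on 0 b a" using primitive_imp_AC_loc[OF a] b unfolding AC_loc_def by blast
      show "0 \<le> \<kappa> * exp (\<kappa> * a b)" using \<kappa> by simp
      fix r s :: real assume rs: "0 \<le> r" "r \<le> s" "s \<le> b"
      have le: "a r \<le> a s" "a s \<le> a b" using mono rs by auto
      have "exp (\<kappa> * a s) - exp (\<kappa> * a r) = exp (\<kappa> * a s) * (1 - exp (- (\<kappa> * (a s - a r))))"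
        by (simp add: exp_minus exp_diff field_simps)
      also have "\<dots> \<le> exp (\<kappa> * a b) * (\<kappa> * (a s - a r))"
      proof (rule mult_mono)
        show "exp (\<kappa> * a s) \<le> exp (\<kappa> * a b)" using le \<kappa> by simp
        show "1 - exp (- (\<kappa> * (a s - a r))) \<le> \<kappa> * (a s - a r)"
          using exp_ge_add_one_self[of "- (\<kappa> * (a s - a r))"] by linarith
        show "0 \<le> 1 - exp (- (\<kappa> * (a s - a r)))" using le \<kappa> by simp
      qed simp
      finally have "exp (\<kappa> * a s) - exp (\<kappa> * a r) \<le> exp (\<kappa> * a b) * (\<kappa> * (a s - a r))" .
      moreover have "exp (\<kappa> * a r) \<le> exp (\<kappa> * a s)" using le \<kappa> by simp
      ultimately show "norm (exp (\<kappa> * a s) - exp (\<kappa> * a r)) \<le> \<kappa> * exp (\<kappa> * a b) * norm (a s - a r)"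
        using le by (simp add: mult_ac)
    qed
  qed
  moreover have "AE r in halfline. ((\<lambda>r. exp (\<kappa> * a r)) has_vector_derivative \<kappa> * (\<alpha> r * exp (\<kappa> * a r))) (at r)"
    using primitive_derivative_AE[OF a]
  proof eventually_elim
    case (elim r)
    then have "(a has_real_derivative \<alpha> r) (at r)"
      by (simp add: has_real_derivative_iff_has_vector_derivative)
    then have "((\<lambda>r. exp (\<kappa> * a r)) has_real_derivative \<kappa> * (\<alpha> r * exp (\<kappa> * a r))) (at r)"
      by (auto intro!: derivative_eq_intros)
    then show ?case by (simp add: has_real_derivative_iff_has_vector_derivative)
  qed
  ultimately have P: "primitive (\<lambda>r. exp (\<kappa> * a r)) (\<lambda>r. \<kappa> * (\<alpha> r * exp (\<kappa> * a r)))"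
    by (rule primitiveI)
  have "(\<lambda>r. \<kappa> * (\<alpha> r * exp (\<kappa> * a r))) integrable_on {0..t}"
    by (rule locally_integrable_integrable[OF primitive_locally_integrable[OF P]]) simp
  then have "((\<lambda>r. \<kappa> * (\<alpha> r * exp (\<kappa> * a r))) has_integral (exp (\<kappa> * a t) - 1)) {0..t}"
    using primitive_eq[OF P t] a0 by (simp add: has_integral_integrable_integral)
  from has_integral_mult_right[OF this, of "1 / \<kappa>"] show ?thesis using \<kappa> by simp
qed

text \<open>Picard iteration in the space of bounded continuous functions. The weighted unknown
  \<open>exp (- \<kappa> a) Y\<close>, with \<open>a\<close> the primitive of \<open>\<parallel>A\<parallel>\<close> and \<open>\<kappa>\<close> twice the bound of the product, makes the operator a
  contraction with factor \<open>1/2\<close>, so one fixed point gives the global solution.\<close>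

theorem linear_ode_solution:
  fixes prod :: "'a::euclidean_space \<Rightarrow> 'b::euclidean_space \<Rightarrow> 'b" and A :: "real \<Rightarrow> 'a"
  assumes prod: "bounded_bilinear prod" and A: "locally_integrable A"
  obtains Y where "primitive Y (\<lambda>t. prod (A t) (Y t))" "Y 0 = c"
proof -
  obtain K where K: "K > 0" "\<And>x y. norm (prod x y) \<le> norm x * norm y * K"
    using bounded_bilinear.pos_bounded[OF prod] by blast
  define \<kappa> where "\<kappa> = 2 * K"
  define \<alpha> where "\<alpha> t = norm (A t)" for t
  define a where "a t = 0 + integral {0..t} \<alpha>" for t
  have \<kappa>: "\<kappa> > 0" using K by (simp add: \<kappa>_def)
  have \<alpha>: "locally_integrable \<alpha>" unfolding \<alpha>_def by (rule locally_integrable_norm[OF A])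
  have a: "primitive a \<alpha>" unfolding a_def by (rule primitive_integral[OF \<alpha>])
  have a0: "a 0 = 0" by (simp add: a_def)
  have a_pos: "0 \<le> a t" if "0 \<le> t" for t
  proof -
    have "0 \<le> integral {0..t} \<alpha>"
      by (rule Henstock_Kurzweil_Integration.integral_nonneg[OF locally_integrable_integrable[OF \<alpha> order_refl]])
        (simp add: \<alpha>_def)
    then show ?thesis by (simp add: a_def)
  qed
  note ca = primitive_continuous_on[OF a]
  \<comment> \<open>\<open>V u\<close> is the unweighted function represented by \<open>u\<close>.\<close>
  define V where "V u r = exp (\<kappa> * a r) *\<^sub>R u r" for u :: "real \<Rightarrow> 'b" and r
  have locV: "locally_integrable (\<lambda>r. prod (A r) (V u r))" if "continuous_on {0..} u" for u
    unfolding V_def by (intro locally_integrable_bilinear_right[OF prod A] continuous_intros ca that)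
  define S where "S u t = exp (- (\<kappa> * a t)) *\<^sub>R (c + integral {0..t} (\<lambda>r. prod (A r) (V u r)))" for u t
  have contS: "continuous_on {0..} (S u)" if "continuous_on {0..} u" for u
    unfolding S_def
    by (intro continuous_intros ca primitive_continuous_on[OF primitive_integral] locV that)
  have bound: "norm (exp (- (\<kappa> * a t)) *\<^sub>R integral {0..t} (\<lambda>r. prod (A r) (V u r))) \<le> M / 2"
    if u: "continuous_on {0..} u" and M: "\<And>r. 0 \<le> r \<Longrightarrow> norm (u r) \<le> M" and t: "0 \<le> t" for u M t
  proof -
    have M0: "M \<ge> 0" using M[of 0] norm_ge_zero[of "u 0"] by linarith
    have "norm (integral {0..t} (\<lambda>r. prod (A r) (V u r))) \<le> integral {0..t} (\<lambda>r. (K * M) * (\<alpha> r * exp (\<kappa> * a r)))"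
    proof (rule Henstock_Kurzweil_Integration.integral_norm_bound_integral)
      show "(\<lambda>r. prod (A r) (V u r)) integrable_on {0..t}"
        by (rule locally_integrable_integrable[OF locV[OF u]]) simp
      show "(\<lambda>r. (K * M) * (\<alpha> r * exp (\<kappa> * a r))) integrable_on {0..t}"
        using has_integral_mult_right[OF integral_exp_primitive[OF a _ a0 \<kappa> t]]
        unfolding integrable_on_def \<alpha>_def by (metis norm_ge_zero)
      fix r assume r: "r \<in> {0..t}"
      have "norm (prod (A r) (V u r)) \<le> norm (A r) * norm (V u r) * K" by (rule K(2))
      also have "\<dots> \<le> norm (A r) * (exp (\<kappa> * a r) * M) * K"
        using M[of r] r K(1) by (intro mult_right_mono mult_left_mono) (auto simp: V_def)
      finally show "norm (prod (A r) (V u r)) \<le> (K * M) * (\<alpha> r * exp (\<kappa> * a r))"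
        by (simp add: \<alpha>_def mult_ac)
    qed
    also have "\<dots> = (K * M) * ((exp (\<kappa> * a t) - 1) / \<kappa>)"
      using integral_exp_primitive[OF a _ a0 \<kappa> t]
      by (intro integral_unique has_integral_mult_right) (simp add: \<alpha>_def)
    also have "\<dots> \<le> M / 2 * exp (\<kappa> * a t)" using K(1) M0 by (simp add: \<kappa>_def field_simps)
    finally have "norm (integral {0..t} (\<lambda>r. prod (A r) (V u r))) \<le> M / 2 * exp (\<kappa> * a t)" .
    then show ?thesis by (simp add: exp_minus field_simps)
  qed
  define T where "T u t = S (apply_bcontfun u) (max t 0)" for u :: "real \<Rightarrow>\<^sub>C 'b" and t
  have T: "T u \<in> bcontfun" for u
  proof (rule bcontfun_normI)
    have "continuous_on UNIV (S (apply_bcontfun u) \<circ> (\<lambda>t. max t 0))"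
      by (intro continuous_on_compose continuous_intros) (auto intro!: continuous_on_subset[OF contS])
    then show "continuous_on UNIV (T u)" unfolding T_def by (simp add: o_def)
    show "norm (T u t) \<le> norm c + norm u / 2" for t
    proof -
      have "norm (exp (- (\<kappa> * a (max t 0))) *\<^sub>R c) \<le> 1 * norm c"
        unfolding norm_scaleR using \<kappa> a_pos[of "max t 0"] by (intro mult_right_mono) auto
      moreover have "norm (exp (- (\<kappa> * a (max t 0))) *\<^sub>R integral {0..max t 0} (\<lambda>r. prod (A r) (V (apply_bcontfun u) r))) \<le> norm u / 2"
        by (rule bound) (auto simp: norm_bounded)
      ultimately show ?thesis unfolding T_def S_def scaleR_add_right
        using norm_triangle_ineq order_trans by (smt (verit))
    qed
  qed
  have "\<exists>!u. Bcontfun (T u) = u"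
  proof (rule banach_fix_type[of "1/2"])
    show "\<forall>u v. dist (Bcontfun (T u)) (Bcontfun (T v)) \<le> 1/2 * dist u v"
    proof (intro allI dist_bound)
      fix u v :: "real \<Rightarrow>\<^sub>C 'b" and t :: real
      let ?s = "max t 0" and ?w = "\<lambda>r. apply_bcontfun u r - apply_bcontfun v r"
      have int: "(\<lambda>r. prod (A r) (V (apply_bcontfun u) r)) integrable_on {0..?s}" for u :: "real \<Rightarrow>\<^sub>C 'b"
        by (rule locally_integrable_integrable[OF locV]) simp_all
      have "integral {0..?s} (\<lambda>r. prod (A r) (V ?w r)) =
          integral {0..?s} (\<lambda>r. prod (A r) (V (apply_bcontfun u) r)) - integral {0..?s} (\<lambda>r. prod (A r) (V (apply_bcontfun v) r))"
        using Henstock_Kurzweil_Integration.integral_diff[OF int[of u] int[of v]]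
        by (simp add: V_def scaleR_diff_right bounded_bilinear.diff_right[OF prod])
      then have "T u t - T v t = exp (- (\<kappa> * a ?s)) *\<^sub>R integral {0..?s} (\<lambda>r. prod (A r) (V ?w r))"
        unfolding T_def S_def by (simp add: scaleR_diff_right[symmetric])
      also have "norm \<dots> \<le> dist u v / 2"
        using dist_bounded[of u _ v] by (intro bound continuous_intros) (auto simp: dist_norm)
      finally show "dist (apply_bcontfun (Bcontfun (T u)) t) (apply_bcontfun (Bcontfun (T v)) t) \<le> 1/2 * dist u v"
        using T by (simp add: Bcontfun_inverse dist_norm)
    qed
  qed auto
  then obtain u where u: "Bcontfun (T u) = u" by blast
  then have uT: "apply_bcontfun u t = S (apply_bcontfun u) t" if "0 \<le> t" for t
    using Bcontfun_inverse[OF T[of u]] that unfolding T_def by (metis max_absorb1)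
  define Y where "Y = V (apply_bcontfun u)"
  have Y: "Y t = c + integral {0..t} (\<lambda>r. prod (A r) (Y r))" if "0 \<le> t" for t
  proof -
    have "Y t = exp (\<kappa> * a t) *\<^sub>R S (apply_bcontfun u) t"
      unfolding Y_def V_def uT[OF that, symmetric] ..
    also have "\<dots> = c + integral {0..t} (\<lambda>r. prod (A r) (Y r))"
      unfolding S_def Y_def by (simp add: exp_minus)
    finally show ?thesis .
  qed
  have Y0: "Y 0 = c" using Y[of 0] by simp
  show ?thesis
  proof (rule that[of Y])
    show "Y 0 = c" by (rule Y0)
    show "primitive Y (\<lambda>t. prod (A t) (Y t))"
      unfolding primitive_def Y0
    proof (intro conjI allI impI)
      show "locally_integrable (\<lambda>t. prod (A t) (Y t))" unfolding Y_def by (rule locV) simp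
      show "Y t = c + integral {0..t} (\<lambda>t. prod (A t) (Y t))" if "0 \<le> t" for t by (rule Y[OF that])
    qed
  qed
qed

section \<open>Completeness and orthogonal projection\<close>

lemma l2_eq_refl_iff: "l2_eq f f \<longleftrightarrow> square_integrable f"
  by (simp add: l2_eq_def)

lemma square_integrable_rep_l2: "square_integrable (rep_l2 f)"
  using Quotient3_rel_rep[OF Quotient3_l2, of f f] by (simp add: l2_eq_def)

lemma l2_class_rep: "l2_class (rep_l2 f) = f"
  using Quotient3_abs_rep[OF Quotient3_l2] .

lemma l2_class_eq_iff:
  assumes "square_integrable f" "square_integrable g"
  shows "l2_class f = l2_class g \<longleftrightarrow> (AE t in halfline. f t = g t)"
  using Quotient3_rel[OF Quotient3_l2, of f g] assms by (simp add: l2_eq_def)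

lemma l2_class_cases:
  obtains y where "square_integrable y" "f = l2_class y"
  using square_integrable_rep_l2 l2_class_rep by metis

lemma l2_class_0: "l2_class (\<lambda>t. 0) = 0"
  by (simp add: zero_l2.abs_eq)

lemma l2_class_add:
  assumes "square_integrable f" "square_integrable g"
  shows "l2_class f + l2_class g = l2_class (\<lambda>t. f t + g t)"
  using assms by (simp add: plus_l2.abs_eq l2_eq_refl_iff)

lemma l2_class_minus:
  assumes "square_integrable f"
  shows "- l2_class f = l2_class (\<lambda>t. - f t)"
  using assms by (simp add: uminus_l2.abs_eq l2_eq_refl_iff)

lemma l2_class_diff:
  assumes "square_integrable f" "square_integrable g"
  shows "l2_class f - l2_class g = l2_class (\<lambda>t. f t - g t)"
  using assms square_integrable_bounded_linear[OF bounded_linear_minus[OF bounded_linear_ident] assms(2)]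
  by (simp add: minus_l2_def l2_class_minus l2_class_add)

lemma l2_class_cscale:
  assumes "square_integrable f"
  shows "cscale c (l2_class f) = l2_class (\<lambda>t. c *s f t)"
  using assms by (simp add: cscale.abs_eq l2_eq_refl_iff)

lemma inner_l2_class:
  assumes "square_integrable f" "square_integrable g"
  shows "l2_class f \<bullet> l2_class g = integral\<^sup>L halfline (\<lambda>t. f t \<bullet> g t)"
  using assms by (simp add: inner_l2.abs_eq l2_eq_refl_iff)

lemma norm_l2_class:
  assumes "square_integrable f"
  shows "(norm (l2_class f))\<^sup>2 = integral\<^sup>L halfline (\<lambda>t. (norm (f t))\<^sup>2)"
  using inner_l2_class[OF assms assms] by (simp add: power2_norm_eq_inner)

text \<open>Riesz--Fischer: a subsequence whose successive distances are summable converges almost everywhere,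
  because \<open>\<Sum>k. 2^k \<parallel>f (k+1) - f k\<parallel>\<^sup>2\<close> is integrable; Fatou's lemma identifies the limit.\<close>

instance l2 :: (euclidean_space) complete_space
proof
  fix X :: "nat \<Rightarrow> 'a l2" assume X: "Cauchy X"
  have "\<exists>N. \<forall>m\<ge>N. \<forall>n\<ge>N. norm (X m - X n) < (1/4)^k" for k :: nat
    using X unfolding Cauchy_def dist_norm by (metis zero_less_divide_1_iff zero_less_numeral zero_less_power)
  then obtain N where N: "\<And>k m n. m \<ge> N k \<Longrightarrow> n \<ge> N k \<Longrightarrow> norm (X m - X n) < (1/4)^k" by metis
  define r where "r k = (\<Sum>i\<le>k. Suc (N i))" for k
  have rN: "N k \<le> r k" for k
    unfolding r_def by (rule order_trans[OF _ member_le_sum[of k "{..k}" "\<lambda>i. Suc (N i)"]]) auto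
  have r_mono: "strict_mono r" unfolding strict_mono_Suc_iff r_def by simp
  define f where "f k = rep_l2 (X (r k))" for k
  have sf: "square_integrable (f k)" for k unfolding f_def by (rule square_integrable_rep_l2)
  have Xf: "X (r k) = l2_class (f k)" for k unfolding f_def by (rule l2_class_rep[symmetric])
  note [measurable] = sf[THEN square_integrable_measurable]
  have sd: "square_integrable (\<lambda>t. f i t - f k t)" for i k
    using square_integrable_add[OF sf[of i] square_integrable_bounded_linear[OF bounded_linear_minus[OF bounded_linear_ident] sf[of k]]]
    by simp
  have nd: "(norm (X (r i) - X (r k)))\<^sup>2 = integral\<^sup>L halfline (\<lambda>t. (norm (f i t - f k t))\<^sup>2)" for i k
    unfolding Xf l2_class_diff[OF sf sf] by (rule norm_l2_class[OF sd])
  have step: "norm (X (r (Suc k)) - X (r k)) < (1/4)^k" for k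
    using rN[of k] strict_monoD[OF r_mono, of k "Suc k"] by (intro N) auto
  have nn: "(\<integral>\<^sup>+t. ennreal ((norm (f i t - f k t))\<^sup>2) \<partial>halfline) = ennreal ((norm (X (r i) - X (r k)))\<^sup>2)" for i k
    unfolding nd using sd[of i k] by (intro nn_integral_eq_integral) (auto simp: square_integrable_def)
  \<comment> \<open>The weight \<open>4^k\<close> still leaves a convergent series of integrals and forces \<open>\<parallel>f (k+1) - f k\<parallel> \<le> M 2\<^sup>-\<^sup>k\<close>.\<close>
  have "(\<integral>\<^sup>+t. (\<Sum>k. ennreal (4^k * (norm (f (Suc k) t - f k t))\<^sup>2)) \<partial>halfline)
      = (\<Sum>k. \<integral>\<^sup>+t. ennreal (4^k * (norm (f (Suc k) t - f k t))\<^sup>2) \<partial>halfline)"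
    by (rule nn_integral_suminf) measurable
  also have "\<dots> \<le> (\<Sum>k. ennreal ((1/4)^k))"
  proof (rule suminf_le)
    fix k
    have "(\<integral>\<^sup>+t. ennreal (4^k * (norm (f (Suc k) t - f k t))\<^sup>2) \<partial>halfline)
        = ennreal (4^k * (norm (X (r (Suc k)) - X (r k)))\<^sup>2)"
      by (simp add: ennreal_mult nn_integral_cmult nn)
    also have "\<dots> \<le> ennreal ((1/4)^k)"
    proof (rule ennreal_leI)
      have "(norm (X (r (Suc k)) - X (r k)))\<^sup>2 \<le> ((1/4)^k)\<^sup>2" using step[of k] by (intro power_mono) auto
      then have "4^k * (norm (X (r (Suc k)) - X (r k)))\<^sup>2 \<le> 4^k * ((1/4)^k)\<^sup>2" by (intro mult_left_mono) auto
      also have "\<dots> = (1/4)^k" by (simp add: power2_eq_square power_divide)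
      finally show "4^k * (norm (X (r (Suc k)) - X (r k)))\<^sup>2 \<le> (1/4)^k" .
    qed
    finally show "(\<integral>\<^sup>+t. ennreal (4^k * (norm (f (Suc k) t - f k t))\<^sup>2) \<partial>halfline) \<le> ennreal ((1/4)^k)" .
  qed auto
  also have "\<dots> < \<infinity>"
    by (subst suminf_ennreal2) (auto simp: summable_geometric)
  finally have "AE t in halfline. (\<Sum>k. ennreal (4^k * (norm (f (Suc k) t - f k t))\<^sup>2)) \<noteq> \<infinity>"
    by (intro nn_integral_PInf_AE) auto
  then have AEconv: "AE t in halfline. convergent (\<lambda>k. f k t)"
  proof eventually_elim
    case (elim t)
    have "summable (\<lambda>k. 4^k * (norm (f (Suc k) t - f k t))\<^sup>2)"
      using elim by (intro summable_suminf_not_top) auto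
    then have "bounded (range (\<lambda>k. 4^k * (norm (f (Suc k) t - f k t))\<^sup>2))"
      by (intro Bseq_eq_bounded[THEN iffD1] convergent_imp_Bseq) (auto dest: summable_LIMSEQ_zero simp: convergent_def)
    then obtain M where M: "M > 0" "\<And>k. 4^k * (norm (f (Suc k) t - f k t))\<^sup>2 \<le> M"
      unfolding bounded_pos by auto
    have le: "norm (f (Suc k) t - f k t) \<le> sqrt M * (1/2)^k" for k
    proof (rule power2_le_imp_le)
      have "(2::real)^(k*2) = 4^k" by (simp add: power_mult mult.commute[of k])
      then show "(norm (f (Suc k) t - f k t))\<^sup>2 \<le> (sqrt M * (1/2)^k)\<^sup>2"
        using M(2)[of k] M(1) by (simp add: power_mult_distrib power_divide power_mult[symmetric] field_simps)
    qed (use M in simp)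
    have "summable (\<lambda>k. f (Suc k) t - f k t)"
      using le by (intro summable_comparison_test'[OF summable_mult[OF summable_geometric]]) auto
    then have "convergent (\<lambda>n. \<Sum>k<n. (f (Suc k) t - f k t))" by (simp add: summable_iff_convergent)
    then have "convergent (\<lambda>n. f n t - f 0 t)" by (simp add: sum_lessThan_telescope[of "\<lambda>k. f k t"])
    then show ?case using convergent_add_const_right_iff[of "\<lambda>n. f n t" "- f 0 t"] by simp
  qed
  define g where "g t = lim (\<lambda>k. f k t)" for t
  have [measurable]: "g \<in> borel_measurable halfline" unfolding g_def by measurable
  have AEg: "AE t in halfline. (\<lambda>k. f k t) \<longlonglongrightarrow> g t"
    using AEconv by eventually_elim (simp add: g_def convergent_LIMSEQ_iff)
  have fatou: "(\<integral>\<^sup>+t. ennreal ((norm (g t - f k t))\<^sup>2) \<partial>halfline) \<le> ennreal (((1/4)^k)\<^sup>2)" for k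
  proof -
    have "(\<integral>\<^sup>+t. ennreal ((norm (g t - f k t))\<^sup>2) \<partial>halfline)
        = (\<integral>\<^sup>+t. liminf (\<lambda>i. ennreal ((norm (f i t - f k t))\<^sup>2)) \<partial>halfline)"
    proof (rule nn_integral_cong_AE)
      show "AE t in halfline. ennreal ((norm (g t - f k t))\<^sup>2) = liminf (\<lambda>i. ennreal ((norm (f i t - f k t))\<^sup>2))"
        using AEg
      proof eventually_elim
        case (elim t)
        then have "(\<lambda>i. ennreal ((norm (f i t - f k t))\<^sup>2)) \<longlonglongrightarrow> ennreal ((norm (g t - f k t))\<^sup>2)"
          by (intro tendsto_ennrealI tendsto_intros)
        then show ?case by (rule lim_imp_Liminf[OF trivial_limit_sequentially, symmetric])
      qed
    qed
    also have "\<dots> \<le> liminf (\<lambda>i. \<integral>\<^sup>+t. ennreal ((norm (f i t - f k t))\<^sup>2) \<partial>halfline)"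
      by (rule nn_integral_liminf) measurable
    also have "\<dots> \<le> ennreal (((1/4)^k)\<^sup>2)"
    proof (rule Liminf_le)
      show "\<forall>\<^sub>F i in sequentially. (\<integral>\<^sup>+t. ennreal ((norm (f i t - f k t))\<^sup>2) \<partial>halfline) \<le> ennreal (((1/4)^k)\<^sup>2)"
        using eventually_ge_at_top[of k]
      proof eventually_elim
        case (elim i)
        then have "r k \<le> r i" using r_mono by (simp add: strict_mono_less_eq)
        then have "norm (X (r i) - X (r k)) < (1/4)^k" using rN[of k] by (intro N) auto
        then show ?case unfolding nn by (intro ennreal_leI power_mono) auto
      qed
    qed simp
    finally show ?thesis .
  qed
  have sgf: "square_integrable (\<lambda>t. g t - f k t)" for k
    unfolding square_integrable_def
  proof
    show "integrable halfline (\<lambda>t. (norm (g t - f k t))\<^sup>2)"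
      using fatou[of k] by (intro integrableI_nonneg) (auto simp: le_less_trans[OF _ ennreal_less_top])
  qed measurable
  have sg: "square_integrable g" using square_integrable_add[OF sgf[of 0] sf[of 0]] by simp
  have "norm (X (r k) - l2_class g) \<le> (1/4)^k" for k
  proof (rule power2_le_imp_le)
    have "(norm (X (r k) - l2_class g))\<^sup>2 = (norm (l2_class (\<lambda>t. g t - f k t)))\<^sup>2"
      unfolding Xf l2_class_diff[OF sg sf, symmetric] by (simp add: norm_minus_commute)
    also have "\<dots> = integral\<^sup>L halfline (\<lambda>t. (norm (g t - f k t))\<^sup>2)" by (rule norm_l2_class[OF sgf])
    also have "\<dots> \<le> ((1/4)^k)\<^sup>2"
      using fatou[of k] sgf[of k] unfolding square_integrable_def
      by (subst (asm) nn_integral_eq_integral) auto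
    finally show "(norm (X (r k) - l2_class g))\<^sup>2 \<le> ((1/4)^k)\<^sup>2" .
  qed simp
  then have "(\<lambda>k. X (r k) - l2_class g) \<longlonglongrightarrow> 0"
    by (intro Lim_null_comparison[OF _ LIMSEQ_realpow_zero[of "1/4"]]) auto
  then have "(X \<circ> r) \<longlonglongrightarrow> l2_class g" by (simp add: LIM_zero_iff o_def)
  then show "convergent X"
    using Cauchy_converges_subseq X r_mono convergent_def by (metis (no_types, lifting))
qed

text \<open>A minimizing sequence for the distance to a complete subspace is a Cauchy sequence by the
  parallelogram law.\<close>

lemma orthogonal_projection_exists:
  fixes M :: "'a::real_inner set"
  assumes sub: "subspace M" and comp: "complete M"
  obtains m where "m \<in> M" "\<And>v. v \<in> M \<Longrightarrow> (g - m) \<bullet> v = 0"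
proof -
  define d where "d = (INF v\<in>M. norm (g - v))"
  have ne: "M \<noteq> {}" using sub subspace_0 by blast
  have bdd: "bdd_below ((\<lambda>v. norm (g - v)) ` M)" by (intro bdd_belowI2[of _ 0]) simp
  have d_le: "d \<le> norm (g - v)" if "v \<in> M" for v unfolding d_def using bdd that by (rule cINF_lower)
  have d0: "d \<ge> 0" unfolding d_def using ne by (intro cINF_greatest) auto
  have "\<exists>v\<in>M. norm (g - v) < d + inverse (real (Suc n))" for n
    using cINF_less_iff[OF ne bdd, of "d + inverse (real (Suc n))"] unfolding d_def by simp
  then obtain v where v: "\<And>n. v n \<in> M" "\<And>n. norm (g - v n) < d + inverse (real (Suc n))" by metis
  have par: "(norm (v m - v n))\<^sup>2 \<le> 2 * (norm (g - v m))\<^sup>2 + 2 * (norm (g - v n))\<^sup>2 - 4 * d\<^sup>2" for m n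
  proof -
    have "(1/2) *\<^sub>R (v m + v n) \<in> M" using sub v(1) by (intro subspace_scale subspace_add)
    then have "d \<le> norm (g - (1/2) *\<^sub>R (v m + v n))" by (rule d_le)
    then have "d\<^sup>2 \<le> (norm (g - (1/2) *\<^sub>R (v m + v n)))\<^sup>2" using d0 by (rule power_mono)
    moreover have "(norm (v m - v n))\<^sup>2 = 2 * (norm (g - v m))\<^sup>2 + 2 * (norm (g - v n))\<^sup>2 - 4 * (norm (g - (1/2) *\<^sub>R (v m + v n)))\<^sup>2"
      unfolding power2_norm_eq_inner by (simp add: inner_diff_left inner_diff_right inner_add_left inner_add_right inner_commute algebra_simps)
    ultimately show ?thesis by linarith
  qed
  have lim: "(\<lambda>n. norm (g - v n)) \<longlonglongrightarrow> d"
  proof (rule tendsto_sandwich[of "\<lambda>n. d" _ _ "\<lambda>n. d + inverse (real (Suc n))"])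
    show "(\<lambda>n. d + inverse (real (Suc n))) \<longlonglongrightarrow> d"
      using tendsto_add[OF tendsto_const LIMSEQ_inverse_real_of_nat, of d] by simp
    next
    show "\<forall>\<^sub>F n in sequentially. norm (g - v n) \<le> d + inverse (real (Suc n))"
      using v(2) by (intro always_eventually allI less_imp_le)
  qed (use v d_le in auto)
  then have "(\<lambda>n. (norm (g - v n))\<^sup>2) \<longlonglongrightarrow> d\<^sup>2" by (intro tendsto_power)
  have "Cauchy v"
    unfolding Cauchy_altdef2
  proof (intro allI impI)
    fix e :: real assume e: "e > 0"
    then have "\<forall>\<^sub>F n in sequentially. dist ((norm (g - v n))\<^sup>2) (d\<^sup>2) < e\<^sup>2 / 4"
      using \<open>(\<lambda>n. (norm (g - v n))\<^sup>2) \<longlonglongrightarrow> d\<^sup>2\<close> by (intro tendstoD) auto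
    then obtain N where N: "\<And>n. n \<ge> N \<Longrightarrow> \<bar>(norm (g - v n))\<^sup>2 - d\<^sup>2\<bar> < e\<^sup>2 / 4"
      unfolding eventually_sequentially dist_real_def by blast
    have "dist (v n) (v N) < e" if "n \<ge> N" for n
    proof -
      have "(norm (v n - v N))\<^sup>2 < e\<^sup>2"
        using par[of n N] N[OF that] N[of N] by (simp add: abs_if split: if_splits)
      then show ?thesis using e unfolding dist_norm by (simp add: power_less_imp_less_base)
    qed
    then show "\<exists>N. \<forall>n\<ge>N. dist (v n) (v N) < e" by blast
  qed
  then obtain m where m: "m \<in> M" "v \<longlonglongrightarrow> m"
    using comp v(1) unfolding complete_def by blast
  have nm: "norm (g - m) = d"
    using tendsto_norm[OF tendsto_diff[OF tendsto_const m(2)]] lim by (rule LIMSEQ_unique)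
  show ?thesis
  proof (rule that[OF m(1)])
    fix w assume w: "w \<in> M"
    show "(g - m) \<bullet> w = 0"
    proof (cases "w = 0")
      case False
      define s where "s = ((g - m) \<bullet> w) / (w \<bullet> w)"
      have ww: "w \<bullet> w > 0" using False by simp
      have "m + s *\<^sub>R w \<in> M" using sub m(1) w by (intro subspace_scale subspace_add)
      then have "(norm (g - m))\<^sup>2 \<le> (norm (g - (m + s *\<^sub>R w)))\<^sup>2"
        using d_le d0 unfolding nm by (intro power_mono) auto
      also have "\<dots> = (norm (g - m))\<^sup>2 - ((g - m) \<bullet> w)\<^sup>2 / (w \<bullet> w)"
      proof -
        have "g - (m + s *\<^sub>R w) = (g - m) - s *\<^sub>R w" by simp
        then have "(norm (g - (m + s *\<^sub>R w)))\<^sup>2 = (norm (g - m))\<^sup>2 - 2 * s * ((g - m) \<bullet> w) + s\<^sup>2 * (w \<bullet> w)"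
          unfolding power2_norm_eq_inner
          by (simp only: inner_diff_left inner_diff_right inner_scaleR_left inner_scaleR_right)
            (simp add: inner_commute algebra_simps power2_eq_square)
        then show ?thesis using ww by (simp add: s_def field_simps power2_eq_square)
      qed
      finally have "((g - m) \<bullet> w)\<^sup>2 / (w \<bullet> w) \<le> 0" by simp
      then have "((g - m) \<bullet> w)\<^sup>2 \<le> 0" using ww by (simp add: divide_le_0_iff)
      then show ?thesis by simp
    qed simp
  qed
qed

section \<open>The symplectic form and the bilinear pairing\<close>

lemma sum_UNIV_Plus_gen:
  "(\<Sum>k\<in>UNIV. F k) = (\<Sum>a\<in>UNIV. F (Inl a)) + (\<Sum>a\<in>(UNIV::'q set). F (Inr a))"
  for F :: "'p::finite + 'q::finite \<Rightarrow> 'b::comm_monoid_add"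
  by (subst UNIV_Plus_UNIV[symmetric], subst Plus_def, subst sum.union_disjoint)
     (auto simp: sum.reindex)

definition sdot :: "complex^('p::finite + 'p) \<Rightarrow> complex^('p + 'p) \<Rightarrow> complex" where
  "sdot u v = (\<Sum>a\<in>UNIV. u $ Inl a * v $ Inr a + u $ Inr a * v $ Inl a)"

definition symp :: "complex^('p::finite + 'p) \<Rightarrow> complex^('p + 'p) \<Rightarrow> complex" where
  "symp u v = sdot (J_mat *v u) v"

lemma J_mat_mult:
  "(J_mat *v w) $ Inl a = \<i> * w $ Inl a" "(J_mat *v w) $ Inr a = - \<i> * w $ Inr a"
  by (simp_all add: J_mat_def block_mat_def matrix_vector_mult_def sum_UNIV_Plus mat_def
      if_distrib[of "\<lambda>x. x * _"] cong: if_cong)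

lemma J_J: "J_mat *v (J_mat *v w) = - w"
  by (simp add: vec_Plus_eq_iff J_mat_mult)

text \<open>Since \<open>J\<^sup>2 = - 1\<close>, the equation \<open>J y' + Q y = f\<close> can be solved for \<open>y'\<close>.\<close>

lemma J_eq_iff: "J_mat *v u + w = f \<longleftrightarrow> u = J_mat *v (w - f)"
proof
  assume "J_mat *v u + w = f"
  then have "w - f = - (J_mat *v u)" by (simp add: algebra_simps)
  then have "J_mat *v (w - f) = - (J_mat *v (J_mat *v u))" by (simp add: vec_Plus_eq_iff J_mat_mult)
  then show "u = J_mat *v (w - f)" by (simp add: J_J)
next
  assume "u = J_mat *v (w - f)"
  then show "J_mat *v u + w = f" by (simp add: J_J)
qed

lemma sdot_sym: "sdot u v = sdot v u"
  unfolding sdot_def by (simp add: mult.commute add.commute)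

lemma sdot_bounded_bilinear: "bounded_bilinear sdot"
  unfolding bilinear_conv_bounded_bilinear[symmetric] bilinear_def sdot_def
  by (auto intro!: linearI simp: sum.distrib algebra_simps scaleR_sum_right)

lemmas sdot_linear = bounded_bilinear.add_left[OF sdot_bounded_bilinear] bounded_bilinear.add_right[OF sdot_bounded_bilinear]
  bounded_bilinear.diff_left[OF sdot_bounded_bilinear] bounded_bilinear.diff_right[OF sdot_bounded_bilinear]
  bounded_bilinear.minus_left[OF sdot_bounded_bilinear] bounded_bilinear.minus_right[OF sdot_bounded_bilinear]
  bounded_bilinear.zero_left[OF sdot_bounded_bilinear] bounded_bilinear.zero_right[OF sdot_bounded_bilinear]

lemma sdot_scale_left: "sdot (c *s u) v = c * sdot u v"
  and sdot_scale_right: "sdot u (c *s v) = c * sdot u v"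
  unfolding sdot_def by (simp_all add: sum_distrib_left algebra_simps)

lemma bounded_linear_matrix_vector: "bounded_linear (\<lambda>v. (M::complex^'n^'m) *v v)"
  by (rule linear_conv_bounded_linear[THEN iffD1], rule linearI)
     (simp_all add: vec_eq_iff matrix_vector_mult_def scaleR_sum_right distrib_left sum.distrib)

lemma symp_bounded_bilinear: "bounded_bilinear symp"
  unfolding symp_def[abs_def]
  using bounded_bilinear.comp1[OF sdot_bounded_bilinear bounded_linear_matrix_vector] .

lemmas symp_linear = bounded_bilinear.add_left[OF symp_bounded_bilinear] bounded_bilinear.add_right[OF symp_bounded_bilinear]
  bounded_bilinear.diff_left[OF symp_bounded_bilinear] bounded_bilinear.diff_right[OF symp_bounded_bilinear]
  bounded_bilinear.zero_left[OF symp_bounded_bilinear] bounded_bilinear.zero_right[OF symp_bounded_bilinear]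
  bounded_bilinear.minus_left[OF symp_bounded_bilinear] bounded_bilinear.minus_right[OF symp_bounded_bilinear]

lemma symp_scale_left: "symp (c *s u) v = c * symp u v"
  and symp_scale_right: "symp u (c *s v) = c * symp u v"
proof -
  have "J_mat *v (c *s u) = c *s (J_mat *v u)" by (simp add: vec_Plus_eq_iff J_mat_mult algebra_simps)
  then show "symp (c *s u) v = c * symp u v" by (simp add: symp_def sdot_scale_left)
qed (simp add: symp_def sdot_scale_right)

lemma symp_expand: "symp u v = \<i> * (\<Sum>a\<in>UNIV. u $ Inl a * v $ Inr a - u $ Inr a * v $ Inl a)"
  unfolding symp_def sdot_def J_mat_mult by (simp add: sum_distrib_left algebra_simps)

lemma symp_alt: "symp u v = - sdot u (J_mat *v v)"
  unfolding symp_def sdot_def J_mat_mult by (simp add: sum_negf[symmetric] algebra_simps del: sum_negf)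

lemma symp_antisym: "symp u v = - symp v u"
  unfolding symp_expand by (simp add: algebra_simps sum_subtractf)

lemma sdot_axis:
  "sdot u (axis (Inr a) 1) = u $ Inl a" "sdot u (axis (Inl a) 1) = u $ Inr a"
  unfolding sdot_def axis_def by (simp_all add: if_distrib[of "\<lambda>x. _ * x"] sum.distrib cong: if_cong)

lemma symp_nondegenerate:
  assumes "\<And>v. symp u v = 0"
  shows "u = 0"
proof -
  have "sdot (J_mat *v u) v = 0" for v using assms[of v] by (simp add: symp_def)
  from this[of "axis (Inr _) 1"] this[of "axis (Inl _) 1"] show ?thesis
    by (simp add: sdot_axis vec_Plus_eq_iff J_mat_mult)
qed

lemma block_mat_mult:
  "(block_mat A B C D *v w) $ Inl a = (\<Sum>b\<in>UNIV. A $ a $ b * w $ Inl b) + (\<Sum>b\<in>UNIV. B $ a $ b * w $ Inr b)"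
  "(block_mat A B C D *v w) $ Inr a = (\<Sum>b\<in>UNIV. C $ a $ b * w $ Inl b) + (\<Sum>b\<in>UNIV. D $ a $ b * w $ Inr b)"
  by (simp_all add: block_mat_def matrix_vector_mult_def sum_UNIV_Plus)

lemma sum_transpose_swap:
  fixes A :: "complex^'p^'p"
  assumes "transpose A = D"
  shows "(\<Sum>a\<in>UNIV. (\<Sum>b\<in>UNIV. A $ a $ b * x b) * y a) = (\<Sum>a\<in>UNIV. x a * (\<Sum>b\<in>UNIV. D $ a $ b * y b))"
proof -
  have "A $ a $ b = D $ b $ a" for a b using assms by (auto simp: transpose_def)
  then have "(\<Sum>a\<in>UNIV. (\<Sum>b\<in>UNIV. A $ a $ b * x b) * y a) = (\<Sum>a\<in>UNIV. \<Sum>b\<in>UNIV. x b * (D $ b $ a * y a))"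
    by (simp add: sum_distrib_right sum_distrib_left mult_ac)
  also have "\<dots> = (\<Sum>b\<in>UNIV. \<Sum>a\<in>UNIV. x b * (D $ b $ a * y a))" by (rule sum.swap)
  finally show ?thesis by (simp add: sum_distrib_left)
qed

text \<open>The symmetry assumptions on the blocks say that the potential is symmetric for the bilinear form \<open>sdot\<close>.\<close>

lemma sdot_block_mat_symmetric:
  fixes A B C D :: "complex^('p::finite)^'p"
  assumes "transpose A = D" "transpose B = B" "transpose C = C"
  shows "sdot (block_mat A B C D *v u) v = sdot u (block_mat A B C D *v v)"
proof -
  have D: "transpose D = A" using assms(1) transpose_transpose by metis
  show ?thesis
    unfolding sdot_def block_mat_mult distrib_right distrib_left sum.distrib
      sum_transpose_swap[OF assms(1)] sum_transpose_swap[OF assms(2)] sum_transpose_swap[OF assms(3)] sum_transpose_swap[OF D]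
    by simp
qed

lemma swap_conj_class:
  assumes "square_integrable f"
  shows "swap_conj (l2_class f) = l2_class (\<lambda>t. swap_mat *v (\<chi> k. cnj (f t $ k)))"
  using assms by (simp add: swap_conj.abs_eq l2_eq_refl_iff)

lemma cinner_class:
  assumes "square_integrable f" "square_integrable g"
  shows "cinner (l2_class f) (l2_class g) = integral\<^sup>L halfline (\<lambda>t. \<Sum>k\<in>UNIV. f t $ k * cnj (g t $ k))"
  using assms by (simp add: cinner.abs_eq l2_eq_refl_iff)

text \<open>In terms of representatives this is the integral of \<open>sdot (f t) (g t)\<close>, which contains no complex
  conjugates and is symmetric.\<close>

definition bil :: "(complex^('p::finite + 'p)) l2 \<Rightarrow> (complex^('p + 'p)) l2 \<Rightarrow> complex" where
  "bil f g = cinner f (swap_conj g)"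

lemma bil_class:
  assumes "square_integrable f" "square_integrable g"
  shows "bil (l2_class f) (l2_class g) = integral\<^sup>L halfline (\<lambda>t. sdot (f t) (g t))"
  unfolding bil_def swap_conj_class[OF assms(2)]
    cinner_class[OF assms(1) square_integrable_bounded_linear[OF bounded_linear_swap_cnj assms(2)]]
  by (simp add: sum_UNIV_Plus swap_mat_mult sdot_def sum.distrib)

lemma integrable_bilinear_square_integrable:
  fixes h :: "'a::euclidean_space \<Rightarrow> 'b::euclidean_space \<Rightarrow> 'c::euclidean_space"
  assumes h: "bounded_bilinear h" and f: "square_integrable f" and g: "square_integrable g"
  shows "integrable halfline (\<lambda>t. h (f t) (g t))"
proof -
  note [measurable] = f[THEN square_integrable_measurable] g[THEN square_integrable_measurable]
  obtain K where K: "K > 0" "\<And>x y. norm (h x y) \<le> norm x * norm y * K"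
    using bounded_bilinear.pos_bounded[OF h] by blast
  have "integrable halfline (\<lambda>t. ((norm (f t))\<^sup>2 + (norm (g t))\<^sup>2) * K)"
    using f g by (auto simp: square_integrable_def)
  then show ?thesis
  proof (rule Bochner_Integration.integrable_bound)
    have "continuous_on UNIV (\<lambda>p. h (fst p) (snd p))"
      by (intro bounded_bilinear.continuous_on[OF h] continuous_intros)
    then have "(\<lambda>p. h (fst p) (snd p)) \<in> borel_measurable borel" by (rule borel_measurable_continuous_onI)
    then have "(\<lambda>t. (\<lambda>p. h (fst p) (snd p)) (f t, g t)) \<in> borel_measurable halfline"
      by (rule measurable_compose_rev) measurable
    then show "(\<lambda>t. h (f t) (g t)) \<in> borel_measurable halfline" by simp
    show "AE t in halfline. norm (h (f t) (g t)) \<le> norm (((norm (f t))\<^sup>2 + (norm (g t))\<^sup>2) * K)"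
    proof (rule AE_I2)
      fix t
      have "norm (f t) * norm (g t) \<le> (norm (f t))\<^sup>2 + (norm (g t))\<^sup>2"
        using sum_squares_bound[of "norm (f t)" "norm (g t)"] mult_nonneg_nonneg[OF norm_ge_zero[of "f t"] norm_ge_zero[of "g t"]]
        by linarith
      then have le: "norm (f t) * norm (g t) * K \<le> ((norm (f t))\<^sup>2 + (norm (g t))\<^sup>2) * K"
        using K(1) by (intro mult_right_mono) auto
      then show "norm (h (f t) (g t)) \<le> norm (((norm (f t))\<^sup>2 + (norm (g t))\<^sup>2) * K)"
        using order_trans[OF K(2) le] K(1) by (simp add: abs_mult)
    qed
  qed
qed

lemmas integrable_sdot = integrable_bilinear_square_integrable[OF sdot_bounded_bilinear]

lemma bil_sym: "bil f g = bil g f"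
  by (cases f rule: l2_class_cases; cases g rule: l2_class_cases) (simp add: bil_class sdot_sym)

lemma bil_add_left: "bil (f + f') g = bil f g + bil f' g"
  by (cases f rule: l2_class_cases; cases f' rule: l2_class_cases; cases g rule: l2_class_cases)
     (simp add: bil_class l2_class_add square_integrable_add sdot_linear integrable_sdot)

lemma bil_scale_left: "bil (cscale c f) g = c * bil f g"
  by (cases f rule: l2_class_cases; cases g rule: l2_class_cases)
     (simp add: bil_class l2_class_cscale square_integrable_bounded_linear[OF bounded_linear_vec_scale] sdot_scale_left)

lemma bil_add_right: "bil g (f + f') = bil g f + bil g f'"
  unfolding bil_sym[of g] by (rule bil_add_left)

lemma bil_scale_right: "bil g (cscale c f) = c * bil g f"
  unfolding bil_sym[of g] by (rule bil_scale_left)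

lemma cscale_of_real: "cscale (of_real r) f = r *\<^sub>R f"
proof (cases f rule: l2_class_cases)
  case (1 y)
  have "of_real r *s y t = r *\<^sub>R y t" for t unfolding vec_eq_iff vector_scaleR_component by (simp add: scaleR_conv_of_real)
  then show ?thesis using 1 by (simp add: l2_class_cscale scaleR_l2.abs_eq l2_eq_refl_iff)
qed

lemma cscale_minus_one: "cscale (-1) f = - f"
  using cscale_of_real[of "-1" f] by simp

lemma bil_diff_left: "bil (f - f') g = bil f g - bil f' g"
proof -
  have eq: "f - f' = f + cscale (-1) f'" by (simp add: cscale_minus_one)
  show ?thesis unfolding eq bil_add_left bil_scale_left by simp
qed

lemma bil_diff_right: "bil g (f - f') = bil g f - bil g f'"
  unfolding bil_sym[of g] by (rule bil_diff_left)

lemma bil_zero [simp]: "bil 0 g = 0" "bil g 0 = 0"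
  using bil_diff_left[of 0 0 g] bil_diff_right[of g 0 0] by simp_all

lemma inner_eq_Re_cinner: "f \<bullet> g = Re (cinner f g)"
proof (cases f rule: l2_class_cases; cases g rule: l2_class_cases)
  fix u v :: "real \<Rightarrow> complex^'a" assume *: "square_integrable u" "f = l2_class u" "square_integrable v" "g = l2_class v"
  have eq: "u t \<bullet> v t = Re (\<Sum>k\<in>UNIV. u t $ k * cnj (v t $ k))" for t
    by (simp add: inner_vec_def inner_complex_def)
  have int: "integrable halfline (\<lambda>t. \<Sum>k\<in>UNIV. u t $ k * cnj (v t $ k))"
  proof (intro integrable_bilinear_square_integrable[OF _ *(1,3)])
    show "bounded_bilinear (\<lambda>(x::complex^'a) y. \<Sum>k\<in>UNIV. x $ k * cnj (y $ k))"
      unfolding bilinear_conv_bounded_bilinear[symmetric] bilinear_def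
      by (auto intro!: linearI simp: sum.distrib algebra_simps scaleR_sum_right)
  qed
  show ?thesis
    unfolding *(2,4) inner_l2_class[OF *(1,3)] cinner_class[OF *(1,3)] eq by (rule integral_Re[OF int])
qed

lemma norm_swap_conj: "norm (swap_conj f) = norm f"
proof (cases f rule: l2_class_cases)
  case (1 y)
  have "norm (swap_mat *v (\<chi> k. cnj (y t $ k))) = norm (y t)" for t
    by (simp add: norm_vec_def L2_set_def sum_UNIV_Plus_gen swap_mat_mult add.commute)
  then have "(norm (swap_conj f))\<^sup>2 = (norm f)\<^sup>2"
    using 1 by (simp add: swap_conj_class norm_l2_class square_integrable_bounded_linear[OF bounded_linear_swap_cnj])
  then show ?thesis by simp
qed

lemma norm_vec_scale: "norm (c *s v) = cmod c * norm (v::complex^'n)"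
  by (simp add: norm_vec_def norm_mult L2_set_right_distrib)

lemma norm_cscale: "norm (cscale c f) = cmod c * norm f"
proof (cases f rule: l2_class_cases)
  case (1 y)
  then have "(norm (cscale c f))\<^sup>2 = (cmod c * norm f)\<^sup>2"
    using square_integrable_bounded_linear[OF bounded_linear_vec_scale[of c] 1(1)]
    by (simp add: l2_class_cscale norm_l2_class norm_vec_scale power_mult_distrib)
  then show ?thesis by simp
qed

lemma swap_conj_add: "swap_conj (f + g) = swap_conj f + swap_conj g"
  and swap_conj_cscale: "swap_conj (cscale c f) = cscale (cnj c) (swap_conj f)"
  and swap_conj_swap_conj: "swap_conj (swap_conj f) = f"
  using conjugation_swap_conj unfolding conjugation_def by blast+

text \<open>Cauchy--Schwarz for the Hermitian product, and the conjugation preserves norms.\<close>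

lemma bil_bound: "cmod (bil f g) \<le> norm f * norm g"
proof (cases "bil f g = 0")
  case False
  define c where "c = cnj (bil f g) / of_real (cmod (bil f g))"
  have c: "cmod c = 1" using False by (simp add: c_def norm_divide)
  have "bil (cscale c f) g = of_real (cmod (bil f g))"
    using False by (simp add: bil_scale_left c_def complex_norm_square[symmetric] mult.commute power2_eq_square)
  then have "cmod (bil f g) = cscale c f \<bullet> swap_conj g" by (simp add: inner_eq_Re_cinner bil_def)
  also have "\<dots> \<le> norm (cscale c f) * norm (swap_conj g)" by (rule norm_cauchy_schwarz)
  finally show ?thesis by (simp add: norm_cscale norm_swap_conj c)
qed simp

lemma bil_bounded_bilinear: "bounded_bilinear bil"
proof
  show "bil (f + f') g = bil f g + bil f' g" for f f' g by (rule bil_add_left)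
  show "bil g (f + f') = bil g f + bil g f'" for f f' g by (rule bil_add_right)
  show "bil (r *\<^sub>R f) g = r *\<^sub>R bil f g" for r f g
    by (simp add: cscale_of_real[symmetric] bil_scale_left scaleR_conv_of_real)
  show "bil f (r *\<^sub>R g) = r *\<^sub>R bil f g" for r f g
    by (simp add: cscale_of_real[symmetric] bil_scale_right scaleR_conv_of_real)
  show "\<exists>K. \<forall>f g. norm (bil f g) \<le> norm f * norm g * K" using bil_bound by (metis mult.right_neutral)
qed

lemma cscale_bounded_bilinear: "bounded_bilinear (cscale :: complex \<Rightarrow> (complex^'n) l2 \<Rightarrow> _)"
proof
  show "cscale (r *\<^sub>R c) f = r *\<^sub>R cscale c f" for r c and f :: "(complex^'n) l2"
    by (simp add: cscale_of_real[symmetric] scaleR_conv_of_real)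
  show "cscale c (r *\<^sub>R f) = r *\<^sub>R cscale c f" for r c and f :: "(complex^'n) l2"
    by (simp add: cscale_of_real[symmetric] mult.commute)
  show "\<exists>K. \<forall>c (f :: (complex^'n) l2). norm (cscale c f) \<le> norm c * norm f * K"
    by (rule exI[of _ 1]) (simp add: norm_cscale)
qed (simp_all add: l2.scale_left_distrib l2.scale_right_distrib)

text \<open>For the conjugation \<open>swap_conj\<close>, the operator \<open>j T\<^sup>* j\<close> is the transpose of \<open>T\<close> for the bilinear
  pairing; working with the transpose removes all complex conjugates from the analysis.\<close>

definition transpose_op :: "('p::finite + 'p) l2_op \<Rightarrow> ('p + 'p) l2_op" where
  "transpose_op T = {(u, v). \<forall>(f, g)\<in>T. bil g u = bil f v}"

lemma conj_op_adj: "conj_op swap_conj (adj T) = transpose_op T"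
proof -
  have "(u, v) \<in> conj_op swap_conj (adj T) \<longleftrightarrow> (swap_conj u, swap_conj v) \<in> adj T" for u v
    unfolding conj_op_def by (auto simp: swap_conj_swap_conj) (metis swap_conj_swap_conj)
  then show ?thesis unfolding transpose_op_def adj_def bil_def by auto
qed

lemma adj_iff_transpose_op: "(u, v) \<in> adj T \<longleftrightarrow> (swap_conj u, swap_conj v) \<in> transpose_op T"
  unfolding transpose_op_def adj_def bil_def by (simp add: swap_conj_swap_conj)

lemma closed_transpose_op: "closed (transpose_op T)"
proof -
  have "transpose_op T = (\<Inter>(f, g)\<in>T. {p. bil g (fst p) = bil f (snd p)})"
    unfolding transpose_op_def by auto
  moreover have "closed {p. bil g (fst p) = bil f (snd p)}" for f g
    by (intro closed_Collect_eq bounded_bilinear.continuous_on[OF bil_bounded_bilinear] continuous_intros)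
  ultimately show ?thesis by (auto intro!: closed_INT)
qed

text \<open>The pairing is continuous, so the defining identities pass to limits in the graph.\<close>

lemma transpose_op_closure: "transpose_op (closure T) = transpose_op T"
proof
  show "transpose_op (closure T) \<subseteq> transpose_op T"
    unfolding transpose_op_def using closure_subset by fast
  show "transpose_op T \<subseteq> transpose_op (closure T)"
  proof
    fix p assume p: "p \<in> transpose_op T"
    have "closed {q. bil (snd q) (fst p) = bil (fst q) (snd p)}"
      by (intro closed_Collect_eq bounded_bilinear.continuous_on[OF bil_bounded_bilinear] continuous_intros)
    moreover have "T \<subseteq> {q. bil (snd q) (fst p) = bil (fst q) (snd p)}"
      using p unfolding transpose_op_def by auto
    ultimately have "closure T \<subseteq> {q. bil (snd q) (fst p) = bil (fst q) (snd p)}" by (rule closure_minimal[rotated])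
    then show "p \<in> transpose_op (closure T)" unfolding transpose_op_def by force
  qed
qed

section \<open>Functions on the half-line\<close>

lemma (in bounded_bilinear) has_vector_derivative_prod:
  assumes "(f has_vector_derivative f') (at t)" "(g has_vector_derivative g') (at t)"
  shows "((\<lambda>t. prod (f t) (g t)) has_vector_derivative prod (f t) g' + prod f' (g t)) (at t)"
  using FDERIV[OF assms[unfolded has_vector_derivative_def]]
  unfolding has_vector_derivative_def by (simp add: scaleR_left scaleR_right scaleR_add_right)

lemma square_integrable_cong_AE:
  fixes f g :: "real \<Rightarrow> 'b::euclidean_space"
  assumes f: "square_integrable f" and eq: "AE t in halfline. f t = g t"
  shows "square_integrable g"
proof -
  have "(\<lambda>t. if t \<in> {0..} then f t else 0) \<in> borel_measurable lebesgue"
    using f by (intro borel_measurable_if_I) (auto simp: square_integrable_def)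
  moreover have "AE t in lebesgue. t \<in> {0..} \<longrightarrow> f t = g t"
    using eq by (subst (asm) AE_restrict_space_iff) auto
  then have "AE t in lebesgue. (if t \<in> {0..} then f t else 0) = (if t \<in> {0..} then g t else 0)"
    by eventually_elim simp
  ultimately have "(\<lambda>t. if t \<in> {0..} then g t else 0) \<in> borel_measurable lebesgue" by (rule borel_measurable_AE)
  then have m[measurable]: "g \<in> borel_measurable halfline" by (rule borel_measurable_if_D)
  note [measurable] = square_integrable_measurable[OF f]
  have "integrable halfline (\<lambda>t. (norm (f t))\<^sup>2) \<longleftrightarrow> integrable halfline (\<lambda>t. (norm (g t))\<^sup>2)"
    by (rule integrable_cong_AE) (measurable, use eq in eventually_elim, auto)
  then show ?thesis using f m by (simp add: square_integrable_def)
qed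

lemma l2_class_cong_AE:
  assumes "square_integrable f" "AE t in halfline. f t = g t"
  shows "l2_class f = l2_class g"
  using l2_class_eq_iff[OF assms(1) square_integrable_cong_AE[OF assms]] assms(2) by simp

lemma integrable_halfline_indicator: "integrable halfline (indicator {a..b} :: real \<Rightarrow> real)"
proof -
  have "integrable lebesgue (indicator {max 0 a..b} :: real \<Rightarrow> real)"
    unfolding lmeasurable_iff_integrable[symmetric] by simp
  also have "(indicator {max 0 a..b} :: real \<Rightarrow> real) = (\<lambda>t. indicator {0..} t *\<^sub>R indicator {a..b} t)"
    by (auto simp: indicator_def)
  finally show ?thesis by (subst integrable_restrict_space) auto
qed

lemma square_integrable_imp_locally_integrable:
  assumes "square_integrable f"
  shows "locally_integrable f"
  unfolding locally_integrable_def
proof (intro allI impI)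
  fix b :: real assume "0 \<le> b"
  note ind = integrable_halfline_indicator[of 0 b]
  then have "integrable halfline (\<lambda>t. indicator {0..b} t + (norm (f t))\<^sup>2)"
    using assms by (auto simp: square_integrable_def)
  then have "integrable halfline (\<lambda>t. indicator {0..b} t *\<^sub>R f t)"
  proof (rule Bochner_Integration.integrable_bound)
    note [measurable] = square_integrable_measurable[OF assms]
    have [measurable]: "(indicator {0..b} :: real \<Rightarrow> real) \<in> borel_measurable halfline" using ind by auto
    show "(\<lambda>t. indicator {0..b} t *\<^sub>R f t) \<in> borel_measurable halfline" by measurable
    have "norm (f t) \<le> 1 + (norm (f t))\<^sup>2" for t
    proof -
      have "0 \<le> norm (f t)" "2 * norm (f t) \<le> (norm (f t))\<^sup>2 + 1"
        using sum_squares_bound[of "norm (f t)" 1] by simp_all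
      then show ?thesis by linarith
    qed
    then show "AE t in halfline. norm (indicator {0..b} t *\<^sub>R f t) \<le> norm (indicator {0..b} t + (norm (f t))\<^sup>2)"
      by (intro AE_I2) (auto simp: indicator_def)
  qed
  then have "integrable lebesgue (\<lambda>t. indicator {0..} t *\<^sub>R indicator {0..b} t *\<^sub>R f t)"
    by (subst (asm) integrable_restrict_space) auto
  also have "(\<lambda>t. indicator {0..} t *\<^sub>R indicator {0..b} t *\<^sub>R f t) = (\<lambda>t. indicator {0..b} t *\<^sub>R f t)"
    by (auto simp: indicator_def)
  finally show "f absolutely_integrable_on {0..b}" unfolding set_integrable_def .
qed

lemma square_integrable_cutoff:
  fixes g :: "real \<Rightarrow> 'b::euclidean_space"
  assumes g: "continuous_on {0..} g" and k: "k \<in> borel_measurable borel" "\<And>t. \<bar>k t\<bar> \<le> M" "\<And>t. t > b \<Longrightarrow> k t = 0"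
  shows "square_integrable (\<lambda>t. k t *\<^sub>R g t)"
proof -
  obtain N where N: "N > 0" "\<And>t. 0 \<le> t \<Longrightarrow> t \<le> b \<Longrightarrow> norm (g t) \<le> N"
    using continuous_bounded_on_interval[OF g] by blast
  have [measurable]: "g \<in> borel_measurable halfline"
    by (rule continuous_imp_measurable_on_sets_lebesgue[OF g]) simp
  have [measurable]: "k \<in> borel_measurable halfline"
  proof -
    have "k \<in> borel_measurable lborel" using k(1) by simp
    then show ?thesis by (intro measurable_restrict_space1 measurable_completion)
  qed
  have ind: "integrable halfline (\<lambda>t. (M * N)\<^sup>2 * indicator {0..b} t :: real)"
    by (intro integrable_mult_right integrable_halfline_indicator)
  show ?thesis
    unfolding square_integrable_def
  proof
    show "integrable halfline (\<lambda>t. (norm (k t *\<^sub>R g t))\<^sup>2)"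
      using ind
    proof (rule Bochner_Integration.integrable_bound)
      show "AE t in halfline. norm ((norm (k t *\<^sub>R g t))\<^sup>2) \<le> norm ((M * N)\<^sup>2 * indicator {0..b} t :: real)"
      proof (rule AE_I2)
        fix t :: real assume t: "t \<in> space halfline"
        show "norm ((norm (k t *\<^sub>R g t))\<^sup>2) \<le> norm ((M * N)\<^sup>2 * indicator {0..b} t :: real)"
        proof (cases "t \<le> b")
          case True
          have "\<bar>k t\<bar> * norm (g t) \<le> M * N"
            using k(2)[of t] N t True by (intro mult_mono) auto
          then have "(\<bar>k t\<bar> * norm (g t))\<^sup>2 \<le> (M * N)\<^sup>2" by (intro power_mono) auto
          then show ?thesis using t True by simp
        next
          case False
          then show ?thesis using k(3)[of t] by simp
        qed
      qed
    qed measurable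
  qed measurable
qed

lemma AC_loc_eqI_AE:
  fixes y w :: "real \<Rightarrow> 'b::euclidean_space"
  assumes y: "AC_loc y" and w: "AC_loc w" and eq: "AE t in halfline. y t = w t" and t: "t \<ge> 0"
  shows "y t = w t"
proof -
  let ?d = "\<lambda>t. y t - w t"
  have c: "continuous_on {0..} ?d" by (intro continuous_intros AC_loc_continuous_on y w)
  obtain N where N: "negligible N" "\<And>t. t \<ge> 0 \<Longrightarrow> t \<notin> N \<Longrightarrow> y t = w t" using AE_halfline_negligibleE[OF eq] by blast
  define S where "S = {t \<in> {0<..}. ?d t \<in> - {0}}"
  have "continuous_on {0<..} ?d" using c by (rule continuous_on_subset) auto
  then have "open S" unfolding S_def by (rule continuous_open_preimage[unfolded vimage_def Int_def, simplified]) auto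
  moreover have "negligible S"
  proof (rule negligible_subset[OF N(1)])
    show "S \<subseteq> N"
    proof
      fix t assume "t \<in> S"
      then show "t \<in> N" using N(2)[of t] unfolding S_def by auto
    qed
  qed
  ultimately have "S = {}" using open_not_negligible by blast
  then have 0: "?d t = 0" if "t \<in> {0<..}" for t using that unfolding S_def by auto
  have cl: "closure {0::real<..} = {0..}" by simp
  have "?d t = 0" by (rule continuous_constant_on_closure[of "{0<..}" ?d]) (use c 0 t cl in auto)
  then show ?thesis by simp
qed

lemma integral_halfline_cutoff:
  fixes F :: "real \<Rightarrow> 'b::euclidean_space"
  assumes F: "integrable halfline F" and 0: "\<And>t. t > b \<Longrightarrow> F t = 0" and b: "0 \<le> b"
  shows "integral\<^sup>L halfline F = integral {0..b} F"
proof -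
  have "integral\<^sup>L halfline F = integral {0..} F" using F by (rule lebesgue_integral_eq_integral) simp
  also have "\<dots> = integral {0..} (\<lambda>t. if t \<in> {0..b} then F t else 0)"
    using 0 by (intro integral_cong) auto
  also have "\<dots> = integral ({0..b} \<inter> {0..}) F" by (rule Henstock_Kurzweil_Integration.integral_restrict_Int)
  also have "{0..b} \<inter> {0..} = {0..b}" by auto
  finally show ?thesis .
qed

text \<open>Otherwise \<open>\<parallel>F\<parallel>\<close> would exceed \<open>\<parallel>L\<parallel> / 2\<close> on intervals of arbitrary length.\<close>

lemma integrable_tendsto_zero:
  fixes F :: "real \<Rightarrow> 'b::euclidean_space"
  assumes F: "integrable halfline F" and lim: "(F \<longlongrightarrow> L) at_top"
  shows "L = 0"
proof (rule ccontr)
  assume "L \<noteq> 0"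
  then have "\<forall>\<^sub>F t in at_top. dist (F t) L < norm L / 2" using lim by (intro tendstoD) auto
  then obtain N where N: "\<And>t. t \<ge> N \<Longrightarrow> dist (F t) L < norm L / 2" unfolding eventually_at_top_linorder by blast
  define a where "a = max N 0"
  have big: "norm L / 2 \<le> norm (F t)" if "t \<ge> a" for t
  proof -
    have "norm L \<le> norm (F t) + dist (F t) L" by (metis dist_commute dist_norm norm_triangle_sub)
    then show ?thesis using N[of t] that unfolding a_def by simp
  qed
  let ?I = "integral\<^sup>L halfline (\<lambda>t. norm (F t))"
  have "norm L / 2 * m \<le> ?I" if "m \<ge> 0" for m
  proof -
    have int: "integrable halfline (\<lambda>t. norm L / 2 * indicator {a..a+m} t)"
      by (intro integrable_mult_right integrable_halfline_indicator)
    have eq: "integral\<^sup>L halfline (\<lambda>t. norm L / 2 * indicator {a..a+m} t) = norm L / 2 * m"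
    proof -
      have "(\<lambda>t. indicator {0..} t *\<^sub>R indicator {a..a+m} t) = (indicator {a..a+m} :: real \<Rightarrow> real)"
        unfolding a_def by (auto simp: indicator_def fun_eq_iff)
      then have "integral\<^sup>L halfline (indicator {a..a+m}) = (integral\<^sup>L lebesgue (indicator {a..a+m}) :: real)"
        by (subst integral_restrict_space) simp_all
      then show ?thesis using that by simp
    qed
    have "integral\<^sup>L halfline (\<lambda>t. norm L / 2 * indicator {a..a+m} t) \<le> ?I"
      using F big by (intro integral_mono int integrable_norm) (auto simp: indicator_def)
    then show ?thesis unfolding eq .
  qed
  \<comment> \<open>An interval so long that the integral over it exceeds the total integral \<open>?I\<close>.\<close>
  from this[of "(?I + 1) / (norm L / 2)"] \<open>L \<noteq> 0\<close>
  have "?I + 1 \<le> ?I \<or> \<not> 0 \<le> (?I + 1) / (norm L / 2)" by auto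
  moreover have "0 \<le> ?I" by simp
  ultimately show False using \<open>L \<noteq> 0\<close> by (auto simp: field_simps)
qed

text \<open>\<open>sinv X\<close> is the inverse of a symplectic matrix \<open>X\<close>.\<close>

definition sinv :: "complex^('p::finite + 'p)^('p + 'p) \<Rightarrow> complex^('p + 'p) \<Rightarrow> complex^('p + 'p)" where
  "sinv X w = (\<chi> k. case k of Inl a \<Rightarrow> \<i> * symp (X *v axis (Inr a) 1) w
                            | Inr a \<Rightarrow> - \<i> * symp (X *v axis (Inl a) 1) w)"

lemma matrix_vector_bounded_bilinear: "bounded_bilinear ((*v) :: complex^'n^'m \<Rightarrow> _)"
  unfolding bilinear_conv_bounded_bilinear[symmetric] bilinear_def
  by (auto intro!: linearI simp: vec_eq_iff matrix_vector_mult_def sum.distrib algebra_simps scaleR_sum_right)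

lemma matrix_matrix_bounded_bilinear: "bounded_bilinear ((**) :: complex^'n^'m \<Rightarrow> complex^'k^'n \<Rightarrow> _)"
  unfolding bilinear_conv_bounded_bilinear[symmetric] bilinear_def
  by (auto intro!: linearI simp: vec_eq_iff matrix_matrix_mult_def sum.distrib algebra_simps scaleR_sum_right)

lemma sinv_nth: "sinv X w $ Inl a = \<i> * symp (X *v axis (Inr a) 1) w"
  "sinv X w $ Inr a = - \<i> * symp (X *v axis (Inl a) 1) w"
  by (simp_all add: sinv_def)

lemma sinv_bounded_bilinear: "bounded_bilinear (sinv :: complex^('p::finite + 'p)^('p + 'p) \<Rightarrow> _)"
proof -
  note mv = bounded_bilinear.add_left[OF matrix_vector_bounded_bilinear]
    bounded_bilinear.scaleR_left[OF matrix_vector_bounded_bilinear]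
  note sy = symp_linear(1,2) bounded_bilinear.scaleR_left[OF symp_bounded_bilinear]
    bounded_bilinear.scaleR_right[OF symp_bounded_bilinear]
  show ?thesis
    unfolding bilinear_conv_bounded_bilinear[symmetric] bilinear_def
    by (auto intro!: linearI simp: vec_Plus_eq_iff sinv_nth mv sy algebra_simps)
qed

lemma symp_axis: "symp (axis (Inr a) 1) v = - \<i> * v $ Inl a" "symp (axis (Inl a) 1) v = \<i> * v $ Inr a"
  unfolding symp_antisym[of "axis _ _"] by (simp_all add: symp_def sdot_axis J_mat_mult)

lemma sinv_inverse:
  fixes X :: "complex^('p::finite + 'p)^('p + 'p)"
  assumes X: "\<And>c d. symp (X *v c) (X *v d) = symp c d"
  shows "sinv X (X *v c) = c" "X *v sinv X w = w"
proof -
  show 1: "sinv X (X *v c) = c" for c by (simp add: vec_Plus_eq_iff sinv_nth X symp_axis)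
  have "inj ((*v) X)" using 1 by (metis injI)
  then obtain Y where "Y ** X = mat 1" using matrix_left_invertible_injective[of X] by (auto simp: inj_def)
  then have "X ** Y = mat 1" by (simp add: matrix_left_right_inverse)
  then have "w = X *v (Y *v w)" by (metis matrix_vector_mul_assoc matrix_vector_mul_lid)
  then show "X *v sinv X w = w" using 1 by metis
qed

section \<open>Solutions and the Lagrange identity\<close>

text \<open>The block conditions are packed into symmetry for \<open>sdot\<close>, a condition that is visibly stable under
  adding a multiple of the identity.\<close>

locale dirac =
  fixes Q :: "real \<Rightarrow> complex^('p::finite + 'p)^('p + 'p)"
  assumes Q_loc: "locally_integrable Q"
    and Q_sym: "AE t in halfline. \<forall>u v. sdot (Q t *v u) v = sdot u (Q t *v v)"
begin

text \<open>\<open>solution y f\<close> says that the differential expression maps \<open>y\<close> to \<open>f\<close>; the equation is solved for the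
  derivative, which makes differentiability almost everywhere part of the statement.\<close>

definition solution :: "(real \<Rightarrow> complex^('p + 'p)) \<Rightarrow> (real \<Rightarrow> complex^('p + 'p)) \<Rightarrow> bool" where
  "solution y f \<longleftrightarrow> AC_loc y \<and>
     (AE t in halfline. (y has_vector_derivative J_mat *v (Q t *v y t - f t)) (at t))"

lemma solution_AC: "solution y f \<Longrightarrow> AC_loc y"
  by (simp add: solution_def)

lemma solution_iff: "solution y f \<longleftrightarrow> AC_loc y \<and> (AE t in halfline. diff_expr Q y t = f t)"
proof -
  have "(AE t in halfline. (y has_vector_derivative J_mat *v (Q t *v y t - f t)) (at t)) \<longleftrightarrow>
      (AE t in halfline. diff_expr Q y t = f t)" if "AC_loc y"
  proof
    assume "AE t in halfline. (y has_vector_derivative J_mat *v (Q t *v y t - f t)) (at t)"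
    then show "AE t in halfline. diff_expr Q y t = f t"
      by eventually_elim (simp add: diff_expr_def J_eq_iff vector_derivative_at)
  next
    assume "AE t in halfline. diff_expr Q y t = f t"
    with AC_loc_derivative_AE[OF that]
    show "AE t in halfline. (y has_vector_derivative J_mat *v (Q t *v y t - f t)) (at t)"
      by eventually_elim (simp add: diff_expr_def J_eq_iff)
  qed
  then show ?thesis unfolding solution_def by blast
qed

lemma D_maxI:
  assumes "solution y f" "square_integrable y" "square_integrable f"
  shows "(l2_class y, l2_class f) \<in> D_max Q"
proof -
  have eq: "AE t in halfline. f t = diff_expr Q y t"
    using assms(1) unfolding solution_iff by (auto elim: AE_mp)
  have "square_integrable (diff_expr Q y)" by (rule square_integrable_cong_AE[OF assms(3) eq])
  moreover have "l2_class f = l2_class (diff_expr Q y)" by (rule l2_class_cong_AE[OF assms(3) eq])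
  ultimately show ?thesis using assms unfolding D_max_def max_domain_def by (auto simp: solution_AC)
qed

lemma D_maxE:
  assumes "(u, v) \<in> D_max Q"
  obtains y f where "solution y f" "square_integrable y" "square_integrable f" "u = l2_class y" "v = l2_class f"
proof -
  obtain y where "y \<in> max_domain Q" "u = l2_class y" "v = l2_class (diff_expr Q y)"
    using assms unfolding D_max_def by blast
  then show ?thesis using that[of y "diff_expr Q y"] unfolding max_domain_def solution_iff by auto
qed

text \<open>Because \<open>Q\<close> is symmetric for \<open>sdot\<close>, the potential drops out of the derivative of \<open>symp y w\<close>.\<close>

lemma lagrange:
  assumes y: "solution y f" and w: "solution w h"
  shows "primitive (\<lambda>t. symp (y t) (w t)) (\<lambda>t. sdot (f t) (w t) - sdot (y t) (h t))"
proof (rule primitiveI)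
  show "AC_loc (\<lambda>t. symp (y t) (w t))"
    by (rule AC_loc_bilinear[OF symp_bounded_bilinear solution_AC[OF y] solution_AC[OF w]])
  have "AE t in halfline. (y has_vector_derivative J_mat *v (Q t *v y t - f t)) (at t)"
    "AE t in halfline. (w has_vector_derivative J_mat *v (Q t *v w t - h t)) (at t)"
    using y w unfolding solution_def by auto
  then show "AE t in halfline. ((\<lambda>t. symp (y t) (w t)) has_vector_derivative sdot (f t) (w t) - sdot (y t) (h t)) (at t)"
    using Q_sym
  proof eventually_elim
    case (elim t)
    have "symp (y t) (J_mat *v (Q t *v w t - h t)) + symp (J_mat *v (Q t *v y t - f t)) (w t)
        = sdot (f t) (w t) - sdot (y t) (h t)"
      using elim(3) unfolding symp_def[of "J_mat *v _"] symp_alt[of "y t"] J_J by (simp add: sdot_linear)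
    then show ?case
      using bounded_bilinear.has_vector_derivative_prod[OF symp_bounded_bilinear elim(1,2)] by simp
  qed
qed

text \<open>The decisive fact: there is no boundary term at infinity. The function \<open>symp y w\<close> has a limit at
  infinity, since its derivative is integrable, and it is itself integrable as a product of square
  integrable functions, so the limit is zero.\<close>

lemma lagrange_halfline:
  assumes y: "solution y f" and w: "solution w h"
    and sq: "square_integrable y" "square_integrable f" "square_integrable w" "square_integrable h"
  shows "bil (l2_class f) (l2_class w) - bil (l2_class y) (l2_class h) = - symp (y 0) (w 0)"
proof -
  let ?F = "\<lambda>t. symp (y t) (w t)" and ?g = "\<lambda>t. sdot (f t) (w t) - sdot (y t) (h t)"
  note P = lagrange[OF y w]
  have int: "integrable halfline (\<lambda>t. sdot (f t) (w t))" "integrable halfline (\<lambda>t. sdot (y t) (h t))"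
    by (intro integrable_sdot sq)+
  then have g: "integrable halfline ?g" by simp
  have gs: "set_integrable lebesgue {0..} ?g"
    using g unfolding set_integrable_def by (subst (asm) integrable_restrict_space) auto
  have "((\<lambda>b. LINT t:{0..b}|lebesgue. ?g t) \<longlongrightarrow> (LINT t:{0..}|lebesgue. ?g t)) at_top"
    by (rule tendsto_set_lebesgue_integral_at_top[OF _ gs]) simp
  then have "((\<lambda>b. symp (y 0) (w 0) + (LINT t:{0..b}|lebesgue. ?g t)) \<longlongrightarrow> symp (y 0) (w 0) + (LINT t:{0..}|lebesgue. ?g t)) at_top"
    by (intro tendsto_intros)
  moreover have "\<forall>\<^sub>F b in at_top. symp (y 0) (w 0) + (LINT t:{0..b}|lebesgue. ?g t) = ?F b"
    using eventually_ge_at_top[of 0]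
  proof eventually_elim
    case (elim b)
    have "?g absolutely_integrable_on {0..b}"
      using primitive_locally_integrable[OF P] elim unfolding locally_integrable_def by blast
    then have "(LINT t:{0..b}|lebesgue. ?g t) = integral {0..b} ?g"
      by (rule set_lebesgue_integral_eq_integral(2))
    then show ?case using primitive_eq[OF P elim] by simp
  qed
  ultimately have "(?F \<longlongrightarrow> symp (y 0) (w 0) + (LINT t:{0..}|lebesgue. ?g t)) at_top"
    by (rule Lim_transform_eventually)
  then have "symp (y 0) (w 0) + (LINT t:{0..}|lebesgue. ?g t) = 0"
    by (rule integrable_tendsto_zero[rotated])
      (rule integrable_bilinear_square_integrable[OF symp_bounded_bilinear sq(1,3)])
  moreover have "(LINT t:{0..}|lebesgue. ?g t) = integral\<^sup>L halfline ?g"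
    unfolding set_lebesgue_integral_def by (subst integral_restrict_space) auto
  moreover have "integral\<^sup>L halfline ?g = bil (l2_class f) (l2_class w) - bil (l2_class y) (l2_class h)"
    using int by (simp add: bil_class sq)
  ultimately show ?thesis by (simp add: algebra_simps add_eq_0_iff)
qed

end

section \<open>The transpose of the minimal operator\<close>

text \<open>A piecewise linear cutoff profile: it increases with slope one on \<open>{0..s}\<close> and is constant afterwards.\<close>

definition ramp :: "real \<Rightarrow> real \<Rightarrow> real" where
  "ramp s t = min (max 0 t) s"

lemma ramp_measurable [measurable]: "ramp s \<in> borel_measurable borel"
  unfolding ramp_def[abs_def] by measurable

lemma ramp_bounds: "0 \<le> s \<Longrightarrow> 0 \<le> ramp s t" "ramp s t \<le> s"
  by (auto simp: ramp_def)

lemma AC_loc_ident: "AC_loc (\<lambda>t. t :: real)"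
proof (rule AC_loc_cong)
  have "locally_integrable (\<lambda>t. 1 :: real)"
    unfolding locally_integrable_def by (simp add: absolutely_integrable_on_const)
  from primitive_imp_AC_loc[OF primitive_integral[OF this, of 0]]
  show "AC_loc (\<lambda>t. 0 + integral {0..t} (\<lambda>t. 1 :: real))" .
qed simp

lemma AC_loc_ramp: "AC_loc (ramp s)"
  by (rule AC_loc_bounded_image[OF AC_loc_ident zero_le_one]) (auto simp: ramp_def min_def)

lemma ramp_derivative_AE:
  "AE t in halfline. (ramp s has_vector_derivative (if t < s then 1 else 0)) (at t)"
  unfolding AE_halfline_iff
proof -
  have "{s} \<in> null_sets lebesgue" using negligible_sing negligible_iff_null_sets by blast
  from AE_not_in[OF this] show "AE t in lebesgue. 0 < t \<longrightarrow> (ramp s has_vector_derivative (if t < s then 1 else 0)) (at t)"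
  proof eventually_elim
    case (elim t)
    show ?case
    proof
      assume t: "0 < t"
      show "(ramp s has_vector_derivative (if t < s then 1 else 0)) (at t)"
      proof (cases "t < s")
        case True
        have "((\<lambda>t. t) has_vector_derivative 1) (at t)" by (rule has_vector_derivative_id)
        then have "(ramp s has_vector_derivative 1) (at t)"
          by (rule has_vector_derivative_transform_within_open[of _ _ _ "{0<..<s}"]) (use t True in \<open>auto simp: ramp_def\<close>)
        then show ?thesis using True by simp
      next
        case False
        with elim have "s < t" by simp
        have "((\<lambda>t. min s (max 0 s)) has_vector_derivative 0) (at t)" by (rule has_vector_derivative_const)
        then have "(ramp s has_vector_derivative 0) (at t)"
          by (rule has_vector_derivative_transform_within_open[of _ _ _ "{max 0 s<..}"]) (use t \<open>s < t\<close> in \<open>auto simp: ramp_def\<close>)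
        then show ?thesis using False by simp
      qed
    qed
  qed
qed

lemma has_integral_step:
  fixes \<kappa> :: "real \<Rightarrow> 'b::euclidean_space"
  assumes "\<kappa> integrable_on {0..s}" "s \<le> b"
  shows "((\<lambda>t. (if t < s then 1 else 0) *\<^sub>R \<kappa> t) has_integral integral {0..s} \<kappa>) {0..b}"
proof -
  have eq: "{0..s} \<inter> {0..b} = {0..s}" using assms(2) by auto
  have "(\<kappa> has_integral integral {0..s} \<kappa>) ({0..s} \<inter> {0..b})"
    unfolding eq using assms(1) by (rule integrable_integral)
  then have "((\<lambda>t. if t \<in> {0..s} then \<kappa> t else 0) has_integral integral {0..s} \<kappa>) {0..b}"
    by (simp only: has_integral_restrict_Int)
  then show ?thesis
    by (rule has_integral_spike_finite[of "{s}", rotated 2]) auto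
qed

context dirac
begin

definition fund :: "real \<Rightarrow> complex^('p + 'p)^('p + 'p)" where
  "fund = (SOME \<Phi>. primitive \<Phi> (\<lambda>t. (J_mat ** Q t) ** \<Phi> t) \<and> \<Phi> 0 = mat 1)"

lemma fund: "primitive fund (\<lambda>t. (J_mat ** Q t) ** fund t)" and fund_0: "fund 0 = mat 1"
proof -
  have "locally_integrable (\<lambda>t. J_mat ** Q t)"
    using bounded_bilinear.bounded_linear_right[OF matrix_matrix_bounded_bilinear] Q_loc
    by (rule locally_integrable_linear)
  then obtain \<Phi> where "primitive \<Phi> (\<lambda>t. (J_mat ** Q t) ** \<Phi> t)" "\<Phi> 0 = mat 1"
    using linear_ode_solution[OF matrix_matrix_bounded_bilinear] by blast
  then have "\<exists>\<Phi>. primitive \<Phi> (\<lambda>t. (J_mat ** Q t) ** \<Phi> t) \<and> \<Phi> 0 = mat 1" by blast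
  from someI_ex[OF this] show "primitive fund (\<lambda>t. (J_mat ** Q t) ** fund t)" "fund 0 = mat 1"
    unfolding fund_def by blast+
qed

lemma AC_loc_fund: "AC_loc fund"
  by (rule primitive_imp_AC_loc[OF fund])

lemma fund_continuous: "continuous_on {0..} (\<lambda>t. fund t *v c)"
  by (intro bounded_bilinear.continuous_on[OF matrix_vector_bounded_bilinear] AC_loc_continuous_on AC_loc_fund continuous_intros)

lemma variation_of_constants:
  assumes \<eta>: "AC_loc \<eta>" "AE t in halfline. (\<eta> has_vector_derivative e t) (at t)"
  shows "solution (\<lambda>t. fund t *v \<eta> t) (\<lambda>t. J_mat *v (fund t *v e t))"
  unfolding solution_def
proof
  show "AC_loc (\<lambda>t. fund t *v \<eta> t)"
    by (rule AC_loc_bilinear[OF matrix_vector_bounded_bilinear AC_loc_fund \<eta>(1)])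
  show "AE t in halfline. ((\<lambda>t. fund t *v \<eta> t) has_vector_derivative
      J_mat *v (Q t *v (fund t *v \<eta> t) - J_mat *v (fund t *v e t))) (at t)"
    using primitive_derivative_AE[OF fund] \<eta>(2)
  proof eventually_elim
    case (elim t)
    have "J_mat *v (Q t *v (fund t *v \<eta> t) - J_mat *v (fund t *v e t)) = fund t *v e t + (J_mat ** Q t ** fund t) *v \<eta> t"
      by (simp add: bounded_bilinear.diff_right[OF matrix_vector_bounded_bilinear] J_J matrix_vector_mul_assoc[symmetric])
    then show ?case
      using bounded_bilinear.has_vector_derivative_prod[OF matrix_vector_bounded_bilinear elim] by simp
  qed
qed

lemma fund_solution: "solution (\<lambda>t. fund t *v c) (\<lambda>t. 0)"
proof -
  have "solution (\<lambda>t. fund t *v c) (\<lambda>t. J_mat *v (fund t *v 0))"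
    by (rule variation_of_constants[OF AC_loc_const]) (simp add: has_vector_derivative_const)
  then show ?thesis by (simp add: bounded_bilinear.zero_right[OF matrix_vector_bounded_bilinear])
qed

lemma symp_homogeneous_constant:
  assumes "solution y (\<lambda>t. 0)" "solution w (\<lambda>t. 0)" "0 \<le> t"
  shows "symp (y t) (w t) = symp (y 0) (w 0)"
  using primitive_eq[OF lagrange[OF assms(1,2)] assms(3)] by (simp add: sdot_linear)

text \<open>The symplectic form of two homogeneous solutions is constant, and \<open>fund 0\<close> is the identity.\<close>

lemma fund_symplectic:
  assumes "0 \<le> t"
  shows "symp (fund t *v c) (fund t *v d) = symp c d"
  using symp_homogeneous_constant[OF fund_solution[of c] fund_solution[of d] assms] by (simp add: fund_0)

text \<open>A solution vanishing at \<open>0\<close> has constant symplectic product \<open>0\<close> with every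
  homogeneous solution, and at each \<open>t\<close> these take all values.\<close>

lemma homogeneous_unique:
  assumes y: "solution y (\<lambda>t. 0)" "y 0 = 0" and t: "0 \<le> t"
  shows "y t = 0"
proof (rule symp_nondegenerate)
  fix v
  have "v = fund t *v sinv (fund t) v" by (rule sinv_inverse(2)[symmetric]) (rule fund_symplectic[OF t])
  then show "symp (y t) v = 0"
    using symp_homogeneous_constant[OF y(1) fund_solution[of "sinv (fund t) v"] t] y(2) by (simp add: symp_linear)
qed

text \<open>A smooth compactly supported function is in general not in the maximal domain, because \<open>Q\<close> is only
  locally integrable. Multiplying a homogeneous solution by a cutoff function \<open>k\<close> avoids this: the terms
  that contain \<open>Q\<close> cancel, and the differential expression only sees \<open>k'\<close>.\<close>

lemma cutoff_solution:
  assumes k: "AC_loc k" "AE t in halfline. (k has_vector_derivative k' t) (at t)"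
    "k \<in> borel_measurable borel" "k' \<in> borel_measurable borel"
    "\<And>t. \<bar>k t\<bar> \<le> M" "\<And>t. \<bar>k' t\<bar> \<le> M'" "\<And>t. t > b \<Longrightarrow> k t = 0" "\<And>t. t > b \<Longrightarrow> k' t = 0"
  shows "solution (\<lambda>t. k t *\<^sub>R (fund t *v c)) (\<lambda>t. k' t *\<^sub>R (J_mat *v (fund t *v c)))"
    "square_integrable (\<lambda>t. k t *\<^sub>R (fund t *v c))"
    "square_integrable (\<lambda>t. k' t *\<^sub>R (J_mat *v (fund t *v c)))"
proof -
  have "solution (\<lambda>t. fund t *v (k t *\<^sub>R c)) (\<lambda>t. J_mat *v (fund t *v (k' t *\<^sub>R c)))"
  proof (rule variation_of_constants)
    show "AC_loc (\<lambda>t. k t *\<^sub>R c)" by (rule AC_loc_linear[OF bounded_linear_scaleR_left k(1)])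
    show "AE t in halfline. ((\<lambda>t. k t *\<^sub>R c) has_vector_derivative k' t *\<^sub>R c) (at t)"
      using k(2) by eventually_elim (rule bounded_linear.has_vector_derivative[OF bounded_linear_scaleR_left])
  qed
  then show "solution (\<lambda>t. k t *\<^sub>R (fund t *v c)) (\<lambda>t. k' t *\<^sub>R (J_mat *v (fund t *v c)))"
    by (simp add: bounded_bilinear.scaleR_right[OF matrix_vector_bounded_bilinear])
  show "square_integrable (\<lambda>t. k t *\<^sub>R (fund t *v c))"
    by (rule square_integrable_cutoff[OF fund_continuous k(3,5,7)])
  have "continuous_on {0..} (\<lambda>t. J_mat *v (fund t *v c))"
    by (intro bounded_linear.continuous_on[OF bounded_linear_matrix_vector] fund_continuous)
  then show "square_integrable (\<lambda>t. k' t *\<^sub>R (J_mat *v (fund t *v c)))"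
    by (rule square_integrable_cutoff[OF _ k(4,6,8)])
qed

definition D_min0 :: "('p + 'p) l2_op" where
  "D_min0 = {(l2_class y, l2_class (diff_expr Q y)) | y.
     y \<in> max_domain Q \<and> (\<exists>b. \<forall>t>b. y t = 0) \<and> y 0 = 0}"

lemma D_min_closure: "D_min Q = closure D_min0"
  unfolding D_min_def D_min0_def ..

lemma D_min0_subset: "D_min0 \<subseteq> D_max Q"
  unfolding D_min0_def D_max_def by blast

lemma D_min0I:
  assumes "solution y f" "square_integrable y" "square_integrable f" "\<And>t. t > b \<Longrightarrow> y t = 0" "y 0 = 0"
  shows "(l2_class y, l2_class f) \<in> D_min0"
proof -
  have eq: "AE t in halfline. f t = diff_expr Q y t"
    using assms(1) unfolding solution_iff by (auto elim: AE_mp)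
  have "square_integrable (diff_expr Q y)" by (rule square_integrable_cong_AE[OF assms(3) eq])
  moreover have "l2_class f = l2_class (diff_expr Q y)" by (rule l2_class_cong_AE[OF assms(3) eq])
  moreover have "\<exists>b. \<forall>t>b. y t = 0" using assms(4) by blast
  ultimately show ?thesis using assms solution_AC[OF assms(1)] unfolding D_min0_def max_domain_def by auto
qed

lemma D_min0E:
  assumes "(u, v) \<in> D_min0"
  obtains y f where "solution y f" "square_integrable y" "square_integrable f" "u = l2_class y" "v = l2_class f" "y 0 = 0"
proof -
  obtain y where "y \<in> max_domain Q" "u = l2_class y" "v = l2_class (diff_expr Q y)" "y 0 = 0"
    using assms unfolding D_min0_def by blast
  then show ?thesis using that[of y "diff_expr Q y"] unfolding max_domain_def solution_iff by auto
qed

text \<open>The fundamental lemma of the calculus of variations for the differential expression: testing with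
  functions \<open>\<theta> \<Phi> c\<close>, where \<open>\<theta>\<close> is a tent function, shows that \<open>\<Phi>\<inverse>(u - w)\<close> is constant.\<close>

lemma transpose_D_min0: "transpose_op D_min0 = D_max Q"
proof
  show "D_max Q \<subseteq> transpose_op D_min0"
  proof
    fix p assume "p \<in> D_max Q"
    then obtain u v where p: "p = (u, v)" "(u, v) \<in> D_max Q" by (cases p) auto
    then obtain w h where w: "solution w h" "square_integrable w" "square_integrable h" "u = l2_class w" "v = l2_class h"
      using D_maxE by blast
    have "bil g u = bil f v" if fg: "(f, g) \<in> D_min0" for f g
    proof -
      obtain y k where y: "solution y k" "square_integrable y" "square_integrable k" "f = l2_class y" "g = l2_class k" "y 0 = 0"
        using D_min0E[OF fg] by blast
      show ?thesis using lagrange_halfline[OF y(1) w(1) y(2,3) w(2,3)] y w by (simp add: symp_linear)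
    qed
    then show "p \<in> transpose_op D_min0" unfolding transpose_op_def p by auto
  qed
  show "transpose_op D_min0 \<subseteq> D_max Q"
  proof
    fix p assume "p \<in> transpose_op D_min0"
    then obtain u v where p: "p = (u, v)" and uv: "\<And>f g. (f, g) \<in> D_min0 \<Longrightarrow> bil g u = bil f v"
      unfolding transpose_op_def by (cases p) auto
    obtain U where U: "square_integrable U" "u = l2_class U" by (rule l2_class_cases)
    obtain h where h: "square_integrable h" "v = l2_class h" by (rule l2_class_cases)
    \<comment> \<open>a solution \<open>w = \<Phi> \<eta>\<close> of the inhomogeneous equation with right-hand side \<open>h\<close>\<close>
    define e where "e t = sinv (fund t) (- (J_mat *v h t))" for t
    have locJ: "locally_integrable (\<lambda>t. - (J_mat *v h t))"
      by (intro locally_integrable_linear[OF bounded_linear_minus[OF bounded_linear_matrix_vector]]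
          square_integrable_imp_locally_integrable h(1))
    have loce: "locally_integrable e"
      unfolding e_def by (rule locally_integrable_bilinear[OF sinv_bounded_bilinear AC_loc_continuous_on[OF AC_loc_fund] locJ])
    have sol: "solution (\<lambda>t. fund t *v (\<zeta> + integral {0..t} e)) h" for \<zeta>
    proof -
      have P: "primitive (\<lambda>t. \<zeta> + integral {0..t} e) e" by (rule primitive_integral[OF loce])
      have "solution (\<lambda>t. fund t *v (\<zeta> + integral {0..t} e)) (\<lambda>t. J_mat *v (fund t *v e t))"
        by (rule variation_of_constants[OF primitive_imp_AC_loc[OF P] primitive_derivative_AE[OF P]])
      moreover have "AE t in halfline. J_mat *v (fund t *v e t) = h t"
      proof (rule AE_I2)
        fix t :: real assume "t \<in> space halfline"
        then have "fund t *v e t = - (J_mat *v h t)"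
          unfolding e_def by (intro sinv_inverse(2) fund_symplectic) simp
        then have "fund t *v e t = J_mat *v (0 - h t)" by (simp add: vec_Plus_eq_iff J_mat_mult)
        then show "J_mat *v (fund t *v e t) = h t" by (simp only: J_J) simp
      qed
      ultimately show ?thesis unfolding solution_iff by (auto elim: AE_mp)
    qed
    define w where "w = (\<lambda>t. fund t *v (0 + integral {0..t} e))"
    have w: "solution w h" unfolding w_def by (rule sol)
    have locw: "locally_integrable (\<lambda>t. U t - w t)"
    proof -
      have "locally_integrable w"
        unfolding locally_integrable_def
      proof (intro allI impI absolutely_integrable_continuous_real)
        fix b :: real
        show "continuous_on {0..b} w"
          using AC_loc_continuous_on[OF solution_AC[OF w]] by (rule continuous_on_subset) auto
      qed
      then show ?thesis using square_integrable_imp_locally_integrable[OF U(1)]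
        unfolding locally_integrable_def by (blast intro: set_integral_diff(1))
    qed
    define \<kappa> where "\<kappa> c t = symp (fund t *v c) (U t - w t)" for c t
    have loc\<kappa>: "locally_integrable (\<kappa> c)" for c
      unfolding \<kappa>_def by (rule locally_integrable_bilinear[OF symp_bounded_bilinear fund_continuous locw])
    \<comment> \<open>The tent function \<open>k\<close> has slope \<open>1 - s / b\<close> on \<open>{0..s}\<close>, slope \<open>- s / b\<close> on \<open>{s..b}\<close>, and vanishes at \<open>0\<close> and \<open>b\<close>.\<close>
    have lin: "integral {0..s} (\<kappa> c) = (s / b) *\<^sub>R integral {0..b} (\<kappa> c)" if s: "0 < s" "s \<le> b" for s b c
    proof -
      have b: "0 < b" using s by simp
      define k where "k t = ramp s t - (s / b) * ramp b t" for t
      define k' where "k' t = (if t < s then 1 else 0) - (s / b) * (if t < b then 1 else 0)" for t :: real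
      define y where "y = (\<lambda>t. k t *\<^sub>R (fund t *v c))"
      define f where "f = (\<lambda>t. k' t *\<^sub>R (J_mat *v (fund t *v c)))"
      have kd: "AE t in halfline. (k has_vector_derivative k' t) (at t)"
        using ramp_derivative_AE[of s] ramp_derivative_AE[of b]
        by eventually_elim (unfold k_def[abs_def] k'_def, intro has_vector_derivative_diff
            bounded_linear.has_vector_derivative[OF bounded_linear_mult_right])
      have kAC: "AC_loc k"
        using AC_loc_add[OF AC_loc_ramp[of s] AC_loc_linear[OF bounded_linear_mult_right[of "- (s/b)"] AC_loc_ramp[of b]]]
        by (simp add: k_def[abs_def])
      have kb: "\<bar>k t\<bar> \<le> 2 * s" for t
      proof -
        have "0 \<le> ramp s t" "ramp s t \<le> s" using ramp_bounds s by auto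
        moreover have "0 \<le> (s/b) * ramp b t" using ramp_bounds(1)[of b t] s by simp
        moreover have "(s/b) * ramp b t \<le> (s/b) * b" using ramp_bounds(2)[of b t] s by (intro mult_left_mono) auto
        moreover have "(s/b) * b = s" using b by simp
        moreover have "\<bar>x - q\<bar> \<le> 2 * s" if "0 \<le> x" "x \<le> s" "0 \<le> q" "q \<le> s" for x q using that by linarith
        ultimately show ?thesis unfolding k_def by metis
      qed
      have k'b: "\<bar>k' t\<bar> \<le> 2" for t
      proof -
        have "0 \<le> s / b" "s / b \<le> 1" using s b by auto
        then show ?thesis unfolding k'_def by auto
      qed
      have meas: "k \<in> borel_measurable borel" "k' \<in> borel_measurable borel"
        unfolding k_def[abs_def] k'_def[abs_def] by measurable
      have k0: "k t = 0" "k' t = 0" if "t > b" for t using that s b by (auto simp: k_def k'_def ramp_def)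
      note cut = cutoff_solution[where c=c and b=b, OF kAC kd meas kb k'b k0, folded y_def f_def]
      have y0: "y 0 = 0" using s b by (simp add: y_def k_def ramp_def)
      have yb: "y b = 0" using s b by (simp add: y_def k_def ramp_def)
      have yt: "y t = 0" "f t = 0" if "t > b" for t using k0[OF that] by (simp_all add: y_def f_def)
      have mem: "(l2_class y, l2_class f) \<in> D_min0"
        by (rule D_min0I[where b=b, OF cut yt(1) y0])
      have int1: "integrable halfline (\<lambda>t. sdot (f t) (U t))" and int2: "integrable halfline (\<lambda>t. sdot (y t) (h t))"
        using integrable_sdot[OF cut(3) U(1)] integrable_sdot[OF cut(2) h(1)] by auto
      have hi: "(F has_integral integral\<^sup>L halfline F) {0..b}"
        if F: "integrable halfline F" "\<And>t. t > b \<Longrightarrow> F t = 0" for F :: "real \<Rightarrow> complex"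
      proof -
        have "F integrable_on {0..}" using F(1) by (rule integrable_on_lebesgue_on) simp
        then have "F integrable_on {0..b}" by (rule integrable_on_subinterval) auto
        then show ?thesis using integral_halfline_cutoff[OF F] b by (simp add: has_integral_integral)
      qed
      have eq: "integral\<^sup>L halfline (\<lambda>t. sdot (f t) (U t)) = integral\<^sup>L halfline (\<lambda>t. sdot (y t) (h t))"
        using uv[OF mem] U h cut by (simp add: bil_class)
      note L = lagrange[OF cut(1) w]
      have "((\<lambda>t. sdot (f t) (w t) - sdot (y t) (h t)) has_integral 0) {0..b}"
        using primitive_eq[OF L, of b] locally_integrable_integrable[OF primitive_locally_integrable[OF L], of 0 b] b
        by (simp add: has_integral_integrable_integral y0 yb symp_linear)
      from has_integral_diff[OF has_integral_diff[OF hi[OF int1] hi[OF int2]] this]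
      have "((\<lambda>t. sdot (f t) (U t) - sdot (y t) (h t) - (sdot (f t) (w t) - sdot (y t) (h t))) has_integral 0) {0..b}"
        using yt eq by (simp add: sdot_linear)
      then have 0: "((\<lambda>t. k' t *\<^sub>R \<kappa> c t) has_integral 0) {0..b}"
        by (simp add: f_def \<kappa>_def symp_def sdot_linear bounded_bilinear.scaleR_left[OF sdot_bounded_bilinear] scaleR_diff_right)
      have "((\<lambda>t. (if t < s then 1 else 0) *\<^sub>R \<kappa> c t - (s/b) *\<^sub>R ((if t < b then 1 else 0) *\<^sub>R \<kappa> c t))
          has_integral (integral {0..s} (\<kappa> c) - (s/b) *\<^sub>R integral {0..b} (\<kappa> c))) {0..b}"
        using s by (intro has_integral_diff has_integral_cmul has_integral_step locally_integrable_integrable[OF loc\<kappa>]) auto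
      also have "(\<lambda>t. (if t < s then 1 else 0) *\<^sub>R \<kappa> c t - (s/b) *\<^sub>R ((if t < b then 1 else 0) *\<^sub>R \<kappa> c t)) = (\<lambda>t. k' t *\<^sub>R \<kappa> c t)"
        by (auto simp: k'_def algebra_simps fun_eq_iff)
      finally have "integral {0..s} (\<kappa> c) - (s/b) *\<^sub>R integral {0..b} (\<kappa> c) = 0"
        using 0 by (rule has_integral_unique)
      then show ?thesis by simp
    qed
    \<comment> \<open>The integral of \<open>\<kappa> c\<close> over \<open>{0..s}\<close> is linear in \<open>s\<close>, so \<open>\<kappa> c\<close> is constant.\<close>
    have AEm: "AE t in halfline. \<kappa> c t = integral {0..1} (\<kappa> c)" for c
    proof -
      let ?m = "integral {0..1} (\<kappa> c)"
      have K: "0 + integral {0..s} (\<kappa> c) = s *\<^sub>R ?m" if "0 < s" for s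
      proof (cases "s \<le> 1")
        case True
        then show ?thesis using lin[OF that, of 1] by simp
      next
        case False
        then show ?thesis using lin[of 1 s] by simp
      qed
      show ?thesis
        using primitive_derivative_AE[OF primitive_integral[OF loc\<kappa>[of c], of 0]]
        unfolding AE_halfline_iff
      proof eventually_elim
        case (elim t)
        show ?case
        proof
          assume t: "0 < t"
          have "((\<lambda>s. s *\<^sub>R ?m) has_vector_derivative ?m) (at t)"
            by (auto intro!: derivative_eq_intros)
          then have "((\<lambda>s. 0 + integral {0..s} (\<kappa> c)) has_vector_derivative ?m) (at t)"
          proof (rule has_vector_derivative_transform_within_open[of _ _ _ "{0<..}"])
            show "open {0::real<..}" "t \<in> {0<..}" using t by simp_all
            show "y *\<^sub>R ?m = 0 + integral {0..y} (\<kappa> c)" if "y \<in> {0<..}" for y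
              by (rule K[symmetric]) (use that in simp)
          qed
          with elim t show "\<kappa> c t = ?m" by (blast intro: vector_derivative_unique_at)
        qed
      qed
    qed
    \<comment> \<open>\<open>\<zeta>\<close> is the constant value of \<open>sinv (fund t) (U t - w t)\<close>, written in components.\<close>
    define \<zeta> :: "complex^('p + 'p)" where "\<zeta> = (\<chi> k. case k of Inl a \<Rightarrow> \<i> * integral {0..1} (\<kappa> (axis (Inr a) 1))
                            | Inr a \<Rightarrow> - \<i> * integral {0..1} (\<kappa> (axis (Inl a) 1)))"
    have "AE t in halfline. \<forall>k. \<kappa> (axis k 1) t = integral {0..1} (\<kappa> (axis k 1))"
      unfolding AE_all_countable using AEm by blast
    moreover have "AE t in halfline. 0 \<le> t" by (rule AE_I2) simp
    ultimately have Ueq: "AE t in halfline. U t = fund t *v (\<zeta> + integral {0..t} e)"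
    proof eventually_elim
      case (elim t)
      have "sinv (fund t) (U t - w t) = \<zeta>"
        using elim(1) by (simp add: vec_Plus_eq_iff sinv_nth \<zeta>_def \<kappa>_def)
      then have "U t - w t = fund t *v \<zeta>"
        using sinv_inverse(2)[of "fund t" "U t - w t", OF fund_symplectic[OF elim(2)]] by simp
      then have "U t = fund t *v \<zeta> + w t" by (simp add: algebra_simps)
      then show ?case by (simp add: w_def bounded_bilinear.add_right[OF matrix_vector_bounded_bilinear])
    qed
    have "(l2_class (\<lambda>t. fund t *v (\<zeta> + integral {0..t} e)), l2_class h) \<in> D_max Q"
      by (rule D_maxI[OF sol square_integrable_cong_AE[OF U(1) Ueq] h(1)])
    then show "p \<in> D_max Q" unfolding p U(2) h(2) l2_class_cong_AE[OF U(1) Ueq] .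
  qed
qed

end

section \<open>Boundary values and eigenspaces\<close>

lemma transpose_op_iff: "(u, v) \<in> transpose_op T \<longleftrightarrow> (\<forall>f g. (f, g) \<in> T \<longrightarrow> bil g u = bil f v)"
  unfolding transpose_op_def by auto

lemma transpose_op_add:
  "(u, v) \<in> transpose_op T \<Longrightarrow> (u', v') \<in> transpose_op T \<Longrightarrow> (u + u', v + v') \<in> transpose_op T"
  by (simp add: transpose_op_iff bil_add_right)

lemma transpose_op_scale:
  "(u, v) \<in> transpose_op T \<Longrightarrow> (cscale c u, cscale c v) \<in> transpose_op T"
  by (simp add: transpose_op_iff bil_scale_right)

lemma transpose_op_antimono: "S \<subseteq> T \<Longrightarrow> transpose_op T \<subseteq> transpose_op S"
  unfolding transpose_op_def by blast

lemma subspace_closure: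
  fixes S :: "'a::real_normed_vector set"
  assumes S: "subspace S"
  shows "subspace (closure S)"
  unfolding subspace_def
proof (intro conjI ballI allI)
  show "0 \<in> closure S" using S subspace_0 closure_subset by blast
  fix x y assume "x \<in> closure S" "y \<in> closure S"
  then obtain f g where f: "\<And>n. f n \<in> S" "f \<longlonglongrightarrow> x" and g: "\<And>n. g n \<in> S" "g \<longlonglongrightarrow> y"
    unfolding closure_sequential by blast
  have "(\<lambda>n. f n + g n) \<longlonglongrightarrow> x + y" "\<And>n. f n + g n \<in> S"
    using f g S by (auto intro: tendsto_add subspace_add)
  then show "x + y \<in> closure S" unfolding closure_sequential by (intro exI[of _ "\<lambda>n. f n + g n"]) simp
  fix c
  have "(\<lambda>n. c *\<^sub>R f n) \<longlonglongrightarrow> c *\<^sub>R x" "\<And>n. c *\<^sub>R f n \<in> S"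
    using f S by (auto intro: tendsto_scaleR subspace_scale)
  then show "c *\<^sub>R x \<in> closure S" unfolding closure_sequential by (intro exI[of _ "\<lambda>n. c *\<^sub>R f n"]) simp
qed

lemma mat_vec: "mat z *v v = z *s (v :: complex^'n)"
proof -
  have "(if i = j then z else 0) * v $ j = (if i = j then z * v $ j else 0)" for i j by simp
  then show ?thesis by (simp add: vec_eq_iff matrix_vector_mult_def mat_def)
qed

lemma mat_vec_scale: "M *v (c *s v) = c *s (M *v (v :: complex^'n) :: complex^'m)"
  by (simp add: vec_eq_iff matrix_vector_mult_def sum_distrib_left mult_ac)

lemma vec_of_real_scale: "of_real r *s v = r *\<^sub>R (v :: complex^'n)"
  unfolding vec_eq_iff vector_scaleR_component vector_smult_component by (simp add: scaleR_conv_of_real)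

text \<open>The absolutely continuous representative of a class; on the half-line it does not depend on the choice.\<close>

definition rep_ac :: "('b::euclidean_space) l2 \<Rightarrow> real \<Rightarrow> 'b" where
  "rep_ac u = (SOME y. AC_loc y \<and> square_integrable y \<and> l2_class y = u)"

lemma rep_ac_class:
  assumes "AC_loc y" "square_integrable y" "0 \<le> t"
  shows "rep_ac (l2_class y) t = y t"
proof -
  let ?P = "\<lambda>w. AC_loc w \<and> square_integrable w \<and> l2_class w = l2_class y"
  have "?P (rep_ac (l2_class y))"
    unfolding rep_ac_def by (rule someI[of ?P y]) (use assms in simp)
  then show ?thesis
    using AC_loc_eqI_AE[of "rep_ac (l2_class y)" y t] assms l2_class_eq_iff[of "rep_ac (l2_class y)" y] by blast
qed

context dirac
begin

lemma solution_add:
  assumes "solution y f" "solution w h"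
  shows "solution (\<lambda>t. y t + w t) (\<lambda>t. f t + h t)"
  unfolding solution_def
proof
  show "AC_loc (\<lambda>t. y t + w t)" by (rule AC_loc_add[OF assms[THEN solution_AC]])
  have "AE t in halfline. (y has_vector_derivative J_mat *v (Q t *v y t - f t)) (at t)"
    "AE t in halfline. (w has_vector_derivative J_mat *v (Q t *v w t - h t)) (at t)"
    using assms unfolding solution_def by auto
  then show "AE t in halfline. ((\<lambda>t. y t + w t) has_vector_derivative J_mat *v (Q t *v (y t + w t) - (f t + h t))) (at t)"
  proof eventually_elim
    case (elim t)
    have "J_mat *v (Q t *v (y t + w t) - (f t + h t)) = J_mat *v (Q t *v y t - f t) + J_mat *v (Q t *v w t - h t)"
      by (simp add: bounded_bilinear.diff_right[OF matrix_vector_bounded_bilinear]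
          bounded_bilinear.add_right[OF matrix_vector_bounded_bilinear])
    with has_vector_derivative_add[OF elim] show ?case by simp
  qed
qed

lemma solution_scale:
  assumes "solution y f"
  shows "solution (\<lambda>t. c *s y t) (\<lambda>t. c *s f t)"
  unfolding solution_def
proof
  show "AC_loc (\<lambda>t. c *s y t)" by (rule AC_loc_linear[OF bounded_linear_vec_scale solution_AC[OF assms]])
  have "AE t in halfline. (y has_vector_derivative J_mat *v (Q t *v y t - f t)) (at t)"
    using assms unfolding solution_def by auto
  then show "AE t in halfline. ((\<lambda>t. c *s y t) has_vector_derivative J_mat *v (Q t *v (c *s y t) - c *s f t)) (at t)"
  proof eventually_elim
    case (elim t)
    have "J_mat *v (Q t *v (c *s y t) - c *s f t) = c *s (J_mat *v (Q t *v y t - f t))"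
      by (simp add: bounded_bilinear.diff_right[OF matrix_vector_bounded_bilinear] mat_vec_scale vec_eq_iff algebra_simps)
    with bounded_linear.has_vector_derivative[OF bounded_linear_vec_scale elim] show ?case by simp
  qed
qed

lemma D_max_add: "(u, v) \<in> D_max Q \<Longrightarrow> (u', v') \<in> D_max Q \<Longrightarrow> (u + u', v + v') \<in> D_max Q"
  unfolding transpose_D_min0[symmetric] by (rule transpose_op_add)

lemma D_max_scale: "(u, v) \<in> D_max Q \<Longrightarrow> (cscale c u, cscale c v) \<in> D_max Q"
  unfolding transpose_D_min0[symmetric] by (rule transpose_op_scale)

lemma D_max_diff: "(u, v) \<in> D_max Q \<Longrightarrow> (u', v') \<in> D_max Q \<Longrightarrow> (u - u', v - v') \<in> D_max Q"
  using D_max_add[of u v "cscale (-1) u'" "cscale (-1) v'"] D_max_scale[of u' v' "-1"]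
  by (simp add: cscale_minus_one)

lemma D_max_0: "(0, 0) \<in> D_max Q"
  unfolding transpose_D_min0[symmetric] transpose_op_def by auto

lemma rep_ac_D_max_add:
  assumes "(u, v) \<in> D_max Q" "(u', v') \<in> D_max Q" "0 \<le> t"
  shows "rep_ac (u + u') t = rep_ac u t + rep_ac u' t"
proof -
  obtain y f where y: "solution y f" "square_integrable y" "u = l2_class y" using D_maxE[OF assms(1)] by metis
  obtain w h where w: "solution w h" "square_integrable w" "u' = l2_class w" using D_maxE[OF assms(2)] by metis
  show ?thesis
    using rep_ac_class[OF solution_AC[OF y(1)] y(2) assms(3)] rep_ac_class[OF solution_AC[OF w(1)] w(2) assms(3)]
      rep_ac_class[OF AC_loc_add[OF solution_AC[OF y(1)] solution_AC[OF w(1)]] square_integrable_add[OF y(2) w(2)] assms(3)]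
    by (simp add: y w l2_class_add)
qed

lemma rep_ac_D_max_scale:
  assumes "(u, v) \<in> D_max Q" "0 \<le> t"
  shows "rep_ac (cscale c u) t = c *s rep_ac u t"
proof -
  obtain y f where y: "solution y f" "square_integrable y" "u = l2_class y" using D_maxE[OF assms(1)] by metis
  show ?thesis
    using rep_ac_class[OF solution_AC[OF y(1)] y(2) assms(2)]
      rep_ac_class[OF AC_loc_linear[OF bounded_linear_vec_scale solution_AC[OF y(1)]]
        square_integrable_bounded_linear[OF bounded_linear_vec_scale y(2)] assms(2), of c]
    by (simp add: y l2_class_cscale)
qed

lemma rep_ac_D_max_diff:
  assumes "(u, v) \<in> D_max Q" "(u', v') \<in> D_max Q" "0 \<le> t"
  shows "rep_ac (u - u') t = rep_ac u t - rep_ac u' t"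
  using rep_ac_D_max_add[OF D_max_diff[OF assms(1,2)] assms(2,3)] by simp

lemma lagrange_D_max:
  assumes "(u, v) \<in> D_max Q" "(u', v') \<in> D_max Q"
  shows "bil v u' - bil u v' = - symp (rep_ac u 0) (rep_ac u' 0)"
proof -
  obtain y f where y: "solution y f" "square_integrable y" "square_integrable f" "u = l2_class y" "v = l2_class f"
    using D_maxE[OF assms(1)] by metis
  obtain w h where w: "solution w h" "square_integrable w" "square_integrable h" "u' = l2_class w" "v' = l2_class h"
    using D_maxE[OF assms(2)] by metis
  show ?thesis
    using lagrange_halfline[OF y(1) w(1) y(2,3) w(2,3)]
    by (simp add: y w rep_ac_class[OF solution_AC[OF y(1)] y(2)] rep_ac_class[OF solution_AC[OF w(1)] w(2)])
qed

text \<open>The absolutely continuous representative of the zero class vanishes identically, and so does its image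
  under the differential expression.\<close>

lemma D_max_single_valued: "single_valued (D_max Q)"
proof (rule single_valuedI)
  have zero: "v = 0" if uv: "(0, v) \<in> D_max Q" for v
  proof -
    obtain y f where y: "solution y f" "square_integrable y" "square_integrable f" "0 = l2_class y" "v = l2_class f"
      using D_maxE[OF uv] by metis
    have z0: "AC_loc (\<lambda>t. 0 :: complex^('p + 'p))" by (rule AC_loc_const)
    have y0: "y t = 0" if "0 \<le> t" for t
      using rep_ac_class[OF solution_AC[OF y(1)] y(2) that] rep_ac_class[OF z0 square_integrable_0 that]
      unfolding y(4)[symmetric] l2_class_0 by simp
    have "AE t in halfline. (y has_vector_derivative J_mat *v (Q t *v y t - f t)) (at t)"
      using y(1) unfolding solution_def by (rule conjunct2)
    then have "AE t in halfline. f t = 0"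
      unfolding AE_halfline_iff
    proof eventually_elim
      case (elim t)
      show ?case
      proof
        assume t: "0 < t"
        have "((\<lambda>t. 0) has_vector_derivative 0) (at t)" by (rule has_vector_derivative_const)
        then have "(y has_vector_derivative 0) (at t)"
          by (rule has_vector_derivative_transform_within_open[of _ _ _ "{0<..}"]) (use t y0 in auto)
        with elim t have "J_mat *v (Q t *v y t - f t) = 0" by (blast intro: vector_derivative_unique_at)
        then have "J_mat *v (J_mat *v (- f t)) = J_mat *v 0"
          using y0[of t] t by (simp add: bounded_bilinear.zero_right[OF matrix_vector_bounded_bilinear])
        then show "f t = 0" unfolding J_J by (simp add: bounded_bilinear.zero_right[OF matrix_vector_bounded_bilinear])
      qed
    qed
    then have "l2_class f = l2_class (\<lambda>t. 0)" by (rule l2_class_cong_AE[OF y(3)])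
    then show ?thesis by (simp add: y l2_class_0)
  qed
  fix u v v' assume "(u, v) \<in> D_max Q" "(u, v') \<in> D_max Q"
  from zero[of "v - v'"] D_max_diff[OF this] show "v = v'" by simp
qed

text \<open>\<open>(cut_u c, cut_v c)\<close> is an element of the maximal operator that has initial value \<open>c\<close> and is supported in
  \<open>{0..1}\<close>. Through the Lagrange identity these elements make initial values accessible to the pairing.\<close>

definition cut_u :: "complex^('p + 'p) \<Rightarrow> (complex^('p + 'p)) l2" where
  "cut_u c = l2_class (\<lambda>t. (1 - ramp 1 t) *\<^sub>R (fund t *v c))"

definition cut_v :: "complex^('p + 'p) \<Rightarrow> (complex^('p + 'p)) l2" where
  "cut_v c = l2_class (\<lambda>t. (- (if t < 1 then 1 else 0)) *\<^sub>R (J_mat *v (fund t *v c)))"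

lemma cut_solution:
  shows "solution (\<lambda>t. (1 - ramp 1 t) *\<^sub>R (fund t *v c)) (\<lambda>t. (- (if t < 1 then 1 else 0)) *\<^sub>R (J_mat *v (fund t *v c)))" (is ?S)
    and "square_integrable (\<lambda>t. (1 - ramp 1 t) *\<^sub>R (fund t *v c))" (is ?U)
    and "square_integrable (\<lambda>t. (- (if t < 1 then 1 else 0)) *\<^sub>R (J_mat *v (fund t *v c)))" (is ?V)
proof -
  have AC: "AC_loc (\<lambda>t. 1 - ramp 1 t)"
    using AC_loc_add[OF AC_loc_const[of 1] AC_loc_linear[OF bounded_linear_minus[OF bounded_linear_ident] AC_loc_ramp[of 1]]]
    by simp
  have D: "AE t in halfline. ((\<lambda>t. 1 - ramp 1 t) has_vector_derivative (- (if t < 1 then 1 else 0))) (at t)"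
    using ramp_derivative_AE[of 1]
  proof eventually_elim
    case (elim t)
    from has_vector_derivative_diff[OF has_vector_derivative_const elim, of 1] show ?case by simp
  qed
  have b: "\<bar>1 - ramp 1 t\<bar> \<le> 1" for t using ramp_bounds[of 1 t] by simp
  have b': "\<bar>- (if t < 1 then 1 else 0 :: real)\<bar> \<le> 1" for t :: real by simp
  have z: "1 - ramp 1 t = 0" "- (if t < 1 then 1 else 0 :: real) = 0" if "t > 1" for t :: real
    using that by (auto simp: ramp_def)
  have m: "(\<lambda>t. 1 - ramp 1 t) \<in> borel_measurable borel" "(\<lambda>t::real. - (if t < 1 then 1 else 0 :: real)) \<in> borel_measurable borel"
    by measurable
  from cutoff_solution[OF AC D m b b' z] show ?S ?U ?V by blast+
qed

lemma cut_D_max: "(cut_u c, cut_v c) \<in> D_max Q"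
  unfolding cut_u_def cut_v_def by (rule D_maxI[OF cut_solution])

lemma rep_ac_cut: "rep_ac (cut_u c) 0 = c"
  unfolding cut_u_def using rep_ac_class[OF solution_AC[OF cut_solution(1)] cut_solution(2), of 0 c]
  by (simp add: ramp_def fund_0)

lemma cut_add: "cut_u (c + d) = cut_u c + cut_u d" "cut_v (c + d) = cut_v c + cut_v d"
  unfolding cut_u_def cut_v_def
  by (simp_all only: l2_class_add cut_solution(2,3) bounded_bilinear.add_right[OF matrix_vector_bounded_bilinear] scaleR_add_right)

lemma cut_scale: "cut_u (a *s c) = cscale a (cut_u c)" "cut_v (a *s c) = cscale a (cut_v c)"
proof -
  have *: "a *s (r *\<^sub>R v) = r *\<^sub>R (a *s v)" for r and v :: "complex^('p + 'p)" by (simp add: vec_eq_iff)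
  show "cut_u (a *s c) = cscale a (cut_u c)" "cut_v (a *s c) = cscale a (cut_v c)"
    unfolding cut_u_def cut_v_def by (simp_all only: l2_class_cscale cut_solution(2,3) mat_vec_scale *)
qed

lemma cut_bounded_linear: "bounded_linear cut_u" "bounded_linear cut_v"
  unfolding linear_conv_bounded_linear[symmetric]
  by (auto intro!: linearI simp: cut_add cscale_of_real[symmetric] cut_scale[symmetric] vec_of_real_scale)

lemma D_min0_add:
  assumes "(u, v) \<in> D_min0" "(u', v') \<in> D_min0"
  shows "(u + u', v + v') \<in> D_min0"
proof -
  obtain y b where y: "y \<in> max_domain Q" "u = l2_class y" "v = l2_class (diff_expr Q y)" "\<And>t. t > b \<Longrightarrow> y t = 0" "y 0 = 0"
    using assms(1) unfolding D_min0_def by blast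
  obtain w b' where w: "w \<in> max_domain Q" "u' = l2_class w" "v' = l2_class (diff_expr Q w)" "\<And>t. t > b' \<Longrightarrow> w t = 0" "w 0 = 0"
    using assms(2) unfolding D_min0_def by blast
  have s: "solution y (diff_expr Q y)" "solution w (diff_expr Q w)"
    using y(1) w(1) unfolding max_domain_def solution_iff by auto
  have sq: "square_integrable y" "square_integrable (diff_expr Q y)" "square_integrable w" "square_integrable (diff_expr Q w)"
    using y(1) w(1) unfolding max_domain_def by auto
  have "(l2_class (\<lambda>t. y t + w t), l2_class (\<lambda>t. diff_expr Q y t + diff_expr Q w t)) \<in> D_min0"
    by (rule D_min0I[OF solution_add[OF s], where b="max b b'"]) (use sq y w in \<open>auto intro: square_integrable_add\<close>)
  then show ?thesis by (simp add: y w l2_class_add sq)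
qed

lemma D_min0_scale:
  assumes "(u, v) \<in> D_min0"
  shows "(cscale c u, cscale c v) \<in> D_min0"
proof -
  obtain y b where y: "y \<in> max_domain Q" "u = l2_class y" "v = l2_class (diff_expr Q y)" "\<And>t. t > b \<Longrightarrow> y t = 0" "y 0 = 0"
    using assms(1) unfolding D_min0_def by blast
  have s: "solution y (diff_expr Q y)" using y(1) unfolding max_domain_def solution_iff by auto
  have sq: "square_integrable y" "square_integrable (diff_expr Q y)"
    using y(1) unfolding max_domain_def by auto
  have "(l2_class (\<lambda>t. c *s y t), l2_class (\<lambda>t. c *s diff_expr Q y t)) \<in> D_min0"
    by (rule D_min0I[OF solution_scale[OF s], where b=b])
      (use sq y in \<open>auto intro: square_integrable_bounded_linear[OF bounded_linear_vec_scale]\<close>)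
  then show ?thesis by (simp add: y l2_class_cscale sq)
qed

lemma D_min0_0: "(0, 0) \<in> D_min0"
  using D_min0I[of "\<lambda>t. 0" "\<lambda>t. 0" 0] fund_solution[of 0]
  by (simp add: l2_class_0 square_integrable_0 bounded_bilinear.zero_right[OF matrix_vector_bounded_bilinear])

lemma D_min_scale:
  assumes "(u, v) \<in> D_min Q"
  shows "(cscale c u, cscale c v) \<in> D_min Q"
proof -
  let ?m = "\<lambda>p. (cscale c (fst p), cscale c (snd p))"
  have "?m ` closure D_min0 \<subseteq> closure D_min0"
  proof (rule image_closure_subset)
    show "continuous_on (closure D_min0) ?m"
      by (intro continuous_intros bounded_bilinear.continuous_on[OF cscale_bounded_bilinear])
    have "?m ` D_min0 \<subseteq> D_min0" using D_min0_scale by auto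
    then show "?m ` D_min0 \<subseteq> closure D_min0" using closure_subset by blast
  qed simp
  then show ?thesis using assms unfolding D_min_closure by force
qed

lemma subspace_D_min: "subspace (D_min Q)"
  unfolding D_min_closure
proof (rule subspace_closure)
  show "subspace D_min0"
    unfolding subspace_def
    by (auto simp: zero_prod_def D_min0_0 D_min0_add scaleR_prod_def cscale_of_real[symmetric] D_min0_scale)
qed

lemma D_min_subset_D_max: "D_min Q \<subseteq> D_max Q"
  unfolding D_min_closure
  by (rule closure_minimal[OF D_min0_subset]) (simp add: transpose_D_min0[symmetric] closed_transpose_op)

lemma transpose_D_min: "transpose_op (D_min Q) = D_max Q"
  unfolding D_min_closure transpose_op_closure by (rule transpose_D_min0)

text \<open>The pairing of an element of the minimal operator with the maximal operator has no boundary term, by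
  continuity even after taking closures; testing with cutoff solutions gives the claim.\<close>

lemma rep_ac_D_min:
  assumes "(u, v) \<in> D_min Q"
  shows "rep_ac u 0 = 0"
proof (rule symp_nondegenerate)
  fix c
  have "D_min0 \<subseteq> transpose_op (D_max Q)"
  proof clarify
    fix u v assume uv: "(u, v) \<in> D_min0"
    have "bil g u = bil f v" if "(f, g) \<in> D_max Q" for f g
    proof -
      have "bil v f = bil u g" using that uv unfolding transpose_D_min0[symmetric] transpose_op_iff by blast
      then show ?thesis using bil_sym[of v f] bil_sym[of u g] by simp
    qed
    then show "(u, v) \<in> transpose_op (D_max Q)" unfolding transpose_op_iff by blast
  qed
  then have "D_min Q \<subseteq> transpose_op (D_max Q)"
    unfolding D_min_closure by (rule closure_minimal[OF _ closed_transpose_op])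
  then have "bil (cut_v c) u = bil (cut_u c) v"
    using assms cut_D_max[of c] transpose_op_iff by blast
  then show "symp (rep_ac u 0) c = 0"
    using lagrange_D_max[OF cut_D_max[of c], of u v] assms D_min_subset_D_max symp_antisym[of c "rep_ac u 0"]
    by (auto simp: rep_ac_cut)
qed

text \<open>The range of \<open>D_min - z\<close> is closed, so it contains everything that is annihilated by its
  annihilator \<open>ker (D_max - z)\<close>.\<close>

lemma range_D_min:
  assumes z: "z \<in> rho_hat (D_min Q)"
    and g: "\<And>\<phi>. (\<phi>, cscale z \<phi>) \<in> D_max Q \<Longrightarrow> bil g \<phi> = 0"
  obtains u v where "(u, v) \<in> D_min Q" "g = v - cscale z u"
proof -
  obtain \<epsilon> where \<epsilon>: "\<epsilon> > 0" "\<And>u v. (u, v) \<in> D_min Q \<Longrightarrow> \<epsilon> * norm u \<le> norm (v - cscale z u)"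
    using z unfolding rho_hat_def by fastforce
  define R where "R = (\<lambda>p. snd p - cscale z (fst p)) ` D_min Q"
  have lin: "bounded_linear (\<lambda>p. snd p - cscale z (fst p))"
    by (intro bounded_linear_sub bounded_linear_snd
        bounded_linear_compose[OF bounded_bilinear.bounded_linear_right[OF cscale_bounded_bilinear] bounded_linear_fst])
  have sub: "subspace R"
    unfolding R_def by (rule linear_subspace_image[OF bounded_linear.linear[OF lin] subspace_D_min])
  have scale: "cscale c w \<in> R" if "w \<in> R" for c w
  proof -
    obtain u v where "(u, v) \<in> D_min Q" "w = v - cscale z u" using \<open>w \<in> R\<close> unfolding R_def by auto
    then show ?thesis unfolding R_def
      by (intro image_eqI[of _ _ "(cscale c u, cscale c v)"] D_min_scale)
        (auto simp: l2.scale_right_diff_distrib mult.commute)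
  qed
  have comp: "complete R"
    unfolding complete_def
  proof (intro allI impI)
    fix w assume w: "(\<forall>n. w n \<in> R) \<and> Cauchy w"
    have "\<forall>n. \<exists>p. p \<in> D_min Q \<and> w n = snd p - cscale z (fst p)"
    proof
      fix n
      have "w n \<in> R" using w by blast
      then show "\<exists>p. p \<in> D_min Q \<and> w n = snd p - cscale z (fst p)" unfolding R_def by (rule imageE) blast
    qed
    then obtain p where p: "\<And>n. p n \<in> D_min Q" "\<And>n. w n = snd (p n) - cscale z (fst (p n))" by metis
    have le: "\<epsilon> * norm (fst (p m) - fst (p n)) \<le> norm (w m - w n)" for m n
    proof -
      have "p m - p n \<in> D_min Q" by (intro subspace_diff subspace_D_min p)
      then have "(fst (p m - p n), snd (p m - p n)) \<in> D_min Q" unfolding prod.collapse .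
      then have "\<epsilon> * norm (fst (p m - p n)) \<le> norm (snd (p m - p n) - cscale z (fst (p m - p n)))"
        by (rule \<epsilon>(2))
      then show ?thesis unfolding p(2) by (simp add: l2.scale_right_diff_distrib algebra_simps)
    qed
    have "Cauchy (\<lambda>n. fst (p n))"
    proof (rule metric_CauchyI)
      fix e :: real assume e: "0 < e"
      then obtain M where M: "\<And>m n. m \<ge> M \<Longrightarrow> n \<ge> M \<Longrightarrow> dist (w m) (w n) < \<epsilon> * e"
        using w \<epsilon>(1) unfolding Cauchy_def by (meson mult_pos_pos)
      have "dist (fst (p m)) (fst (p n)) < e" if "m \<ge> M" "n \<ge> M" for m n
      proof -
        have "\<epsilon> * norm (fst (p m) - fst (p n)) < \<epsilon> * e"
          using le[of m n] M[OF that] by (simp add: dist_norm)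
        then show ?thesis using \<epsilon>(1) by (simp add: dist_norm)
      qed
      then show "\<exists>M. \<forall>m\<ge>M. \<forall>n\<ge>M. dist (fst (p m)) (fst (p n)) < e" by blast
    qed
    then obtain u where u: "(\<lambda>n. fst (p n)) \<longlonglongrightarrow> u" using Cauchy_convergent_iff convergent_def by blast
    obtain l where l: "w \<longlonglongrightarrow> l" using w Cauchy_convergent_iff convergent_def by blast
    have cu: "(\<lambda>n. cscale z (fst (p n))) \<longlonglongrightarrow> cscale z u"
      by (intro bounded_bilinear.tendsto[OF cscale_bounded_bilinear] tendsto_const u)
    have "(\<lambda>n. w n + cscale z (fst (p n))) \<longlonglongrightarrow> l + cscale z u" by (intro tendsto_add l cu)
    then have "(\<lambda>n. snd (p n)) \<longlonglongrightarrow> l + cscale z u" by (simp add: p(2))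
    then have "(\<lambda>n. (fst (p n), snd (p n))) \<longlonglongrightarrow> (u, l + cscale z u)" by (intro tendsto_Pair u)
    then have "(u, l + cscale z u) \<in> D_min Q"
      using closed_sequentially[of "D_min Q" p] p(1) unfolding D_min_closure by simp
    then have "l \<in> R" unfolding R_def by (intro image_eqI[of _ _ "(u, l + cscale z u)"]) auto
    then show "\<exists>l\<in>R. w \<longlonglongrightarrow> l" using l by blast
  qed
  obtain m where m: "m \<in> R" "\<And>w. w \<in> R \<Longrightarrow> (g - m) \<bullet> w = 0"
    using orthogonal_projection_exists[OF sub comp] by blast
  define \<psi> where "\<psi> = swap_conj (g - m)"
  have perp: "bil w \<psi> = 0" if "w \<in> R" for w
  proof -
    have "Re (bil w \<psi>) = 0" if "w \<in> R" for w
      using m(2)[OF that] inner_eq_Re_cinner[of w "g - m"]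
      by (simp add: \<psi>_def bil_def swap_conj_swap_conj inner_commute)
    from this[OF \<open>w \<in> R\<close>] this[OF scale[OF \<open>w \<in> R\<close>, of \<i>]] show ?thesis
      by (simp add: bil_scale_left complex_eq_iff)
  qed
  have "(\<psi>, cscale z \<psi>) \<in> D_max Q"
    unfolding transpose_D_min[symmetric] transpose_op_def
  proof clarify
    fix u v assume "(u, v) \<in> D_min Q"
    then have "v - cscale z u \<in> R" unfolding R_def by force
    from perp[OF this] show "bil v \<psi> = bil u (cscale z \<psi>)"
      by (simp add: bil_diff_left bil_scale_left bil_scale_right)
  qed
  then have "bil (g - m) \<psi> = 0" using g perp[OF m(1)] by (simp add: bil_diff_left)
  then have "(g - m) \<bullet> (g - m) = 0"
    by (simp add: inner_eq_Re_cinner bil_def \<psi>_def swap_conj_swap_conj)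
  then have "g = m" by simp
  then show ?thesis using m(1) that unfolding R_def by auto
qed

text \<open>With this, uniqueness for the eigenvalue equation is uniqueness for the homogeneous equation of the
  shifted potential.\<close>

lemma dirac_shift: "dirac (\<lambda>t. Q t - mat z)"
proof
  show "locally_integrable (\<lambda>t. Q t - mat z)"
    unfolding locally_integrable_def
  proof (intro allI impI)
    fix b :: real assume "0 \<le> b"
    then have "Q absolutely_integrable_on {0..b}" using Q_loc unfolding locally_integrable_def by simp
    moreover have "(\<lambda>t. mat z :: complex^('p + 'p)^('p + 'p)) absolutely_integrable_on {0..b}"
      by (simp add: absolutely_integrable_on_const)
    ultimately show "(\<lambda>t. Q t - mat z) absolutely_integrable_on {0..b}" by (rule set_integral_diff(1))
  qed
  show "AE t in halfline. \<forall>u v. sdot ((Q t - mat z) *v u) v = sdot u ((Q t - mat z) *v v)"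
    using Q_sym by eventually_elim
      (simp add: bounded_bilinear.diff_left[OF matrix_vector_bounded_bilinear] mat_vec sdot_linear sdot_scale_left sdot_scale_right)
qed

lemma eigen_unique:
  assumes y: "solution y (\<lambda>t. z *s y t)" "y 0 = 0" and t: "0 \<le> t"
  shows "y t = 0"
proof -
  interpret shifted: dirac "\<lambda>t. Q t - mat z" by (rule dirac_shift)
  have "shifted.solution y (\<lambda>t. 0)"
    using y(1) unfolding solution_def shifted.solution_def
    by (simp add: bounded_bilinear.diff_left[OF matrix_vector_bounded_bilinear] mat_vec)
  then show ?thesis using y(2) t by (rule shifted.homogeneous_unique)
qed

definition eig :: "complex \<Rightarrow> (complex^('p + 'p)) l2 set" where
  "eig z = {\<phi>. (\<phi>, cscale z \<phi>) \<in> D_max Q}"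

lemma eigE:
  assumes "\<phi> \<in> eig z"
  obtains y where "solution y (\<lambda>t. z *s y t)" "square_integrable y" "\<phi> = l2_class y"
proof -
  obtain y f where y: "solution y f" "square_integrable y" "square_integrable f" "\<phi> = l2_class y" "cscale z \<phi> = l2_class f"
    using D_maxE assms unfolding eig_def by blast
  have "l2_class (\<lambda>t. z *s y t) = l2_class f" using y by (simp add: l2_class_cscale)
  then have "AE t in halfline. f t = z *s y t"
    using l2_class_eq_iff[OF square_integrable_bounded_linear[OF bounded_linear_vec_scale y(2)] y(3)]
    by (auto elim: AE_mp)
  then have "solution y (\<lambda>t. z *s y t)" using y(1) unfolding solution_iff by (auto elim: AE_mp)
  then show ?thesis using that y by blast
qed

lemma eig_zero:
  assumes "\<phi> \<in> eig z" "rep_ac \<phi> 0 = 0"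
  shows "\<phi> = 0"
proof -
  obtain y where y: "solution y (\<lambda>t. z *s y t)" "square_integrable y" "\<phi> = l2_class y" using eigE[OF assms(1)] .
  have "y 0 = 0" using assms(2) rep_ac_class[OF solution_AC[OF y(1)] y(2), of 0] y(3) by simp
  then have "AE t in halfline. y t = 0" using eigen_unique[OF y(1)] by (intro AE_I2) simp
  then have "l2_class y = l2_class (\<lambda>t. 0)" by (rule l2_class_cong_AE[OF y(2)])
  then show ?thesis using y(3) l2_class_0 by simp
qed

lemma eig_add: "\<phi> \<in> eig z \<Longrightarrow> \<psi> \<in> eig z \<Longrightarrow> \<phi> + \<psi> \<in> eig z"
  using D_max_add[of \<phi> "cscale z \<phi>" \<psi> "cscale z \<psi>"] by (simp add: eig_def l2.scale_right_distrib)

lemma eig_scale: "\<phi> \<in> eig z \<Longrightarrow> cscale c \<phi> \<in> eig z"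
  unfolding eig_def using D_max_scale[of \<phi> "cscale z \<phi>" c] by (simp add: mult.commute)

lemma eig_0: "0 \<in> eig z"
  unfolding eig_def using D_max_0 by simp

text \<open>The space of initial values of the square integrable solutions for \<open>z\<close>.\<close>

definition bdry :: "complex \<Rightarrow> (complex^('p + 'p)) set" where
  "bdry z = (\<lambda>\<phi>. rep_ac \<phi> 0) ` eig z"

lemma subspace_bdry: "vec.subspace (bdry z)"
proof (rule vec.subspaceI)
  have "(0, 0) \<in> D_max Q" by (rule D_max_0)
  from rep_ac_D_max_scale[OF this, of 0 0] show "0 \<in> bdry z"
    unfolding bdry_def using eig_0 by (intro image_eqI[of _ _ 0]) auto
  fix x y assume "x \<in> bdry z" "y \<in> bdry z"
  then obtain \<phi> \<psi> where *: "\<phi> \<in> eig z" "\<psi> \<in> eig z" "x = rep_ac \<phi> 0" "y = rep_ac \<psi> 0" unfolding bdry_def by auto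
  then show "x + y \<in> bdry z"
    unfolding bdry_def using rep_ac_D_max_add[of \<phi> "cscale z \<phi>" \<psi> "cscale z \<psi>" 0]
    by (intro image_eqI[of _ _ "\<phi> + \<psi>"] eig_add) (auto simp: eig_def)
  fix c
  show "c *s x \<in> bdry z"
    unfolding bdry_def using rep_ac_D_max_scale[of \<phi> "cscale z \<phi>" 0 c] *
    by (intro image_eqI[of _ _ "cscale c \<phi>"] eig_scale) (auto simp: eig_def)
qed

text \<open>The initial values of the square integrable solutions form a Lagrangian subspace: isotropy holds
  since the boundary form vanishes at infinity, maximality since the range is closed.\<close>

lemma bdry_lagrangian:
  assumes z: "z \<in> rho_hat (D_min Q)"
  shows "c \<in> bdry z \<longleftrightarrow> (\<forall>n\<in>bdry z. symp c n = 0)"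
proof
  assume "c \<in> bdry z"
  then obtain \<phi> where \<phi>: "\<phi> \<in> eig z" "c = rep_ac \<phi> 0" unfolding bdry_def by auto
  show "\<forall>n\<in>bdry z. symp c n = 0"
  proof
    fix n assume "n \<in> bdry z"
    then obtain \<psi> where \<psi>: "\<psi> \<in> eig z" "n = rep_ac \<psi> 0" unfolding bdry_def by auto
    show "symp c n = 0"
      using lagrange_D_max[of \<phi> "cscale z \<phi>" \<psi> "cscale z \<psi>"] \<phi> \<psi>
      by (simp add: eig_def bil_scale_left bil_scale_right)
  qed
next
  assume c: "\<forall>n\<in>bdry z. symp c n = 0"
  define g where "g = cut_v c - cscale z (cut_u c)"
  have "bil g \<phi> = 0" if "(\<phi>, cscale z \<phi>) \<in> D_max Q" for \<phi>
  proof -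
    have "bil g \<phi> = bil (cut_v c) \<phi> - bil (cut_u c) (cscale z \<phi>)"
      by (simp add: g_def bil_diff_left bil_scale_left bil_scale_right)
    also have "\<dots> = - symp c (rep_ac \<phi> 0)" using lagrange_D_max[OF cut_D_max that] by (simp add: rep_ac_cut)
    also have "\<dots> = 0" using c that unfolding bdry_def eig_def by auto
    finally show ?thesis .
  qed
  then obtain u v where uv: "(u, v) \<in> D_min Q" "g = v - cscale z u" using range_D_min[OF z] by blast
  have uv': "(u, v) \<in> D_max Q" using uv(1) D_min_subset_D_max by blast
  have "cut_v c - v = cscale z (cut_u c - u)"
    using uv(2) unfolding g_def by (simp add: l2.scale_right_diff_distrib algebra_simps)
  then have "cut_u c - u \<in> eig z" unfolding eig_def using D_max_diff[OF cut_D_max uv', of c] by simp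
  moreover have "rep_ac (cut_u c - u) 0 = c"
    using rep_ac_D_max_diff[OF cut_D_max uv', of 0 c] rep_ac_D_min[OF uv(1)] by (simp add: rep_ac_cut)
  ultimately show "c \<in> bdry z" unfolding bdry_def by (metis imageI)
qed

end

section \<open>Lagrangian subspaces\<close>

text \<open>\<open>skewc\<close> is an antilinear complex structure that is compatible with the symplectic form, that is,
  \<open>symp u (skewc v)\<close> is the Hermitian product of \<open>u\<close> and \<open>v\<close>.\<close>

definition herm :: "complex^('p::finite + 'p) \<Rightarrow> complex^('p + 'p) \<Rightarrow> complex" where
  "herm u v = (\<Sum>k\<in>UNIV. u $ k * cnj (v $ k))"

definition skewc :: "complex^('p::finite + 'p) \<Rightarrow> complex^('p + 'p)" where
  "skewc v = (\<chi> k. case k of Inl a \<Rightarrow> \<i> * cnj (v $ Inr a) | Inr a \<Rightarrow> - \<i> * cnj (v $ Inl a))"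

lemma skewc_nth: "skewc v $ Inl a = \<i> * cnj (v $ Inr a)" "skewc v $ Inr a = - \<i> * cnj (v $ Inl a)"
  by (simp_all add: skewc_def)

lemma symp_skewc: "symp u (skewc v) = herm u v"
  unfolding symp_expand herm_def sum_UNIV_Plus skewc_nth
  by (simp add: sum_distrib_left sum.distrib[symmetric] algebra_simps)

lemma skewc_skewc: "skewc (skewc v) = - v"
  by (simp add: vec_Plus_eq_iff skewc_nth)

lemma skewc_add: "skewc (u + v) = skewc u + skewc v"
  by (simp add: vec_Plus_eq_iff skewc_nth algebra_simps)

lemma skewc_scale: "skewc (c *s v) = cnj c *s skewc v"
  by (simp add: vec_Plus_eq_iff skewc_nth)

lemma skewc_0: "skewc 0 = 0"
  by (simp add: vec_Plus_eq_iff skewc_nth)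

lemma skewc_sum: "skewc (\<Sum>k\<in>A. f k) = (\<Sum>k\<in>A. skewc (f k))"
  by (induction A rule: infinite_finite_induct) (auto simp: skewc_0 skewc_add)

lemma symp_skewc_skewc: "symp (skewc u) (skewc v) = cnj (symp u v)"
  unfolding symp_expand skewc_nth by (simp add: sum_subtractf algebra_simps)

lemma inner_eq_Re_herm: "u \<bullet> v = Re (herm u v)"
  by (simp add: inner_vec_def inner_complex_def herm_def)

lemma herm_self_eq_0: "herm v v = 0 \<Longrightarrow> v = 0"
  using inner_eq_Re_herm[of v v] by simp

lemma herm_scale_left: "herm (c *s u) v = c * herm u v"
  by (simp add: herm_def sum_distrib_left mult_ac)

lemma matrix_vector_columns: "(\<chi> i k. f k $ i) *v x = (\<Sum>k\<in>UNIV. x $ k *s (f k :: complex^'m))"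
  by (simp add: vec_eq_iff matrix_vector_mult_def mult.commute)

lemma symp_sum_left: "symp (\<Sum>k\<in>A. f k) v = (\<Sum>k\<in>A. symp (f k) v)"
  by (rule bounded_bilinear.sum_left[OF symp_bounded_bilinear])

lemma symp_sum_right: "symp v (\<Sum>k\<in>A. f k) = (\<Sum>k\<in>A. symp v (f k))"
  by (rule bounded_bilinear.sum_right[OF symp_bounded_bilinear])

lemma vec_subspace_imp_subspace:
  assumes "vec.subspace (N :: (complex^'n) set)"
  shows "subspace N"
  unfolding subspace_def
proof (intro conjI ballI allI)
  show "0 \<in> N" by (rule vec.subspace_0[OF assms])
  show "x + y \<in> N" if "x \<in> N" "y \<in> N" for x y by (rule vec.subspace_add[OF assms that])
  show "c *\<^sub>R x \<in> N" if "x \<in> N" for c x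
    using vec.subspace_scale[OF assms that, of "of_real c"]
    unfolding vec_eq_iff by (simp add: vec_of_real_scale)
qed

text \<open>A Lagrangian subspace \<open>N\<close> and its image under \<open>skewc\<close>, which is its Hermitian complement, are in
  direct sum and have the same dimension; this gives a symplectic frame \<open>(\<Phi>, W)\<close> adapted to \<open>N\<close>.\<close>

lemma lagrangian_frame:
  fixes N :: "(complex^('p::finite + 'p)) set"
  assumes sub: "vec.subspace N" and lag: "\<And>c. c \<in> N \<longleftrightarrow> (\<forall>n\<in>N. symp c n = 0)"
  obtains \<Phi> W :: "complex^'p^('p + 'p)"
  where "N = range ((*v) \<Phi>)" "\<And>x y. symp (W *v x) (W *v y) = 0"
    "\<And>x y. symp (W *v x) (\<Phi> *v y) = (\<Sum>k\<in>UNIV. x $ k * y $ k)"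
    "\<And>v. \<exists>a b. v = \<Phi> *v a + W *v b"
proof -
  define L where "L = skewc ` N"
  have N_L: "N \<inter> L = {0}"
  proof -
    have "x = 0" if x: "x \<in> N" "x \<in> L" for x
    proof -
      obtain n where n: "n \<in> N" "x = skewc n" using x(2) unfolding L_def by auto
      then have "symp x n = 0" using lag x(1) by blast
      then have "herm n n = 0" using n(2) symp_skewc[of n n] symp_antisym[of x n] by simp
      then show ?thesis using herm_self_eq_0[of n] n(2) skewc_0 by simp
    qed
    moreover have "0 \<in> N" by (rule vec.subspace_0[OF sub])
    moreover have "0 \<in> L" unfolding L_def using \<open>0 \<in> N\<close> skewc_0 by (metis imageI)
    ultimately show ?thesis by blast
  qed
  have decomp: "\<exists>n l. n \<in> N \<and> l \<in> L \<and> v = n + l" for v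
  proof -
    have "span N = N" using vec_subspace_imp_subspace[OF sub] by (simp add: span_eq_iff)
    then obtain y z where yz: "y \<in> N" "\<And>w. w \<in> N \<Longrightarrow> orthogonal z w" "v = y + z"
      using orthogonal_subspace_decomp_exists[of N v] by metis
    have "herm w z = 0" if w: "w \<in> N" for w
    proof -
      have "Re (herm w z) = 0" if "w \<in> N" for w
        using yz(2)[OF that] inner_eq_Re_herm[of w z] by (simp add: orthogonal_def inner_commute)
      from this[OF w] this[OF vec.subspace_scale[OF sub w, of \<i>]] show ?thesis
        by (simp add: herm_scale_left complex_eq_iff)
    qed
    then have "symp (skewc z) w = 0" if "w \<in> N" for w
      using that symp_skewc[of w z] symp_antisym[of w "skewc z"] by simp
    then have "skewc z \<in> N" using lag by blast
    then have "(-1) *s skewc z \<in> N" by (rule vec.subspace_scale[OF sub])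
    moreover have "skewc ((-1) *s skewc z) = z" unfolding skewc_scale skewc_skewc by simp
    ultimately have "z \<in> L" unfolding L_def by (metis imageI)
    with yz show ?thesis by blast
  qed
  have subL: "vec.subspace L"
  proof (rule vec.subspaceI)
    show "0 \<in> L" using N_L by blast
    show "x + y \<in> L" if "x \<in> L" "y \<in> L" for x y
      using that vec.subspace_add[OF sub] unfolding L_def by (auto simp: skewc_add[symmetric])
    show "c *s x \<in> L" if "x \<in> L" for c x
    proof -
      obtain n where "n \<in> N" "x = skewc n" using \<open>x \<in> L\<close> unfolding L_def by auto
      then have "c *s x = skewc (cnj c *s n)" "cnj c *s n \<in> N"
        using vec.subspace_scale[OF sub] by (simp_all add: skewc_scale)
      then show ?thesis unfolding L_def by blast
    qed
  qed
  have dim_le: "vec.dim (skewc ` S) \<le> vec.dim S" for S :: "(complex^('p + 'p)) set"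
  proof -
    obtain B where B: "B \<subseteq> S" "vec.independent B" "S \<subseteq> vec.span B" "card B = vec.dim S"
      using vec.basis_exists[of S] by blast
    have fin: "finite B" by (rule vec.finiteI_independent[OF B(2)])
    have "vec.subspace {x. skewc x \<in> vec.span (skewc ` B)}"
      by (rule vec.subspaceI) (auto simp: skewc_0 skewc_add skewc_scale vec.span_zero vec.span_add vec.span_scale)
    moreover have "B \<subseteq> {x. skewc x \<in> vec.span (skewc ` B)}" by (auto intro: vec.span_base)
    ultimately have "vec.span B \<subseteq> {x. skewc x \<in> vec.span (skewc ` B)}" by (metis vec.span_minimal)
    then have "skewc ` S \<subseteq> vec.span (skewc ` B)" using B(3) by blast
    then have "vec.dim (skewc ` S) \<le> card (skewc ` B)" using fin by (intro vec.dim_le_card) auto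
    also have "\<dots> \<le> card B" by (rule card_image_le[OF fin])
    finally show ?thesis using B(4) by simp
  qed
  have "skewc ` L = N"
  proof
    show "skewc ` L \<subseteq> N"
      using vec.subspace_neg[OF sub] unfolding L_def by (auto simp: skewc_skewc)
    show "N \<subseteq> skewc ` L"
    proof
      fix n assume n: "n \<in> N"
      then have "- n \<in> N" by (rule vec.subspace_neg[OF sub])
      then have "skewc (skewc (- n)) \<in> skewc ` L" unfolding L_def by blast
      then show "n \<in> skewc ` L" by (simp add: skewc_skewc)
    qed
  qed
  then have dimL: "vec.dim L = vec.dim N" using dim_le[of N] dim_le[of L] unfolding L_def[symmetric] by simp
  have "{x + y |x y. x \<in> N \<and> y \<in> L} = UNIV" using decomp by blast
  then have "vec.dim (UNIV :: (complex^('p + 'p)) set) + vec.dim ({0} :: (complex^('p + 'p)) set) = vec.dim N + vec.dim L"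
    using vec.dim_sums_Int[OF sub subL] N_L by simp
  moreover have "vec.dim ({0} :: (complex^('p + 'p)) set) = 0" by simp
  moreover have "vec.dim (UNIV :: (complex^('p + 'p)) set) = CARD('p) + CARD('p)"
    using vec_dim_card[where ?'n="'p + 'p" and ?'a=complex] by simp
  ultimately have dimN: "vec.dim N = CARD('p)" using dimL by simp
  obtain B where B: "B \<subseteq> N" "vec.independent B" "N \<subseteq> vec.span B" "card B = CARD('p)"
    using vec.basis_exists[of N] unfolding dimN by blast
  have finB: "finite B" by (rule vec.finiteI_independent[OF B(2)])
  obtain f :: "'p \<Rightarrow> complex^('p + 'p)" where f: "bij_betw f UNIV B"
    using finite_same_card_bij[of "UNIV :: 'p set" B] finB B(4) by auto
  then have finj: "inj f" and fB: "range f = B" by (simp_all add: bij_betw_def)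
  have fN: "f k \<in> N" for k using fB B(1) by blast
  define \<Phi> :: "complex^'p^('p + 'p)" where "\<Phi> = (\<chi> i k. f k $ i)"
  have \<Phi>x: "\<Phi> *v x = (\<Sum>k\<in>UNIV. x $ k *s f k)" for x unfolding \<Phi>_def by (rule matrix_vector_columns)
  have \<Phi>N: "\<Phi> *v x \<in> N" for x
    unfolding \<Phi>x by (intro vec.subspace_sum[OF sub] vec.subspace_scale[OF sub] fN)
  have range\<Phi>: "N = range ((*v) \<Phi>)"
  proof
    show "range ((*v) \<Phi>) \<subseteq> N" using \<Phi>N by blast
    show "N \<subseteq> range ((*v) \<Phi>)"
    proof
      fix n assume "n \<in> N"
      then have "n \<in> range (\<lambda>u. \<Sum>v\<in>B. u v *s v)" using B(3) vec.span_finite[OF finB] by blast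
      then obtain u where "n = (\<Sum>v\<in>B. u v *s v)" by blast
      also have "\<dots> = (\<Sum>k\<in>UNIV. u (f k) *s f k)" unfolding fB[symmetric] by (simp add: sum.reindex[OF finj])
      also have "\<dots> = \<Phi> *v (\<chi> k. u (f k))" unfolding \<Phi>x by simp
      finally show "n \<in> range ((*v) \<Phi>)" by blast
    qed
  qed
  have inj\<Phi>: "x = 0" if "\<Phi> *v x = 0" for x
  proof -
    have "(\<Sum>v\<in>B. x $ (inv f v) *s v) = 0"
      unfolding fB[symmetric] using that finj by (simp add: sum.reindex[OF finj] \<Phi>x)
    then have "\<not> (\<exists>v\<in>B. x $ (inv f v) \<noteq> 0)"
      using B(2) vec.dependent_finite[OF finB, THEN iffD2, OF exI, of "\<lambda>v. x $ inv f v"] by metis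
    then have "x $ inv f (f k) = 0" for k using fB by blast
    then show ?thesis using finj by (simp add: vec_eq_iff)
  qed
  define W' :: "complex^'p^('p + 'p)" where "W' = (\<chi> i k. skewc (f k) $ i)"
  have W'x: "W' *v x = skewc (\<Phi> *v (\<chi> k. cnj (x $ k)))" for x
    unfolding W'_def matrix_vector_columns \<Phi>x skewc_sum skewc_scale by simp
  \<comment> \<open>\<open>P\<close> is, up to sign, the Gram matrix of the basis \<open>f\<close>, hence invertible; \<open>W\<close> is \<open>W'\<close> normalized by its inverse.\<close>
  define P :: "complex^'p^'p" where "P = (\<chi> l k. symp (skewc (f k)) (f l))"
  have Px: "(P *v x) $ l = symp (W' *v x) (f l)" for x l
  proof -
    have "(P *v x) $ l = (\<Sum>k\<in>UNIV. symp (skewc (f k)) (f l) * x $ k)"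
      by (simp add: P_def matrix_vector_mult_def)
    moreover have "symp (W' *v x) (f l) = (\<Sum>k\<in>UNIV. x $ k * symp (skewc (f k)) (f l))"
      unfolding W'_def matrix_vector_columns symp_sum_left symp_scale_left ..
    ultimately show ?thesis by (simp add: mult.commute)
  qed
  have W'\<Phi>: "symp (W' *v x) (\<Phi> *v y) = (\<Sum>k\<in>UNIV. (P *v x) $ k * y $ k)" for x y
    unfolding \<Phi>x symp_sum_right symp_scale_right Px by (simp add: mult.commute)
  have "x = 0" if "P *v x = 0" for x
  proof -
    let ?y = "\<chi> k. cnj (x $ k)"
    have "symp (W' *v x) (\<Phi> *v ?y) = 0" unfolding W'\<Phi> that by simp
    then have "herm (\<Phi> *v ?y) (\<Phi> *v ?y) = 0"
      unfolding W'x using symp_skewc[of "\<Phi> *v ?y" "\<Phi> *v ?y"] symp_antisym[of "\<Phi> *v ?y" "skewc (\<Phi> *v ?y)"] by simp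
    then have "?y = 0" using herm_self_eq_0 inj\<Phi> by blast
    then show ?thesis by (simp add: vec_eq_iff)
  qed
  then obtain Pi where "Pi ** P = mat 1" using matrix_left_invertible_ker[of P] by blast
  then have PPi: "P ** Pi = mat 1" by (simp add: matrix_left_right_inverse)
  define W where "W = W' ** Pi"
  have Wx: "W *v x = W' *v (Pi *v x)" for x unfolding W_def by (simp add: matrix_vector_mul_assoc)
  have W_L: "W *v x \<in> L" for x unfolding Wx W'x L_def using \<Phi>N by blast
  have PPx: "P *v (Pi *v x) = x" for x using PPi by (simp add: matrix_vector_mul_assoc)
  have "W *v (P *v x) = W' *v x" for x
    unfolding Wx using \<open>Pi ** P = mat 1\<close> by (simp add: matrix_vector_mul_assoc)
  then have L_W: "\<exists>b. l = W *v b" if lL: "l \<in> L" for l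
  proof -
    obtain n where n: "n \<in> N" "l = skewc n" using lL unfolding L_def by auto
    then obtain y where y: "n = \<Phi> *v y" using range\<Phi> by blast
    have "l = W' *v (\<chi> k. cnj (y $ k))" unfolding W'x n y by simp
    then show ?thesis using \<open>\<And>x. W *v (P *v x) = W' *v x\<close> by metis
  qed
  show ?thesis
  proof (rule that[of \<Phi> W])
    show "N = range ((*v) \<Phi>)" by (rule range\<Phi>)
    show "symp (W *v x) (W *v y) = 0" for x y
    proof -
      obtain m n where mn: "m \<in> N" "n \<in> N" "W *v x = skewc m" "W *v y = skewc n" using W_L unfolding L_def by blast
      have "symp m n = 0" using lag mn(1,2) by blast
      then show ?thesis unfolding mn(3,4) symp_skewc_skewc by simp
    qed
    show "symp (W *v x) (\<Phi> *v y) = (\<Sum>k\<in>UNIV. x $ k * y $ k)" for x y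
      unfolding Wx W'\<Phi> PPx ..
    show "\<exists>a b. v = \<Phi> *v a + W *v b" for v
    proof -
      obtain n l where "n \<in> N" "l \<in> L" "v = n + l" using decomp by blast
      moreover obtain a where "n = \<Phi> *v a" using \<open>n \<in> N\<close> range\<Phi> by blast
      moreover obtain b where "l = W *v b" using L_W[OF \<open>l \<in> L\<close>] by blast
      ultimately show ?thesis by blast
    qed
  qed
qed

text \<open>The rows of \<open>C\<close> are the functionals \<open>symp (W e\<^sub>k)\<close>. Duality of \<open>W\<close> and \<open>\<Phi>\<close> gives \<open>C \<Phi> = 1\<close>, and the
  kernel of \<open>C\<close> is the range of \<open>W\<close>, a Lagrangian complement of \<open>N\<close>; the last property says that this
  kernel is its own symplectic complement.\<close>

lemma lagrangian_boundary_matrix: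
  fixes N :: "(complex^('p::finite + 'p)) set"
  assumes sub: "vec.subspace N" and lag: "\<And>c. c \<in> N \<longleftrightarrow> (\<forall>n\<in>N. symp c n = 0)"
  obtains \<Phi> W :: "complex^'p^('p + 'p)" and C :: "complex^('p + 'p)^'p"
  where "N = range ((*v) \<Phi>)" "\<And>x. C *v (\<Phi> *v x) = x" "\<And>x. C *v (W *v x) = 0"
    "\<And>x y. symp (W *v x) (\<Phi> *v y) = (\<Sum>k\<in>UNIV. x $ k * y $ k)"
    "\<And>c. C *v c = 0 \<longleftrightarrow> (\<forall>d. C *v d = 0 \<longrightarrow> symp d c = 0)"
proof -
  obtain \<Phi> W :: "complex^'p^('p + 'p)"
  where fr: "N = range ((*v) \<Phi>)" "\<And>x y. symp (W *v x) (W *v y) = 0"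
    "\<And>x y. symp (W *v x) (\<Phi> *v y) = (\<Sum>k\<in>UNIV. x $ k * y $ k)"
    "\<And>v. \<exists>a b. v = \<Phi> *v a + W *v b"
    using lagrangian_frame[OF sub lag] by blast
  define C :: "complex^('p + 'p)^'p" where "C = (\<chi> k i. symp (W *v axis k 1) (axis i 1))"
  have Cv: "(C *v v) $ k = symp (W *v axis k 1) v" for v k
  proof -
    have "(C *v v) $ k = symp (W *v axis k 1) (\<Sum>i\<in>UNIV. v $ i *s axis i 1)"
      unfolding C_def matrix_vector_mult_def symp_sum_right symp_scale_right by (simp add: mult.commute)
    then show ?thesis by (simp add: basis_expansion)
  qed
  have delta: "(\<Sum>l\<in>UNIV. axis k 1 $ l * x $ l) = x $ k" for k and x :: "complex^'p"
  proof -
    have "axis k 1 $ l * x $ l = (if l = k then x $ l else 0)" for l by (simp add: axis_def)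
    then show ?thesis by simp
  qed
  have C\<Phi>: "C *v (\<Phi> *v x) = x" for x by (simp add: vec_eq_iff Cv fr(3) delta)
  have CW: "C *v (W *v x) = 0" for x by (simp add: vec_eq_iff Cv fr(2))
  show ?thesis
  proof (rule that[OF fr(1) C\<Phi> CW fr(3)])
    fix c
    have ker: "\<exists>b. d = W *v b" if "C *v d = 0" for d
    proof -
      obtain a b where d: "d = \<Phi> *v a + W *v b" using fr(4) by blast
      then have "C *v d = a" by (simp add: bounded_bilinear.add_right[OF matrix_vector_bounded_bilinear] C\<Phi> CW)
      then show ?thesis using that d by (auto simp: bounded_bilinear.zero_right[OF matrix_vector_bounded_bilinear])
    qed
    show "C *v c = 0 \<longleftrightarrow> (\<forall>d. C *v d = 0 \<longrightarrow> symp d c = 0)"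
    proof
      assume "C *v c = 0"
      then show "\<forall>d. C *v d = 0 \<longrightarrow> symp d c = 0" using ker fr(2) by metis
    next
      assume "\<forall>d. C *v d = 0 \<longrightarrow> symp d c = 0"
      then have "symp (W *v axis k 1) c = 0" for k using CW by blast
      then show "C *v c = 0" by (simp add: vec_eq_iff Cv)
    qed
  qed
qed

section \<open>The adjoint potential and the defect numbers\<close>

text \<open>The independence of the family \<open>f\<close> forces \<open>f\<close> to be injective, so that its range is a basis with
  \<open>CARD('p)\<close> elements.\<close>

lemma l2_dim_eq_CARD:
  fixes f :: "'p::finite \<Rightarrow> (complex^'n) l2"
  assumes V: "V = range (\<lambda>c. \<Sum>k\<in>UNIV. cscale (c k) (f k))"
    and ind: "\<And>c k. (\<Sum>k\<in>UNIV. cscale (c k) (f k)) = 0 \<Longrightarrow> c k = 0"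
  shows "l2.dim V = CARD('p)"
proof -
  have inj: "inj f"
  proof (rule injI, rule ccontr)
    fix a b assume ab: "f a = f b" "a \<noteq> b"
    have "(\<Sum>k\<in>UNIV. cscale (if k = a then 1 else if k = b then -1 else 0) (f k))
        = (\<Sum>k\<in>{a,b}. cscale (if k = a then 1 else if k = b then -1 else 0) (f k))"
      by (rule sum.mono_neutral_right) auto
    also have "\<dots> = 0" using ab by simp
    finally show False using ind[of "\<lambda>k. if k = a then 1 else if k = b then -1 else 0" a] by simp
  qed
  have fin: "finite (range f)" by simp
  have "l2.independent (range f)"
    unfolding l2.dependent_finite[OF fin]
  proof clarify
    fix u k assume "(\<Sum>v\<in>range f. cscale (u v) v) = 0" "u (f k) \<noteq> 0"
    then have "(\<Sum>k\<in>UNIV. cscale (u (f k)) (f k)) = 0" by (simp add: sum.reindex[OF inj])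
    from ind[of "\<lambda>k. u (f k)", OF this, of k] \<open>u (f k) \<noteq> 0\<close> show False by simp
  qed
  moreover have "l2.span (range f) = V"
  proof -
    have "l2.span (range f) = range (\<lambda>u. \<Sum>k\<in>UNIV. cscale (u (f k)) (f k))"
      unfolding l2.span_finite[OF fin] by (simp add: sum.reindex[OF inj])
    also have "\<dots> = V"
      unfolding V
    proof (intro set_eqI iffI)
      fix x assume "x \<in> range (\<lambda>c. \<Sum>k\<in>UNIV. cscale (c k) (f k))"
      then obtain c where x: "x = (\<Sum>k\<in>UNIV. cscale (c k) (f k))" by blast
      have "x = (\<Sum>k\<in>UNIV. cscale ((c \<circ> inv f) (f k)) (f k))" unfolding x using inj by simp
      then show "x \<in> range (\<lambda>u. \<Sum>k\<in>UNIV. cscale (u (f k)) (f k))" by blast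
    next
      fix x assume "x \<in> range (\<lambda>u. \<Sum>k\<in>UNIV. cscale (u (f k)) (f k))"
      then obtain u where "x = (\<Sum>k\<in>UNIV. cscale (u (f k)) (f k))" by blast
      then show "x \<in> range (\<lambda>c. \<Sum>k\<in>UNIV. cscale (c k) (f k))" by (intro range_eqI[of _ _ "\<lambda>k. u (f k)"])
    qed
    finally show ?thesis .
  qed
  ultimately have "l2.dim V = card (range f)"
    using l2.dim_eq_card[of "range f" V] l2.span_span by metis
  then show ?thesis using inj by (simp add: card_image)
qed

text \<open>Conjugation by \<open>v \<mapsto> swap_mat *v cnj v\<close> turns a matrix that is symmetric for \<open>sdot\<close> into its Hermitian
  adjoint and fixes \<open>J\<close>. Therefore \<open>swap_conj\<close> intertwines the Dirac operators of \<open>Q\<close> and of \<open>Q\<^sup>*\<close>.\<close>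

lemma swap_cnj_commutes:
  fixes A :: "complex^('p::finite + 'p)^('p + 'p)"
  defines "sc \<equiv> (\<lambda>v :: complex^('p + 'p). swap_mat *v (\<chi> k. cnj (v $ k)))"
  assumes A: "\<And>u v. sdot (A *v u) v = sdot u (A *v v)"
  shows "sc (A *v v) = adj_mat A *v sc v" "sc (J_mat *v v) = J_mat *v sc v"
proof -
  have col: "(A *v axis k 1) $ i = A $ i $ k" for i k
  proof -
    have "A $ i $ j * axis k 1 $ j = (if j = k then A $ i $ j else 0)" for j by (simp add: axis_def)
    then show ?thesis by (simp add: matrix_vector_mult_def)
  qed
  have ent: "A $ Inr a $ Inr b = A $ Inl b $ Inl a" "A $ Inl a $ Inr b = A $ Inl b $ Inr a"
    "A $ Inr a $ Inl b = A $ Inr b $ Inl a" for a b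
    using A[of "axis (Inr b) 1" "axis (Inl a) 1"] A[of "axis (Inr b) 1" "axis (Inr a) 1"] A[of "axis (Inl b) 1" "axis (Inl a) 1"]
      sdot_sym[of "axis (Inr b) 1" "A *v axis (Inl a) 1"] sdot_sym[of "axis (Inr b) 1" "A *v axis (Inr a) 1"]
      sdot_sym[of "axis (Inl b) 1" "A *v axis (Inl a) 1"]
    by (simp_all add: sdot_axis col)
  have mv: "(M *v x) $ i = (\<Sum>b\<in>UNIV. M $ i $ Inl b * x $ Inl b) + (\<Sum>b\<in>UNIV. M $ i $ Inr b * x $ Inr b)"
    for M :: "complex^('p + 'p)^('p + 'p)" and x i
    by (simp add: matrix_vector_mult_def sum_UNIV_Plus)
  have adj_nth: "adj_mat A $ i $ k = cnj (A $ k $ i)" for i k by (simp add: adj_mat_def)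
  show "sc (A *v v) = adj_mat A *v sc v"
    unfolding sc_def vec_Plus_eq_iff
    by (simp add: swap_mat_mult mv[of A] mv[of "adj_mat A"] adj_nth ent add.commute)
  show "sc (J_mat *v v) = J_mat *v sc v"
    unfolding sc_def vec_Plus_eq_iff by (simp add: swap_mat_mult J_mat_mult)
qed

lemma swap_conj_diff: "swap_conj (f - g) = swap_conj f - swap_conj g"
  using swap_conj_add[of "f - g" g] by simp

lemma adj_mat_adj_mat: "adj_mat (adj_mat A) = A"
  by (simp add: adj_mat_def vec_eq_iff)

lemma bounded_linear_adj_mat: "bounded_linear (adj_mat :: complex^'m^'n \<Rightarrow> complex^'n^'m)"
  by (rule linear_conv_bounded_linear[THEN iffD1], rule linearI) (simp_all add: vec_eq_iff adj_mat_def)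

lemma cinner_hermitian: "cinner f g = cnj (cinner g f)"
proof (cases f rule: l2_class_cases; cases g rule: l2_class_cases)
  fix u v :: "real \<Rightarrow> complex^'a" assume *: "square_integrable u" "f = l2_class u" "square_integrable v" "g = l2_class v"
  have "cnj (integral\<^sup>L halfline (\<lambda>t. \<Sum>k\<in>UNIV. v t $ k * cnj (u t $ k)))
      = integral\<^sup>L halfline (\<lambda>t. cnj (\<Sum>k\<in>UNIV. v t $ k * cnj (u t $ k)))"
    by (rule integral_bounded_linear'[OF bounded_linear_cnj bounded_linear_cnj, symmetric]) simp
  then show ?thesis unfolding *(2,4) cinner_class[OF *(1,3)] cinner_class[OF *(3,1)] by (simp add: mult.commute)
qed

context dirac
begin

lemma dirac_adj: "dirac (\<lambda>t. adj_mat (Q t))"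
proof
  show "locally_integrable (\<lambda>t. adj_mat (Q t))" by (rule locally_integrable_linear[OF bounded_linear_adj_mat Q_loc])
  show "AE t in halfline. \<forall>u v. sdot (adj_mat (Q t) *v u) v = sdot u (adj_mat (Q t) *v v)"
    using Q_sym
  proof eventually_elim
    case (elim t)
    let ?sc = "\<lambda>v :: complex^('p + 'p). swap_mat *v (\<chi> k. cnj (v $ k))"
    have sc2: "?sc (?sc v) = v" for v by (simp add: vec_Plus_eq_iff swap_mat_mult)
    have sd: "sdot (?sc u) (?sc v) = cnj (sdot u v)" for u v
      unfolding sdot_def by (simp add: swap_mat_mult add.commute)
    show ?case
    proof (intro allI)
      fix u v
      have "sdot (adj_mat (Q t) *v u) v = sdot (?sc (Q t *v ?sc u)) (?sc (?sc v))"
        using swap_cnj_commutes(1)[of "Q t" "?sc u"] elim by (simp add: sc2)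
      also have "\<dots> = cnj (sdot (?sc u) (Q t *v ?sc v))" unfolding sd using elim by simp
      also have "\<dots> = sdot u (?sc (Q t *v ?sc v))" unfolding sd[symmetric] sc2 ..
      also have "\<dots> = sdot u (adj_mat (Q t) *v v)"
        using swap_cnj_commutes(1)[of "Q t" "?sc v"] elim by (simp add: sc2)
      finally show "sdot (adj_mat (Q t) *v u) v = sdot u (adj_mat (Q t) *v v)" .
    qed
  qed
qed

interpretation star: dirac "\<lambda>t. adj_mat (Q t)"
  by (rule dirac_adj)

lemma solution_star:
  assumes "solution y f"
  shows "star.solution (\<lambda>t. swap_mat *v (\<chi> k. cnj (y t $ k))) (\<lambda>t. swap_mat *v (\<chi> k. cnj (f t $ k)))"
  unfolding star.solution_def
proof
  let ?sc = "\<lambda>v :: complex^('p + 'p). swap_mat *v (\<chi> k. cnj (v $ k))"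
  show "AC_loc (\<lambda>t. ?sc (y t))" by (rule AC_loc_linear[OF bounded_linear_swap_cnj solution_AC[OF assms]])
  have "AE t in halfline. (y has_vector_derivative J_mat *v (Q t *v y t - f t)) (at t)"
    using assms unfolding solution_def by (rule conjunct2)
  then show "AE t in halfline. ((\<lambda>t. ?sc (y t)) has_vector_derivative J_mat *v (adj_mat (Q t) *v ?sc (y t) - ?sc (f t))) (at t)"
    using Q_sym
  proof eventually_elim
    case (elim t)
    have "?sc (Q t *v y t - f t) = ?sc (Q t *v y t) - ?sc (f t)"
      using bounded_linear.linear[OF bounded_linear_swap_cnj] by (rule linear_diff)
    then have "?sc (J_mat *v (Q t *v y t - f t)) = J_mat *v (adj_mat (Q t) *v ?sc (y t) - ?sc (f t))"
      using swap_cnj_commutes[of "Q t"] elim(2) by simp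
    with bounded_linear.has_vector_derivative[OF bounded_linear_swap_cnj elim(1)] show ?case by simp
  qed
qed

lemma D_min_star:
  assumes "(u, v) \<in> D_min Q"
  shows "(swap_conj u, swap_conj v) \<in> D_min (\<lambda>t. adj_mat (Q t))"
proof -
  let ?m = "\<lambda>p. (swap_conj (fst p), swap_conj (snd p))"
  have sw: "bounded_linear (swap_conj :: (complex^('p + 'p)) l2 \<Rightarrow> _)"
  proof (rule bounded_linear_intro[of _ 1])
    show "swap_conj (x + y) = swap_conj x + swap_conj y" for x y :: "(complex^('p + 'p)) l2" by (rule swap_conj_add)
    show "swap_conj (r *\<^sub>R x) = r *\<^sub>R swap_conj x" for r and x :: "(complex^('p + 'p)) l2"
      unfolding cscale_of_real[symmetric] swap_conj_cscale by simp
  qed (simp add: norm_swap_conj)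
  have "?m ` closure D_min0 \<subseteq> closure star.D_min0"
  proof (rule image_closure_subset)
    show "continuous_on (closure D_min0) ?m"
      by (intro continuous_intros bounded_linear.continuous_on[OF sw])
    show "?m ` D_min0 \<subseteq> closure star.D_min0"
    proof clarify
      fix u v assume "(u, v) \<in> D_min0"
      then obtain y b where y: "y \<in> max_domain Q" "u = l2_class y" "v = l2_class (diff_expr Q y)" "\<And>t. t > b \<Longrightarrow> y t = 0" "y 0 = 0"
        unfolding D_min0_def by blast
      have s: "solution y (diff_expr Q y)" using y(1) unfolding max_domain_def solution_iff by auto
      have sq: "square_integrable y" "square_integrable (diff_expr Q y)"
        using y(1) unfolding max_domain_def by auto
      have z: "swap_mat *v (\<chi> k. cnj ((0 :: complex^('p + 'p)) $ k)) = 0" by (simp add: vec_Plus_eq_iff swap_mat_mult)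
      have "(?m (u, v)) \<in> star.D_min0"
        unfolding fst_conv snd_conv y(2,3) swap_conj_class[OF sq(1)] swap_conj_class[OF sq(2)]
        by (rule star.D_min0I[OF solution_star[OF s], where b=b])
          (use sq y z in \<open>auto intro: square_integrable_bounded_linear[OF bounded_linear_swap_cnj]\<close>)
      then show "(swap_conj (fst (u, v)), swap_conj (snd (u, v))) \<in> closure star.D_min0" using closure_subset by blast
    qed
  qed simp
  then show ?thesis using assms unfolding D_min_closure star.D_min_closure by force
qed

text \<open>The potential \<open>Q\<^sup>*\<close> has the same symmetry as \<open>Q\<close>, so the inclusion can be applied twice.\<close>

lemma D_min_star_iff:
  "(u, v) \<in> D_min (\<lambda>t. adj_mat (Q t)) \<longleftrightarrow> (swap_conj u, swap_conj v) \<in> D_min Q"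
  using D_min_star[of "swap_conj u" "swap_conj v"] dirac.D_min_star[OF dirac_adj, of u v]
  by (auto simp: swap_conj_swap_conj adj_mat_adj_mat)

text \<open>Conjugating by \<open>swap_conj\<close> replaces the adjoint by the transpose and \<open>Q\<^sup>*\<close> by \<open>Q\<close>, and the transpose of
  \<open>D_min Q\<close> is \<open>D_max Q\<close>.\<close>

lemma adj_D_min_star: "adj (D_min (\<lambda>t. adj_mat (Q t))) = D_max Q"
proof -
  have *: "cinner b u = cnj (bil u (swap_conj b))" for b u :: "(complex^('p + 'p)) l2"
    unfolding bil_def swap_conj_swap_conj by (rule cinner_hermitian)
  have "(u, v) \<in> adj (D_min (\<lambda>t. adj_mat (Q t))) \<longleftrightarrow> (u, v) \<in> transpose_op (D_min Q)" for u v
  proof -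
    have "(u, v) \<in> adj (D_min (\<lambda>t. adj_mat (Q t))) \<longleftrightarrow>
        (\<forall>a b. (swap_conj a, swap_conj b) \<in> D_min Q \<longrightarrow> bil u (swap_conj b) = bil v (swap_conj a))"
      unfolding adj_def by (auto simp: D_min_star_iff *)
    also have "\<dots> \<longleftrightarrow> (\<forall>f g. (f, g) \<in> D_min Q \<longrightarrow> bil u g = bil v f)" by (metis swap_conj_swap_conj)
    also have "\<dots> \<longleftrightarrow> (u, v) \<in> transpose_op (D_min Q)" unfolding transpose_op_iff bil_sym[of u] bil_sym[of v] by blast
    finally show ?thesis .
  qed
  then show ?thesis unfolding transpose_D_min[symmetric] by auto
qed

lemma defect_space_star: "defect_space z (D_min (\<lambda>t. adj_mat (Q t))) = eig z"
  unfolding defect_space_def eig_def adj_D_min_star ..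

lemma defect_space_eq: "defect_space (cnj z) (D_min Q) = swap_conj ` eig z"
proof -
  have iff: "f \<in> defect_space (cnj z) (D_min Q) \<longleftrightarrow> swap_conj f \<in> eig z" for f
    unfolding defect_space_def eig_def by (simp add: adj_iff_transpose_op transpose_D_min swap_conj_cscale)
  show ?thesis
  proof (intro set_eqI iffI)
    fix f assume "f \<in> defect_space (cnj z) (D_min Q)"
    then have "swap_conj (swap_conj f) \<in> swap_conj ` eig z" unfolding iff by (rule imageI)
    then show "f \<in> swap_conj ` eig z" unfolding swap_conj_swap_conj .
  next
    fix f assume "f \<in> swap_conj ` eig z"
    then obtain g where "g \<in> eig z" "f = swap_conj g" by (rule imageE)
    then show "f \<in> defect_space (cnj z) (D_min Q)" unfolding iff by (simp only: swap_conj_swap_conj)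
  qed
qed

lemma rho_hat_D_min_star:
  assumes "z \<in> rho_hat (D_min Q)"
  shows "cnj z \<in> rho_hat (D_min (\<lambda>t. adj_mat (Q t)))"
proof -
  obtain \<epsilon> where \<epsilon>: "\<epsilon> > 0" "\<And>u v. (u, v) \<in> D_min Q \<Longrightarrow> \<epsilon> * norm u \<le> norm (v - cscale z u)"
    using assms unfolding rho_hat_def by fastforce
  have "\<epsilon> * norm u \<le> norm (v - cscale (cnj z) u)" if "(u, v) \<in> D_min (\<lambda>t. adj_mat (Q t))" for u v
  proof -
    have "\<epsilon> * norm (swap_conj u) \<le> norm (swap_conj v - cscale z (swap_conj u))"
      using that by (intro \<epsilon>(2)) (simp add: D_min_star_iff)
    also have "swap_conj v - cscale z (swap_conj u) = swap_conj (v - cscale (cnj z) u)"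
      unfolding swap_conj_diff swap_conj_cscale by simp
    finally show ?thesis by (simp add: norm_swap_conj)
  qed
  then show ?thesis using \<epsilon>(1) unfolding rho_hat_def by blast
qed

text \<open>A vector orthogonal to the domain would be the image of zero under the maximal operator.\<close>

lemma densely_defined_D_min: "densely_defined (D_min Q)"
proof -
  define M where "M = closure (Domain D_min0)"
  have dom: "u + w \<in> Domain D_min0" "cscale c u \<in> Domain D_min0" "0 \<in> Domain D_min0"
    if "u \<in> Domain D_min0" "w \<in> Domain D_min0" for u w c
    using that D_min0_add D_min0_scale D_min0_0 by blast+
  have "0 \<in> Domain D_min0" using D_min0_0 by blast
  then have "subspace (Domain D_min0)"
    unfolding subspace_def using dom by (auto simp: cscale_of_real[symmetric])
  then have sub: "subspace M" unfolding M_def by (rule subspace_closure)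
  have comp: "complete M" unfolding M_def by (simp add: complete_eq_closed)
  have "g \<in> M" for g
  proof -
    obtain m where m: "m \<in> M" "\<And>w. w \<in> M \<Longrightarrow> (g - m) \<bullet> w = 0"
      using orthogonal_projection_exists[OF sub comp] by blast
    define \<psi> where "\<psi> = swap_conj (g - m)"
    have perp: "bil w \<psi> = 0" if w: "w \<in> Domain D_min0" for w
    proof -
      have re: "Re (bil w \<psi>) = 0" if "w \<in> Domain D_min0" for w
      proof -
        have "w \<in> M" unfolding M_def by (rule subsetD[OF closure_subset that])
        then show ?thesis using m(2)[of w] inner_eq_Re_cinner[of w "g - m"]
          by (simp add: \<psi>_def bil_def swap_conj_swap_conj inner_commute)
      qed
      from re[OF w] re[OF dom(2)[OF w w], of \<i>] show ?thesis
        by (simp add: bil_scale_left complex_eq_iff)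
    qed
    have "(0, \<psi>) \<in> D_max Q"
      unfolding transpose_D_min0[symmetric] transpose_op_iff using perp by (auto simp: Domain_iff)
    then have "\<psi> = 0" using D_max_single_valued D_max_0 unfolding single_valued_def by blast
    then have "norm (g - m) = 0" unfolding \<psi>_def using norm_swap_conj[of "g - m"] by simp
    then show ?thesis using m(1) by simp
  qed
  then have "closure (Domain D_min0) = UNIV" unfolding M_def by blast
  moreover have "Domain D_min0 \<subseteq> Domain (D_min Q)" unfolding D_min_closure using closure_subset by blast
  ultimately show ?thesis unfolding densely_defined_def using closure_mono by (metis top.extremum_uniqueI)
qed

lemma linear_op_D_min: "linear_op (D_min Q)"
  unfolding linear_op_def
proof (intro conjI allI impI)
  show "single_valued (D_min Q)" using D_max_single_valued D_min_subset_D_max by (rule single_valued_subset[rotated])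
  show "(0, 0) \<in> D_min Q" using subspace_0[OF subspace_D_min] by (simp add: zero_prod_def)
  show "(f + f', g + g') \<in> D_min Q" if "(f, g) \<in> D_min Q" "(f', g') \<in> D_min Q" for f g f' g'
    using subspace_add[OF subspace_D_min that] by simp
  show "(cscale c f, cscale c g) \<in> D_min Q" if "(f, g) \<in> D_min Q" for c f g by (rule D_min_scale[OF that])
qed

lemma j_symmetric_D_min: "j_symmetric swap_conj (D_min Q)"
  unfolding j_symmetric_def conj_op_adj transpose_D_min
  using linear_op_D_min densely_defined_D_min D_min_subset_D_max by blast

lemma eigD: "\<phi> \<in> eig z \<Longrightarrow> (\<phi>, cscale z \<phi>) \<in> D_max Q"
  by (simp add: eig_def)

lemma eig_diff: "\<phi> \<in> eig z \<Longrightarrow> \<psi> \<in> eig z \<Longrightarrow> \<phi> - \<psi> \<in> eig z"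
  using eig_add[of \<phi> z "cscale (-1) \<psi>"] eig_scale[of \<psi> z "-1"] by (simp add: cscale_minus_one)

lemma rep_ac_0: "rep_ac (0 :: (complex^('p + 'p)) l2) 0 = 0"
  using rep_ac_D_max_scale[OF D_max_0, of 0 0] by simp

text \<open>An eigenfunction is determined by its initial value, so a frame \<open>\<Phi>\<close> of the space of initial values
  lifts to a basis of the eigenspace.\<close>

lemma eig_basis:
  fixes \<Phi> :: "complex^'p^('p + 'p)"
  assumes frame: "bdry z = range ((*v) \<Phi>)"
  obtains \<phi> where "\<And>c. (\<Sum>k\<in>UNIV. cscale (c k) (\<phi> k)) \<in> eig z"
    "\<And>c. rep_ac (\<Sum>k\<in>UNIV. cscale (c k) (\<phi> k)) 0 = \<Phi> *v (\<chi> k. c k)"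
    "\<And>\<psi> y. \<psi> \<in> eig z \<Longrightarrow> rep_ac \<psi> 0 = \<Phi> *v y \<Longrightarrow> \<psi> = (\<Sum>k\<in>UNIV. cscale (y $ k) (\<phi> k))"
proof -
  have "\<exists>\<phi>. \<phi> \<in> eig z \<and> rep_ac \<phi> 0 = \<Phi> *v axis k 1" for k
  proof -
    have "\<Phi> *v axis k 1 \<in> bdry z" unfolding frame by blast
    then show ?thesis unfolding bdry_def by auto
  qed
  then obtain \<phi> where \<phi>: "\<And>k. \<phi> k \<in> eig z" "\<And>k. rep_ac (\<phi> k) 0 = \<Phi> *v axis k 1" by metis
  have comb: "(\<Sum>k\<in>K. cscale (c k) (\<phi> k)) \<in> eig z \<and> rep_ac (\<Sum>k\<in>K. cscale (c k) (\<phi> k)) 0 = (\<Sum>k\<in>K. c k *s (\<Phi> *v axis k 1))"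
    if "finite K" for c K
    using that
  proof (induction K)
    case empty
    then show ?case by (simp add: eig_0 rep_ac_0)
  next
    case (insert k K)
    let ?s = "\<Sum>k\<in>K. cscale (c k) (\<phi> k)"
    have 1: "cscale (c k) (\<phi> k) \<in> eig z" by (rule eig_scale[OF \<phi>(1)])
    have "rep_ac (cscale (c k) (\<phi> k)) 0 = c k *s rep_ac (\<phi> k) 0"
      by (rule rep_ac_D_max_scale[OF eigD[OF \<phi>(1)] order_refl])
    moreover have "rep_ac (cscale (c k) (\<phi> k) + ?s) 0 = rep_ac (cscale (c k) (\<phi> k)) 0 + rep_ac ?s 0"
      by (rule rep_ac_D_max_add[OF eigD[OF 1] eigD[OF insert.IH[THEN conjunct1]] order_refl])
    ultimately show ?case using insert eig_add[OF 1] by (simp add: \<phi>(2))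
  qed
  have lin: "(\<Sum>k\<in>UNIV. c k *s (\<Phi> *v axis k 1)) = \<Phi> *v (\<chi> k. c k)" for c
  proof -
    have "(\<chi> k. c k) = (\<Sum>k\<in>UNIV. c k *s axis k 1)" using basis_expansion[of "\<chi> k. c k"] by simp
    then show ?thesis by (simp only: bounded_bilinear.sum_right[OF matrix_vector_bounded_bilinear] mat_vec_scale)
  qed
  show ?thesis
  proof (rule that[of \<phi>])
    show c1: "(\<Sum>k\<in>UNIV. cscale (c k) (\<phi> k)) \<in> eig z" for c
      using comb[OF finite, of c] by (rule conjunct1)
    show c2: "rep_ac (\<Sum>k\<in>UNIV. cscale (c k) (\<phi> k)) 0 = \<Phi> *v (\<chi> k. c k)" for c
      using comb[of UNIV c] unfolding lin by simp
    fix \<psi> y assume \<psi>: "\<psi> \<in> eig z" "rep_ac \<psi> 0 = \<Phi> *v y"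
    let ?s = "\<Sum>k\<in>UNIV. cscale (y $ k) (\<phi> k)"
    have "rep_ac (\<psi> - ?s) 0 = rep_ac \<psi> 0 - rep_ac ?s 0"
      by (rule rep_ac_D_max_diff[OF eigD[OF \<psi>(1)] eigD[OF c1] order_refl])
    then have "rep_ac (\<psi> - ?s) 0 = 0" using c2[of "\<lambda>k. y $ k"] \<psi>(2) by simp
    then have "\<psi> - ?s = 0" using eig_zero[OF eig_diff[OF \<psi>(1) c1]] by blast
    then show "\<psi> = ?s" by simp
  qed
qed

text \<open>The space of initial values is Lagrangian, so its dimension is half of that of the whole space.\<close>

lemma dim_eig:
  assumes z: "z \<in> rho_hat (D_min Q)"
  shows "l2.dim (eig z) = CARD('p)" "l2.dim (swap_conj ` eig z) = CARD('p)"
proof -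
  obtain \<Phi> :: "complex^'p^('p + 'p)" and C :: "complex^('p + 'p)^'p"
    where fr: "bdry z = range ((*v) \<Phi>)" "\<And>x. C *v (\<Phi> *v x) = x"
  proof (rule lagrangian_boundary_matrix[OF subspace_bdry bdry_lagrangian[OF z]])
    fix \<Phi> W :: "complex^'p^('p + 'p)" and C :: "complex^('p + 'p)^'p"
    assume "bdry z = range ((*v) \<Phi>)" "\<And>x. C *v (\<Phi> *v x) = x"
    then show thesis by (rule that)
  qed
  obtain \<phi> where \<phi>: "\<And>c. (\<Sum>k\<in>UNIV. cscale (c k) (\<phi> k)) \<in> eig z"
    "\<And>c. rep_ac (\<Sum>k\<in>UNIV. cscale (c k) (\<phi> k)) 0 = \<Phi> *v (\<chi> k. c k)"
    "\<And>\<psi> y. \<psi> \<in> eig z \<Longrightarrow> rep_ac \<psi> 0 = \<Phi> *v y \<Longrightarrow> \<psi> = (\<Sum>k\<in>UNIV. cscale (y $ k) (\<phi> k))"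
  proof (rule eig_basis[OF fr(1)])
    fix \<phi> assume "\<And>c. (\<Sum>k\<in>UNIV. cscale (c k) (\<phi> k)) \<in> eig z"
      "\<And>c. rep_ac (\<Sum>k\<in>UNIV. cscale (c k) (\<phi> k)) 0 = \<Phi> *v (\<chi> k. c k)"
      "\<And>\<psi> y. \<psi> \<in> eig z \<Longrightarrow> rep_ac \<psi> 0 = \<Phi> *v y \<Longrightarrow> \<psi> = (\<Sum>k\<in>UNIV. cscale (y $ k) (\<phi> k))"
    then show thesis by (rule that)
  qed
  have ind: "c k = 0" if "(\<Sum>k\<in>UNIV. cscale (c k) (\<phi> k)) = 0" for c k
  proof -
    have "\<Phi> *v (\<chi> k. c k) = 0" using \<phi>(2)[of c] unfolding that rep_ac_0 by simp
    then have "(\<chi> k. c k) = C *v 0" using fr(2) by metis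
    then have "(\<chi> k. c k) = 0" by (simp add: bounded_bilinear.zero_right[OF matrix_vector_bounded_bilinear])
    then show ?thesis by (simp add: vec_eq_iff)
  qed
  have eig: "eig z = range (\<lambda>c. \<Sum>k\<in>UNIV. cscale (c k) (\<phi> k))"
  proof
    show "range (\<lambda>c. \<Sum>k\<in>UNIV. cscale (c k) (\<phi> k)) \<subseteq> eig z" using \<phi>(1) by blast
    show "eig z \<subseteq> range (\<lambda>c. \<Sum>k\<in>UNIV. cscale (c k) (\<phi> k))"
    proof
      fix \<psi> assume \<psi>: "\<psi> \<in> eig z"
      then have "rep_ac \<psi> 0 \<in> range ((*v) \<Phi>)" unfolding fr(1)[symmetric] bdry_def by blast
      then obtain y where "rep_ac \<psi> 0 = \<Phi> *v y" by blast
      from \<phi>(3)[OF \<psi> this] show "\<psi> \<in> range (\<lambda>c. \<Sum>k\<in>UNIV. cscale (c k) (\<phi> k))"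
        by (intro range_eqI[of _ _ "\<lambda>k. y $ k"])
    qed
  qed
  show "l2.dim (eig z) = CARD('p)" using eig ind by (rule l2_dim_eq_CARD)
  have sum: "swap_conj (\<Sum>k\<in>UNIV. cscale (c k) (\<phi> k)) = (\<Sum>k\<in>UNIV. cscale (cnj (c k)) (swap_conj (\<phi> k)))" for c
  proof -
    have "swap_conj 0 = (0 :: (complex^('p + 'p)) l2)" using norm_swap_conj[of "0 :: (complex^('p + 'p)) l2"] by simp
    then have "swap_conj (\<Sum>k\<in>K. cscale (c k) (\<phi> k)) = (\<Sum>k\<in>K. cscale (cnj (c k)) (swap_conj (\<phi> k)))" for K
      by (induction K rule: infinite_finite_induct) (auto simp: swap_conj_add swap_conj_cscale)
    then show ?thesis .
  qed
  show "l2.dim (swap_conj ` eig z) = CARD('p)"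
  proof (rule l2_dim_eq_CARD)
    show "swap_conj ` eig z = range (\<lambda>c. \<Sum>k\<in>UNIV. cscale (c k) (swap_conj (\<phi> k)))"
    proof (intro set_eqI iffI)
      fix x assume "x \<in> swap_conj ` eig z"
      then show "x \<in> range (\<lambda>c. \<Sum>k\<in>UNIV. cscale (c k) (swap_conj (\<phi> k)))" unfolding eig by (auto simp: sum)
    next
      fix x assume "x \<in> range (\<lambda>c. \<Sum>k\<in>UNIV. cscale (c k) (swap_conj (\<phi> k)))"
      then obtain c where "x = (\<Sum>k\<in>UNIV. cscale (c k) (swap_conj (\<phi> k)))" by blast
      then have "x = swap_conj (\<Sum>k\<in>UNIV. cscale (cnj (c k)) (\<phi> k))" by (simp add: sum)
      then show "x \<in> swap_conj ` eig z" by (intro image_eqI[OF _ \<phi>(1)])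
    qed
    fix c k assume "(\<Sum>k\<in>UNIV. cscale (c k) (swap_conj (\<phi> k))) = 0"
    then have "swap_conj (\<Sum>k\<in>UNIV. cscale (cnj (c k)) (\<phi> k)) = 0" by (simp add: sum)
    then have "(\<Sum>k\<in>UNIV. cscale (cnj (c k)) (\<phi> k)) = 0"
      using norm_swap_conj[of "\<Sum>k\<in>UNIV. cscale (cnj (c k)) (\<phi> k)"] by simp
    from ind[of "\<lambda>k. cnj (c k)", OF this, of k] show "c k = 0" by simp
  qed
qed

end

section \<open>Boundary conditions and the resolvent set\<close>

lemma norm_le_sum_components: "norm (x :: complex^'n) \<le> (\<Sum>k\<in>UNIV. cmod (x $ k))"
  unfolding norm_vec_def by (rule L2_set_le_sum) simp

text \<open>Uniqueness makes the solution operator linear, and the estimate makes it bounded.\<close>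

lemma resolvent_setI:
  fixes T :: "('n::finite) l2_op"
  assumes T: "linear_op T"
    and inj: "\<And>f g. (f, g) \<in> T \<Longrightarrow> g = cscale z f \<Longrightarrow> f = 0"
    and surj: "\<And>h. \<exists>f g. (f, g) \<in> T \<and> h = g - cscale z f \<and> norm f \<le> K * norm h"
  shows "z \<in> resolvent_set T"
proof -
  obtain R G where R: "\<And>h. (R h, G h) \<in> T" "\<And>h. h = G h - cscale z (R h)" "\<And>h. norm (R h) \<le> K * norm h"
    using surj by metis
  have G: "G h = h + cscale z (R h)" for h using R(2)[of h] by (metis diff_add_cancel)
  have add: "(f + f', g + g') \<in> T" if "(f, g) \<in> T" "(f', g') \<in> T" for f g f' g'
    using T that unfolding linear_op_def by blast
  have scale: "(cscale c f, cscale c g) \<in> T" if "(f, g) \<in> T" for c f g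
    using T that unfolding linear_op_def by blast
  have uniq: "f = R h" if fg: "(f, g) \<in> T" "h = g - cscale z f" for f g h
  proof -
    have "(f + cscale (-1) (R h), g + cscale (-1) (G h)) \<in> T" by (rule add[OF fg(1) scale[OF R(1)]])
    then have "(f - R h, g - G h) \<in> T" by (simp add: cscale_minus_one)
    moreover have "g - G h = cscale z (f - R h)"
      by (simp add: G fg(2) l2.scale_right_diff_distrib)
    ultimately have "f - R h = 0" by (rule inj)
    then show ?thesis by simp
  qed
  have "bounded_linear R"
  proof (rule bounded_linear_intro)
    fix x y :: "(complex^'n) l2" and r :: real
    have "x + y = (G x + G y) - cscale z (R x + R y)"
      by (simp add: G l2.scale_right_distrib)
    from uniq[OF add[OF R(1) R(1)] this] show "R (x + y) = R x + R y" by simp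
    have "r *\<^sub>R x = cscale (of_real r) (G x - cscale z (R x))" by (simp add: G cscale_of_real)
    also have "\<dots> = cscale (of_real r) (G x) - cscale z (cscale (of_real r) (R x))"
      by (simp add: l2.scale_right_diff_distrib mult.commute)
    finally have "cscale (of_real r) (R x) = R (r *\<^sub>R x)" by (rule uniq[OF scale[OF R(1)]])
    then show "R (r *\<^sub>R x) = r *\<^sub>R R x" by (simp add: cscale_of_real)
    show "norm (R x) \<le> norm x * K" using R(3)[of x] by (simp add: mult.commute)
  qed
  moreover have "{(g - cscale z f, f) | f g. (f, g) \<in> T} = {(h, R h) | h. True}"
  proof (intro set_eqI iffI)
    fix p assume "p \<in> {(g - cscale z f, f) | f g. (f, g) \<in> T}"
    then obtain f g where p: "p = (g - cscale z f, f)" "(f, g) \<in> T" by blast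
    then have "f = R (g - cscale z f)" by (intro uniq) auto
    then show "p \<in> {(h, R h) | h. True}" using p(1) by auto
  next
    fix p assume "p \<in> {(h, R h) | h. True}"
    then obtain h where p: "p = (h, R h)" by blast
    then have "p = (G h - cscale z (R h), R h)" by (simp add: G)
    then show "p \<in> {(g - cscale z f, f) | f g. (f, g) \<in> T}" using R(1)[of h] by blast
  qed
  ultimately show ?thesis unfolding resolvent_set_def by blast
qed

lemma resolvent_setE:
  assumes "z \<in> resolvent_set T"
  obtains R where "bounded_linear R" "\<And>h. (R h, h + cscale z (R h)) \<in> T"
    "\<And>f g. (f, g) \<in> T \<Longrightarrow> R (g - cscale z f) = f"
proof -
  obtain R where R: "bounded_linear R" and eq: "{(g - cscale z f, f) | f g. (f, g) \<in> T} = {(h, R h) | h. True}"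
    using assms unfolding resolvent_set_def by blast
  have "(R h, h + cscale z (R h)) \<in> T" for h
  proof -
    have "(h, R h) \<in> {(g - cscale z f, f) | f g. (f, g) \<in> T}" unfolding eq by blast
    then obtain g where "h = g - cscale z (R h)" "(R h, g) \<in> T" by auto
    moreover from this(1) have "g = h + cscale z (R h)" by (simp add: algebra_simps)
    ultimately show ?thesis by simp
  qed
  moreover have "R (g - cscale z f) = f" if "(f, g) \<in> T" for f g
  proof -
    have "(g - cscale z f, f) \<in> {(h, R h) | h. True}" unfolding eq[symmetric] using that by blast
    then show ?thesis by auto
  qed
  ultimately show ?thesis using that R by blast
qed

context dirac
begin

text \<open>Evaluation at \<open>t\<close> is continuous for the graph norm of the maximal operator: pairing with the
  homogeneous solutions recovers the value at \<open>t\<close>, and the Lagrange identity on \<open>[0, t]\<close>, together with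
  cutoff solutions for the value at \<open>0\<close>, writes each such pairing as a continuous functional.\<close>

lemma evaluation_bound:
  assumes t: "0 \<le> t"
  obtains M where "\<And>u v. (u, v) \<in> D_max Q \<Longrightarrow> norm (rep_ac u t) \<le> M * (norm u + norm v)"
proof -
  have symp_bound: "\<exists>M. \<forall>u v. (u, v) \<in> D_max Q \<longrightarrow> cmod (symp (fund t *v d) (rep_ac u t)) \<le> M * (norm u + norm v)" for d
  proof -
    let ?k = "\<lambda>s. if s \<le> t then 1 else 0 :: real"
    let ?G = "\<lambda>s. ?k s *\<^sub>R (fund s *v d)"
    have k: "?k \<in> borel_measurable borel" by measurable
    have sq: "square_integrable ?G"
      by (rule square_integrable_cutoff[OF fund_continuous k, where M = 1 and b = t]) auto
    let ?M = "norm (cut_u d) + norm (cut_v d) + norm (l2_class ?G)"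
    have "cmod (symp (fund t *v d) (rep_ac u t)) \<le> ?M * (norm u + norm v)" if uv: "(u, v) \<in> D_max Q" for u v
    proof -
      obtain y f where y: "solution y f" "square_integrable y" "square_integrable f" "u = l2_class y" "v = l2_class f"
        using D_maxE[OF uv] by metis
      have rep: "rep_ac u s = y s" if s: "0 \<le> s" for s
        unfolding y(4) by (rule rep_ac_class[OF solution_AC[OF y(1)] y(2) s])
      let ?F = "\<lambda>s. sdot (f s) (?G s)"
      have "bil v (l2_class ?G) = integral\<^sup>L halfline ?F" unfolding y(5) by (rule bil_class[OF y(3) sq])
      also have "\<dots> = integral {0..t} ?F"
        by (rule integral_halfline_cutoff[OF integrable_sdot[OF y(3) sq] _ t])
          (simp add: bounded_bilinear.zero_right[OF sdot_bounded_bilinear])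
      also have "\<dots> = integral {0..t} (\<lambda>s. sdot (f s) (fund s *v d) - sdot (y s) 0)"
        by (rule Henstock_Kurzweil_Integration.integral_cong)
          (simp add: bounded_bilinear.zero_right[OF sdot_bounded_bilinear])
      finally have G: "bil v (l2_class ?G) = \<dots>" .
      have val: "symp (rep_ac u t) (fund t *v d) = symp (rep_ac u 0) d + bil v (l2_class ?G)"
        unfolding G rep[OF t] rep[OF order_refl]
        using primitive_eq[OF lagrange[OF y(1) fund_solution[of d]] t] by (simp add: fund_0)
      have at0: "symp (rep_ac u 0) d = bil u (cut_v d) - bil v (cut_u d)"
        using lagrange_D_max[OF uv cut_D_max[of d]] unfolding rep_ac_cut by (simp add: algebra_simps)
      have "symp (fund t *v d) (rep_ac u t) = - (bil u (cut_v d) - bil v (cut_u d) + bil v (l2_class ?G))"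
        using symp_antisym[of "fund t *v d" "rep_ac u t"] unfolding val at0 .
      then have "cmod (symp (fund t *v d) (rep_ac u t)) = cmod (bil u (cut_v d) - bil v (cut_u d) + bil v (l2_class ?G))"
        by (simp only: norm_minus_cancel)
      also have "\<dots> \<le> cmod (bil u (cut_v d)) + cmod (bil v (cut_u d)) + cmod (bil v (l2_class ?G))"
        using norm_triangle_ineq[of "bil u (cut_v d) - bil v (cut_u d)" "bil v (l2_class ?G)"]
          norm_triangle_ineq4[of "bil u (cut_v d)" "bil v (cut_u d)"] by linarith
      also have "\<dots> \<le> norm u * norm (cut_v d) + norm v * norm (cut_u d) + norm v * norm (l2_class ?G)"
        by (intro add_mono bil_bound)
      also have "\<dots> \<le> (norm u + norm v) * norm (cut_v d) + (norm u + norm v) * norm (cut_u d)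
          + (norm u + norm v) * norm (l2_class ?G)"
        by (intro add_mono mult_right_mono) auto
      also have "\<dots> = ?M * (norm u + norm v)" by (simp add: algebra_simps)
      finally show ?thesis .
    qed
    then show ?thesis by blast
  qed
  then obtain m where m: "\<And>d u v. (u, v) \<in> D_max Q \<Longrightarrow> cmod (symp (fund t *v d) (rep_ac u t)) \<le> m d * (norm u + norm v)"
    by metis
  obtain K where K: "0 \<le> K" "\<And>x. norm (fund t *v x) \<le> norm x * K"
    using bounded_linear.nonneg_bounded[OF bounded_linear_matrix_vector] by blast
  define c where "c k = (case k of Inl a \<Rightarrow> m (axis (Inr a) 1) | Inr a \<Rightarrow> m (axis (Inl a) 1))" for k :: "'p + 'p"
  show ?thesis
  proof (rule that[of "(\<Sum>k\<in>UNIV. c k) * K"])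
    fix u v assume uv: "(u, v) \<in> D_max Q"
    let ?w = "sinv (fund t) (rep_ac u t)"
    have comp: "cmod (?w $ k) \<le> c k * (norm u + norm v)" for k
      by (cases k) (simp_all add: sinv_nth norm_mult c_def m[OF uv])
    have "norm ?w \<le> (\<Sum>k\<in>UNIV. cmod (?w $ k))" by (rule norm_le_sum_components)
    also have "\<dots> \<le> (\<Sum>k\<in>UNIV. c k * (norm u + norm v))" by (intro sum_mono comp)
    also have "\<dots> = (\<Sum>k\<in>UNIV. c k) * (norm u + norm v)" by (simp add: sum_distrib_right)
    finally have w: "norm ?w * K \<le> (\<Sum>k\<in>UNIV. c k) * (norm u + norm v) * K" using K(1) by (rule mult_right_mono)
    have "rep_ac u t = fund t *v ?w" by (rule sinv_inverse(2)[symmetric]) (rule fund_symplectic[OF t])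
    then have "norm (rep_ac u t) \<le> norm ?w * K" using K(2)[of ?w] by simp
    with w show "norm (rep_ac u t) \<le> (\<Sum>k\<in>UNIV. c k) * K * (norm u + norm v)" by (simp add: mult_ac)
  qed
qed

lemma D_bc_iff: "(u, v) \<in> D_bc Q C \<longleftrightarrow> (u, v) \<in> D_max Q \<and> C *v rep_ac u 0 = 0"
proof -
  have "rep_ac (l2_class y) 0 = y 0" if "y \<in> max_domain Q" for y
    using that rep_ac_class[of y 0] by (simp add: max_domain_def)
  then show ?thesis unfolding D_bc_def D_max_def by fastforce
qed

lemma linear_op_D_bc: "linear_op (D_bc Q C)"
  unfolding linear_op_def
proof (intro conjI allI impI)
  have "D_bc Q C \<subseteq> D_max Q" by (auto simp: D_bc_iff)
  then show "single_valued (D_bc Q C)" using D_max_single_valued single_valued_subset by blast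
  show "(0, 0) \<in> D_bc Q C"
    by (simp add: D_bc_iff D_max_0 rep_ac_0 bounded_bilinear.zero_right[OF matrix_vector_bounded_bilinear])
  show "(f + f', g + g') \<in> D_bc Q C" if "(f, g) \<in> D_bc Q C" "(f', g') \<in> D_bc Q C" for f g f' g'
    using that D_max_add[of f g f' g'] rep_ac_D_max_add[of f g f' g' 0]
    by (simp add: D_bc_iff bounded_bilinear.add_right[OF matrix_vector_bounded_bilinear])
  show "(cscale c f, cscale c g) \<in> D_bc Q C" if "(f, g) \<in> D_bc Q C" for c f g
    using that D_max_scale[of f g c] rep_ac_D_max_scale[of f g 0 c]
    by (simp add: D_bc_iff mat_vec_scale)
qed

lemma D_bc_scale: "(f, g) \<in> D_bc Q C \<Longrightarrow> (cscale c f, cscale c g) \<in> D_bc Q C"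
  using linear_op_D_bc[of C] unfolding linear_op_def by blast

lemma D_min_subset_D_bc: "D_min Q \<subseteq> D_bc Q C"
  using D_min_subset_D_max rep_ac_D_min
  by (auto simp: D_bc_iff bounded_bilinear.zero_right[OF matrix_vector_bounded_bilinear])

text \<open>A Lagrangian boundary condition makes the boundary term of the Lagrange identity vanish; conversely,
  testing against cutoff solutions shows that the transpose can only contain elements satisfying it.\<close>

lemma j_selfadjoint_D_bc:
  assumes lag: "\<And>c. C *v c = 0 \<longleftrightarrow> (\<forall>d. C *v d = 0 \<longrightarrow> symp d c = 0)"
  shows "j_selfadjoint swap_conj (D_bc Q C)"
  unfolding j_selfadjoint_def conj_op_adj
proof (intro conjI linear_op_D_bc set_eqI iffI)
  have "Domain (D_min Q) \<subseteq> Domain (D_bc Q C)" using D_min_subset_D_bc by blast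
  then show "densely_defined (D_bc Q C)"
    using densely_defined_D_min closure_mono unfolding densely_defined_def by blast
  fix p
  {
    assume "p \<in> D_bc Q C"
    then obtain u v where p: "p = (u, v)" "(u, v) \<in> D_max Q" "C *v rep_ac u 0 = 0"
      by (cases p) (auto simp: D_bc_iff)
    have "bil g u = bil f v" if fg: "(f, g) \<in> D_bc Q C" for f g
    proof -
      have "(f, g) \<in> D_max Q" "C *v rep_ac f 0 = 0" using fg by (simp_all add: D_bc_iff)
      then show ?thesis using lagrange_D_max[OF _ p(2), of f g] iffD1[OF lag p(3)] by simp
    qed
    then show "p \<in> transpose_op (D_bc Q C)" unfolding p(1) transpose_op_iff by blast
  next
    assume "p \<in> transpose_op (D_bc Q C)"
    then obtain u v where p: "p = (u, v)" "(u, v) \<in> transpose_op (D_bc Q C)" by (cases p) auto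
    have uv: "(u, v) \<in> D_max Q"
      using p(2) transpose_op_antimono[OF D_min_subset_D_bc] unfolding transpose_D_min[symmetric] by blast
    have "symp d (rep_ac u 0) = 0" if d: "C *v d = 0" for d
    proof -
      have "(cut_u d, cut_v d) \<in> D_bc Q C" by (simp add: D_bc_iff cut_D_max rep_ac_cut d)
      then have "bil (cut_v d) u = bil (cut_u d) v" using p(2) unfolding transpose_op_iff by blast
      then show ?thesis using lagrange_D_max[OF cut_D_max[of d] uv] by (simp add: rep_ac_cut)
    qed
    then have "C *v rep_ac u 0 = 0" using lag by blast
    then show "p \<in> D_bc Q C" by (simp add: p(1) D_bc_iff uv)
  }
qed

text \<open>The range of \<open>D_min Q - z\<close> is the annihilator of the eigenspace, so a right-hand side becomes solvable
  after subtracting a cutoff solution whose initial value \<open>- W b\<close> is dual to the initial values of the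
  eigenspace; this initial value satisfies the boundary condition, because \<open>C W = 0\<close>.\<close>

lemma rho_hat_subset_resolvent_set:
  fixes \<Phi> W :: "complex^'p^('p + 'p)" and C :: "complex^('p + 'p)^'p"
  assumes z: "z \<in> rho_hat (D_min Q)"
    and \<Phi>: "bdry z = range ((*v) \<Phi>)" and C\<Phi>: "\<And>x. C *v (\<Phi> *v x) = x" and CW: "\<And>x. C *v (W *v x) = 0"
    and dual: "\<And>x y. symp (W *v x) (\<Phi> *v y) = (\<Sum>k\<in>UNIV. x $ k * y $ k)"
  shows "z \<in> resolvent_set (D_bc Q C)"
proof -
  obtain \<phi> where \<phi>: "\<And>\<psi> y. \<psi> \<in> eig z \<Longrightarrow> rep_ac \<psi> 0 = \<Phi> *v y \<Longrightarrow> \<psi> = (\<Sum>k\<in>UNIV. cscale (y $ k) (\<phi> k))"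
  proof (rule eig_basis[OF \<Phi>])
    fix \<phi> assume "\<And>\<psi> y. \<psi> \<in> eig z \<Longrightarrow> rep_ac \<psi> 0 = \<Phi> *v y \<Longrightarrow> \<psi> = (\<Sum>k\<in>UNIV. cscale (y $ k) (\<phi> k))"
    then show thesis by (rule that)
  qed
  have frame: "\<exists>y. rep_ac \<psi> 0 = \<Phi> *v y" if "\<psi> \<in> eig z" for \<psi>
  proof -
    have "rep_ac \<psi> 0 \<in> range ((*v) \<Phi>)" using that unfolding \<Phi>[symmetric] bdry_def by blast
    then show ?thesis by blast
  qed
  define b where "b g = (\<chi> k. bil g (\<phi> k))" for g
  define c where "c g = - (W *v b g)" for g
  obtain \<epsilon> where \<epsilon>: "\<epsilon> > 0" "\<And>u v. (u, v) \<in> D_min Q \<Longrightarrow> \<epsilon> * norm u \<le> norm (v - cscale z u)"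
    using z unfolding rho_hat_def by fastforce
  obtain KW where KW: "0 \<le> KW" "\<And>x. norm (W *v x) \<le> norm x * KW"
    using bounded_linear.nonneg_bounded[OF bounded_linear_matrix_vector] by blast
  obtain Ku where Ku: "0 \<le> Ku" "\<And>x. norm (cut_u x) \<le> norm x * Ku"
    using bounded_linear.nonneg_bounded[OF cut_bounded_linear(1)] by blast
  obtain Kv where Kv: "0 \<le> Kv" "\<And>x. norm (cut_v x) \<le> norm x * Kv"
    using bounded_linear.nonneg_bounded[OF cut_bounded_linear(2)] by blast
  define L where "L = (\<Sum>k\<in>UNIV. norm (\<phi> k)) * KW"
  have c_bound: "norm (c g) \<le> norm g * L" for g
  proof -
    have "norm (b g) \<le> (\<Sum>k\<in>UNIV. cmod (b g $ k))" by (rule norm_le_sum_components)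
    also have "\<dots> \<le> (\<Sum>k\<in>UNIV. norm g * norm (\<phi> k))" by (intro sum_mono) (simp add: b_def bil_bound)
    finally have "norm (b g) \<le> norm g * (\<Sum>k\<in>UNIV. norm (\<phi> k))" by (simp add: sum_distrib_left)
    from mult_right_mono[OF this KW(1)] show ?thesis
      using KW(2)[of "b g"] unfolding c_def L_def by (simp add: mult_ac)
  qed
  let ?K = "L * Ku + (1 + L * Kv + cmod z * (L * Ku)) / \<epsilon>"
  show ?thesis
  proof (rule resolvent_setI[OF linear_op_D_bc, where K = ?K])
    fix f g assume fg: "(f, g) \<in> D_bc Q C" "g = cscale z f"
    then have f: "f \<in> eig z" "C *v rep_ac f 0 = 0" by (simp_all add: D_bc_iff eig_def)
    obtain y where y: "rep_ac f 0 = \<Phi> *v y" using frame[OF f(1)] by blast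
    then have "y = 0" using f(2) C\<Phi> by simp
    then show "f = 0" using eig_zero[OF f(1)] y by (simp add: bounded_bilinear.zero_right[OF matrix_vector_bounded_bilinear])
  next
    fix h
    let ?d = "cut_v (c h) - cscale z (cut_u (c h))"
    have ann: "bil (h - ?d) \<psi> = 0" if \<psi>': "(\<psi>, cscale z \<psi>) \<in> D_max Q" for \<psi>
    proof -
      have \<psi>: "\<psi> \<in> eig z" using \<psi>' by (simp add: eig_def)
      obtain y where y: "rep_ac \<psi> 0 = \<Phi> *v y" using frame[OF \<psi>] by blast
      have "bil ?d \<psi> = - symp (c h) (\<Phi> *v y)"
        using lagrange_D_max[OF cut_D_max[of "c h"] \<psi>'] by (simp add: rep_ac_cut y bil_diff_left bil_scale_left bil_scale_right)
      also have "\<dots> = (\<Sum>k\<in>UNIV. b h $ k * y $ k)"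
        unfolding c_def dual[symmetric] by (simp add: bounded_bilinear.minus_left[OF symp_bounded_bilinear])
      also have "\<dots> = (\<Sum>k\<in>UNIV. bil h (cscale (y $ k) (\<phi> k)))"
        by (simp add: b_def bil_scale_right mult.commute)
      also have "\<dots> = bil h (\<Sum>k\<in>UNIV. cscale (y $ k) (\<phi> k))"
        by (rule bounded_bilinear.sum_right[OF bil_bounded_bilinear, symmetric])
      also have "\<dots> = bil h \<psi>" using \<phi>[OF \<psi> y] by simp
      finally show ?thesis by (simp add: bil_diff_left)
    qed
    obtain u v where uv: "(u, v) \<in> D_min Q" "h - ?d = v - cscale z u"
      using range_D_min[OF z ann] by metis
    have uv': "(u, v) \<in> D_max Q" using uv(1) D_min_subset_D_max by blast
    have "rep_ac (cut_u (c h) + u) 0 = c h"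
      using rep_ac_D_max_add[OF cut_D_max[of "c h"] uv' order_refl] by (simp add: rep_ac_cut rep_ac_D_min[OF uv(1)])
    then have bc: "C *v rep_ac (cut_u (c h) + u) 0 = 0"
      by (simp add: c_def bounded_bilinear.minus_right[OF matrix_vector_bounded_bilinear] CW)
    have mem: "(cut_u (c h) + u, cut_v (c h) + v) \<in> D_bc Q C"
      using bc D_max_add[OF cut_D_max[of "c h"] uv'] by (simp add: D_bc_iff)
    have eq: "h = cut_v (c h) + v - cscale z (cut_u (c h) + u)"
      using uv(2) by (simp add: l2.scale_right_distrib algebra_simps)
    have nu: "norm (cut_u (c h)) \<le> norm h * (L * Ku)"
      using Ku(2)[of "c h"] mult_right_mono[OF c_bound[of h] Ku(1)] by (simp add: mult_ac)
    have nv: "norm (cut_v (c h)) \<le> norm h * (L * Kv)"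
      using Kv(2)[of "c h"] mult_right_mono[OF c_bound[of h] Kv(1)] by (simp add: mult_ac)
    have "norm ?d \<le> norm (cut_v (c h)) + cmod z * norm (cut_u (c h))"
      using norm_triangle_ineq4[of "cut_v (c h)" "cscale z (cut_u (c h))"] by (simp add: norm_cscale)
    moreover have "cmod z * norm (cut_u (c h)) \<le> cmod z * (norm h * (L * Ku))"
      by (intro mult_left_mono nu) simp
    ultimately have "norm (h - ?d) \<le> norm h * (1 + L * Kv + cmod z * (L * Ku))"
      using norm_triangle_ineq4[of h ?d] nv by (simp add: algebra_simps)
    then have "\<epsilon> * norm u \<le> norm h * (1 + L * Kv + cmod z * (L * Ku))"
      using \<epsilon>(2)[OF uv(1)] unfolding uv(2) by linarith
    then have "norm u \<le> norm h * ((1 + L * Kv + cmod z * (L * Ku)) / \<epsilon>)"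
      using \<epsilon>(1) by (simp add: field_simps)
    then have "norm (cut_u (c h) + u) \<le> norm h * (L * Ku) + norm h * ((1 + L * Kv + cmod z * (L * Ku)) / \<epsilon>)"
      using nu norm_triangle_ineq[of "cut_u (c h)" u] by linarith
    then have "norm (cut_u (c h) + u) \<le> ?K * norm h" by (simp add: algebra_simps)
    with mem eq show "\<exists>f g. (f, g) \<in> D_bc Q C \<and> h = g - cscale z f \<and> norm f \<le> ?K * norm h" by blast
  qed
qed

end

section \<open>Weyl solutions\<close>

text \<open>The matrix whose column with index \<open>k\<close> is \<open>v\<close> and whose other columns are zero; sums of such matrices
  assemble a matrix-valued solution from vector-valued ones.\<close>

definition col_mat :: "'p \<Rightarrow> complex^'m \<Rightarrow> complex^('p::finite)^'m" where
  "col_mat k v = (\<chi> i l. if l = k then v $ i else 0)"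

lemma col_mat_bounded_linear: "bounded_linear (col_mat k :: complex^'m \<Rightarrow> complex^('p::finite)^'m)"
  by (rule linear_conv_bounded_linear[THEN iffD1], rule linearI) (auto simp: vec_eq_iff col_mat_def)

lemma mult_col_mat: "M ** col_mat k v = col_mat k (M *v v)"
  by (auto simp: vec_eq_iff col_mat_def matrix_matrix_mult_def matrix_vector_mult_def)

lemma mult_sum_col_mat: "M ** (\<Sum>k\<in>A. col_mat k (f k)) = (\<Sum>k\<in>A. col_mat k (M *v f k))"
  by (simp add: bounded_bilinear.sum_right[OF matrix_matrix_bounded_bilinear] mult_col_mat)

lemma sum_col_mat_nth: "(\<Sum>k\<in>UNIV. col_mat k (f k)) $ i $ l = f l $ i"
  by (simp add: sum_component col_mat_def)

lemma sum_col_mat_axis: "(\<Sum>k\<in>UNIV. col_mat k (axis k 1)) = (mat 1 :: complex^('p::finite)^'p)"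
  by (simp only: vec_eq_iff sum_col_mat_nth) (simp add: mat_def axis_def)

lemma AC_loc_sum:
  fixes F :: "'i \<Rightarrow> real \<Rightarrow> 'b::euclidean_space"
  assumes "\<And>k. AC_loc (F k)"
  shows "AC_loc (\<lambda>t. \<Sum>k\<in>A. F k t)"
  by (induction A rule: infinite_finite_induct) (simp_all add: AC_loc_const AC_loc_add assms)

lemma square_integrable_sum:
  assumes "\<And>k. square_integrable (F k)"
  shows "square_integrable (\<lambda>t. \<Sum>k\<in>A. F k t)"
  by (induction A rule: infinite_finite_induct) (simp_all add: square_integrable_0 square_integrable_add assms)

context dirac
begin

text \<open>The chosen representative agrees with any solution in the class only for nonnegative arguments; this
  suffices to transfer derivatives at positive points.\<close>

lemma eig_rep_ac:
  assumes "\<phi> \<in> eig z"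
  shows "solution (rep_ac \<phi>) (\<lambda>t. z *s rep_ac \<phi> t)" "square_integrable (rep_ac \<phi>)"
proof -
  obtain y where y: "solution y (\<lambda>t. z *s y t)" "square_integrable y" "\<phi> = l2_class y" using eigE[OF assms] .
  have eq: "rep_ac \<phi> t = y t" if t: "0 \<le> t" for t
    unfolding y(3) by (rule rep_ac_class[OF solution_AC[OF y(1)] y(2) t])
  show "square_integrable (rep_ac \<phi>)"
    by (rule square_integrable_cong_AE[OF y(2)]) (intro AE_I2, simp add: eq)
  have "AE t in halfline. (y has_vector_derivative J_mat *v (Q t *v y t - z *s y t)) (at t)"
    using y(1) unfolding solution_def by blast
  then have "AE t in halfline. (rep_ac \<phi> has_vector_derivative J_mat *v (Q t *v rep_ac \<phi> t - z *s rep_ac \<phi> t)) (at t)"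
    unfolding AE_halfline_iff
  proof eventually_elim
    case (elim t)
    show ?case
    proof
      assume t: "0 < t"
      then have "(y has_vector_derivative J_mat *v (Q t *v y t - z *s y t)) (at t)" using elim by blast
      then have "(rep_ac \<phi> has_vector_derivative J_mat *v (Q t *v y t - z *s y t)) (at t)"
        by (rule has_vector_derivative_transform_within_open[where S = "{0<..}"]) (use t eq in auto)
      then show "(rep_ac \<phi> has_vector_derivative J_mat *v (Q t *v rep_ac \<phi> t - z *s rep_ac \<phi> t)) (at t)"
        using t by (simp add: eq)
    qed
  qed
  moreover have "AC_loc (rep_ac \<phi>)" by (rule AC_loc_cong[OF solution_AC[OF y(1)]]) (simp add: eq)
  ultimately show "solution (rep_ac \<phi>) (\<lambda>t. z *s rep_ac \<phi> t)" unfolding solution_def by blast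
qed

definition resolvent :: "complex^('p + 'p)^'p \<Rightarrow> complex \<Rightarrow> (complex^('p + 'p)) l2 \<Rightarrow> (complex^('p + 'p)) l2" where
  "resolvent C z = (SOME R. bounded_linear R \<and> (\<forall>h. (R h, h + cscale z (R h)) \<in> D_bc Q C) \<and>
     (\<forall>f g. (f, g) \<in> D_bc Q C \<longrightarrow> R (g - cscale z f) = f))"

lemma
  assumes "z \<in> resolvent_set (D_bc Q C)"
  shows resolvent_bounded_linear: "bounded_linear (resolvent C z)"
    and resolvent_D_bc: "(resolvent C z h, h + cscale z (resolvent C z h)) \<in> D_bc Q C"
    and resolvent_inverse: "(f, g) \<in> D_bc Q C \<Longrightarrow> resolvent C z (g - cscale z f) = f"
proof -
  let ?P = "\<lambda>R. bounded_linear R \<and> (\<forall>h. (R h, h + cscale z (R h)) \<in> D_bc Q C) \<and>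
     (\<forall>f g. (f, g) \<in> D_bc Q C \<longrightarrow> R (g - cscale z f) = f)"
  have "\<exists>R. ?P R" using resolvent_setE[OF assms] by metis
  then have "?P (resolvent C z)" unfolding resolvent_def by (rule someI_ex)
  then show "bounded_linear (resolvent C z)" "(resolvent C z h, h + cscale z (resolvent C z h)) \<in> D_bc Q C"
    "(f, g) \<in> D_bc Q C \<Longrightarrow> resolvent C z (g - cscale z f) = f" by blast+
qed

lemma resolvent_D_max:
  assumes "z \<in> resolvent_set (D_bc Q C)"
  shows "(resolvent C z h, h + cscale z (resolvent C z h)) \<in> D_max Q" "C *v rep_ac (resolvent C z h) 0 = 0"
  using resolvent_D_bc[OF assms, of h] by (simp_all add: D_bc_iff)

lemma resolvent_cscale:
  assumes z: "z \<in> resolvent_set (D_bc Q C)"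
  shows "resolvent C z (cscale c h) = cscale c (resolvent C z h)"
proof -
  have "cscale c h = cscale c (h + cscale z (resolvent C z h)) - cscale z (cscale c (resolvent C z h))"
    by (simp add: l2.scale_right_distrib mult.commute)
  then show ?thesis using resolvent_inverse[OF z D_bc_scale[OF resolvent_D_bc[OF z, of h], of c]] by simp
qed

lemma resolvent_identity:
  assumes z: "z \<in> resolvent_set (D_bc Q C)" and w: "w \<in> resolvent_set (D_bc Q C)"
  shows "resolvent C w h - resolvent C z h = cscale (w - z) (resolvent C w (resolvent C z h))"
proof -
  let ?f = "resolvent C z h"
  have "?f = resolvent C w (h + cscale z ?f - cscale w ?f)"
    using resolvent_inverse[OF w resolvent_D_bc[OF z, of h]] by simp
  also have "h + cscale z ?f - cscale w ?f = h - cscale (w - z) ?f"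
    by (simp add: l2.scale_left_diff_distrib)
  also have "resolvent C w \<dots> = resolvent C w h - cscale (w - z) (resolvent C w ?f)"
    using bounded_linear.linear[OF resolvent_bounded_linear[OF w]] by (simp add: linear_diff resolvent_cscale[OF w])
  finally show ?thesis by (simp add: algebra_simps)
qed

text \<open>For \<open>|w - z| K \<le> 1/2\<close>, with \<open>K\<close> a bound of the resolvent at \<open>z\<close>, the resolvent identity bounds the
  resolvent at \<open>w\<close> by \<open>2 K\<close>; a second use of the identity then gives continuity.\<close>

lemma resolvent_tendsto:
  assumes z: "z \<in> resolvent_set (D_bc Q C)"
  shows "((\<lambda>w. resolvent C w h) \<longlongrightarrow> resolvent C z h) (at z within resolvent_set (D_bc Q C))"
proof -
  let ?S = "resolvent_set (D_bc Q C)" and ?R = "resolvent C"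
  obtain K where K: "0 < K" "\<And>q. norm (?R z q) \<le> norm q * K"
    using bounded_linear.pos_bounded[OF resolvent_bounded_linear[OF z]] by blast
  have bound: "norm (?R w q) \<le> 2 * K * norm q" if w: "w \<in> ?S" and d: "cmod (w - z) * K \<le> 1 / 2" for w q
  proof -
    have "?R w q = ?R z q + cscale (w - z) (?R z (?R w q))"
      using resolvent_identity[OF w z, of q] l2.scale_minus_left[of "w - z" "?R z (?R w q)"] by (simp add: algebra_simps)
    then have "norm (?R w q) \<le> norm (?R z q) + cmod (w - z) * norm (?R z (?R w q))"
      using norm_triangle_ineq[of "?R z q" "cscale (w - z) (?R z (?R w q))"] by (simp add: norm_cscale)
    moreover have "cmod (w - z) * norm (?R z (?R w q)) \<le> cmod (w - z) * (norm (?R w q) * K)"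
      by (intro mult_left_mono K(2)) simp
    moreover have "cmod (w - z) * (norm (?R w q) * K) \<le> 1 / 2 * norm (?R w q)"
      using mult_right_mono[OF d norm_ge_zero[of "?R w q"]] by (simp add: mult_ac)
    ultimately have "norm (?R w q) \<le> 2 * norm (?R z q)" by linarith
    then show ?thesis using K(2)[of q] by (simp add: mult_ac)
  qed
  have near: "\<forall>\<^sub>F w in at z within ?S. w \<in> ?S \<and> dist w z < 1 / (2 * K)"
    unfolding eventually_at using K(1) by (intro exI[of _ "1 / (2 * K)"]) auto
  then have "\<forall>\<^sub>F w in at z within ?S. norm (?R w h - ?R z h) \<le> cmod (w - z) * (2 * K * norm (?R z h))"
  proof eventually_elim
    case (elim w)
    then have "cmod (w - z) * K \<le> 1 / 2" using K(1) by (simp add: dist_norm field_simps)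
    then have "norm (?R w (?R z h)) \<le> 2 * K * norm (?R z h)" using elim by (intro bound) auto
    then show ?case using elim by (simp add: resolvent_identity[OF z] norm_cscale mult_left_mono)
  qed
  moreover have "((\<lambda>w. cmod (w - z) * (2 * K * norm (?R z h))) \<longlongrightarrow> 0) (at z within ?S)"
    by (auto intro!: tendsto_eq_intros)
  ultimately have "((\<lambda>w. ?R w h - ?R z h) \<longlongrightarrow> 0) (at z within ?S)" by (rule Lim_null_comparison)
  then show ?thesis by (rule Lim_null[THEN iffD2])
qed

text \<open>Here \<open>\<Phi>\<close> is a right inverse of \<open>C\<close>, so the cutoff solution with initial value \<open>\<Phi> x\<close> has boundary
  data \<open>x\<close>. The resolvent corrects it to a square integrable eigenfunction without changing these data,
  because the range of the resolvent satisfies the boundary condition.\<close>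

definition weyl_elt :: "complex^('p + 'p)^'p \<Rightarrow> complex^'p^('p + 'p) \<Rightarrow> complex \<Rightarrow> complex^'p \<Rightarrow> (complex^('p + 'p)) l2" where
  "weyl_elt C \<Phi> z x = cut_u (\<Phi> *v x) - resolvent C z (cut_v (\<Phi> *v x) - cscale z (cut_u (\<Phi> *v x)))"

lemma weyl_elt:
  assumes z: "z \<in> resolvent_set (D_bc Q C)" and C\<Phi>: "\<And>x. C *v (\<Phi> *v x) = x"
  shows "weyl_elt C \<Phi> z x \<in> eig z" "C *v rep_ac (weyl_elt C \<Phi> z x) 0 = x"
proof -
  let ?c = "\<Phi> *v x"
  let ?h = "cut_v ?c - cscale z (cut_u ?c)"
  let ?r = "resolvent C z ?h"
  note r = resolvent_D_max[OF z, of ?h]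
  have "cut_v ?c - (?h + cscale z ?r) = cscale z (cut_u ?c - ?r)" by (simp add: l2.scale_right_diff_distrib)
  then show "weyl_elt C \<Phi> z x \<in> eig z"
    using D_max_diff[OF cut_D_max[of ?c] r(1)] unfolding weyl_elt_def eig_def by simp
  have "rep_ac (weyl_elt C \<Phi> z x) 0 = ?c - rep_ac ?r 0"
    unfolding weyl_elt_def using rep_ac_D_max_diff[OF cut_D_max[of ?c] r(1) order_refl] by (simp add: rep_ac_cut)
  then show "C *v rep_ac (weyl_elt C \<Phi> z x) 0 = x"
    by (simp add: bounded_bilinear.diff_right[OF matrix_vector_bounded_bilinear] C\<Phi> r(2))
qed

text \<open>The difference of two candidates is an eigenvector of the operator with boundary condition, but \<open>z\<close> is in
  its resolvent set.\<close>

lemma weyl_elt_unique: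
  assumes z: "z \<in> resolvent_set (D_bc Q C)" and C\<Phi>: "\<And>x. C *v (\<Phi> *v x) = x"
    and \<psi>: "\<psi> \<in> eig z" "C *v rep_ac \<psi> 0 = x"
  shows "\<psi> = weyl_elt C \<Phi> z x"
proof -
  let ?\<delta> = "\<psi> - weyl_elt C \<Phi> z x"
  note F = weyl_elt[OF z C\<Phi>, of x]
  have "?\<delta> \<in> eig z" by (rule eig_diff[OF \<psi>(1) F(1)])
  moreover have "C *v rep_ac ?\<delta> 0 = 0"
    using rep_ac_D_max_diff[OF eigD[OF \<psi>(1)] eigD[OF F(1)] order_refl] \<psi>(2) F(2)
    by (simp add: bounded_bilinear.diff_right[OF matrix_vector_bounded_bilinear])
  ultimately have "(?\<delta>, cscale z ?\<delta>) \<in> D_bc Q C" by (simp add: D_bc_iff eigD)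
  from resolvent_inverse[OF z this] have "?\<delta> = 0"
    using bounded_linear.linear[OF resolvent_bounded_linear[OF z]] by (simp add: linear_0)
  then show ?thesis by simp
qed

text \<open>This difference formula is the source of all holomorphy statements: the difference quotients are values of
  the resolvent, which is continuous in \<open>w\<close>.\<close>

lemma weyl_elt_diff:
  assumes z: "z \<in> resolvent_set (D_bc Q C)" and w: "w \<in> resolvent_set (D_bc Q C)"
    and C\<Phi>: "\<And>x. C *v (\<Phi> *v x) = x"
  shows "weyl_elt C \<Phi> w x - weyl_elt C \<Phi> z x = cscale (w - z) (resolvent C w (weyl_elt C \<Phi> z x))"
proof -
  let ?\<psi> = "weyl_elt C \<Phi> z x"
  let ?r = "resolvent C w ?\<psi>"
  note F = weyl_elt[OF z C\<Phi>, of x] and r = resolvent_D_max[OF w, of ?\<psi>]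
  note s = D_max_scale[OF r(1), of "w - z"]
  have eq: "cscale z ?\<psi> + cscale (w - z) (?\<psi> + cscale w ?r) = cscale w (?\<psi> + cscale (w - z) ?r)"
    by (simp add: l2.scale_right_distrib l2.scale_left_diff_distrib l2.scale_right_diff_distrib right_diff_distrib mult.commute)
  have "?\<psi> + cscale (w - z) ?r \<in> eig w"
    using D_max_add[OF eigD[OF F(1)] s] unfolding eq by (simp add: eig_def)
  moreover have "C *v rep_ac (?\<psi> + cscale (w - z) ?r) 0 = x"
    unfolding rep_ac_D_max_add[OF eigD[OF F(1)] s order_refl] rep_ac_D_max_scale[OF r(1) order_refl]
      bounded_bilinear.add_right[OF matrix_vector_bounded_bilinear] mat_vec_scale F(2) r(2) by simp
  ultimately have "?\<psi> + cscale (w - z) ?r = weyl_elt C \<Phi> w x" by (rule weyl_elt_unique[OF w C\<Phi>])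
  then show ?thesis by (simp add: algebra_simps)
qed

definition weyl_mat :: "complex^('p + 'p)^'p \<Rightarrow> complex^'p^('p + 'p) \<Rightarrow> complex \<Rightarrow> real \<Rightarrow> complex^'p^('p + 'p)" where
  "weyl_mat C \<Phi> z t = (\<Sum>k\<in>UNIV. col_mat k (rep_ac (weyl_elt C \<Phi> z (axis k 1)) t))"

lemma weyl_solution_weyl_mat:
  assumes z: "z \<in> resolvent_set (D_bc Q C)" and C\<Phi>: "\<And>x. C *v (\<Phi> *v x) = x"
  shows "weyl_solution Q C z (weyl_mat C \<Phi> z)"
proof -
  let ?y = "\<lambda>k. rep_ac (weyl_elt C \<Phi> z (axis k 1))"
  note F = weyl_elt[OF z C\<Phi>] and y = eig_rep_ac[OF weyl_elt(1)[OF z C\<Phi>]]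
  have AC: "AC_loc (weyl_mat C \<Phi> z)"
    unfolding weyl_mat_def[abs_def] by (intro AC_loc_sum AC_loc_linear[OF col_mat_bounded_linear] solution_AC[OF y(1)])
  have sq: "square_integrable (weyl_mat C \<Phi> z)"
    unfolding weyl_mat_def[abs_def]
    by (intro square_integrable_sum square_integrable_bounded_linear[OF col_mat_bounded_linear] y(2))
  have "AE t in halfline. \<forall>k\<in>UNIV. (?y k has_vector_derivative J_mat *v (Q t *v ?y k t - z *s ?y k t)) (at t)"
    by (rule AE_finite_allI[OF finite]) (use y(1) in \<open>simp add: solution_def\<close>)
  then have ode: "AE t in halfline. J_mat ** vector_derivative (weyl_mat C \<Phi> z) (at t) + Q t ** weyl_mat C \<Phi> z t = mat z ** weyl_mat C \<Phi> z t"
  proof eventually_elim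
    case (elim t)
    let ?e = "\<lambda>k. J_mat *v (Q t *v ?y k t - z *s ?y k t)"
    have "(weyl_mat C \<Phi> z has_vector_derivative (\<Sum>k\<in>UNIV. col_mat k (?e k))) (at t)"
      unfolding weyl_mat_def[abs_def]
      by (intro has_vector_derivative_sum bounded_linear.has_vector_derivative[OF col_mat_bounded_linear] elim[rule_format] UNIV_I)
    then have d: "vector_derivative (weyl_mat C \<Phi> z) (at t) = (\<Sum>k\<in>UNIV. col_mat k (?e k))"
      by (rule vector_derivative_at)
    have "col_mat k (J_mat *v ?e k) + col_mat k (Q t *v ?y k t) = col_mat k (mat z *v ?y k t)" for k
      unfolding linear_add[OF bounded_linear.linear[OF col_mat_bounded_linear], symmetric] J_J mat_vec by simp
    then show ?case unfolding d unfolding weyl_mat_def mult_sum_col_mat sum.distrib[symmetric] by simp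
  qed
  have "C ** weyl_mat C \<Phi> z 0 = mat 1"
    unfolding weyl_mat_def mult_sum_col_mat F(2) by (rule sum_col_mat_axis)
  with AC sq ode show ?thesis unfolding weyl_solution_def by blast
qed

text \<open>Applied to a vector, a Weyl solution becomes the unique eigenfunction with these boundary data. This
  gives uniqueness of the Weyl solution and identifies its classes in \<open>L\<^sup>2\<close>.\<close>

lemma weyl_solution_class:
  assumes z: "z \<in> resolvent_set (D_bc Q C)" and C\<Phi>: "\<And>x. C *v (\<Phi> *v x) = x"
    and \<Psi>: "weyl_solution Q C z \<Psi>"
  shows "l2_class (\<lambda>t. \<Psi> t *v u) = weyl_elt C \<Phi> z u"
    and "0 \<le> t \<Longrightarrow> \<Psi> t *v u = rep_ac (weyl_elt C \<Phi> z u) t"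
proof -
  let ?y = "\<lambda>t. \<Psi> t *v u"
  note lin = bounded_bilinear.bounded_linear_left[OF matrix_vector_bounded_bilinear, of u]
  have AC: "AC_loc \<Psi>" and sq: "square_integrable \<Psi>" and C1: "C ** \<Psi> 0 = mat 1"
    and ode: "AE t in halfline. J_mat ** vector_derivative \<Psi> (at t) + Q t ** \<Psi> t = mat z ** \<Psi> t"
    using \<Psi> unfolding weyl_solution_def by blast+
  have ACy: "AC_loc ?y" by (rule AC_loc_linear[OF lin AC])
  have sqy: "square_integrable ?y" by (rule square_integrable_bounded_linear[OF lin sq])
  have "AE t in halfline. diff_expr Q ?y t = z *s ?y t"
    using ode AC_loc_derivative_AE[OF AC]
  proof eventually_elim
    case (elim t)
    have d: "vector_derivative ?y (at t) = vector_derivative \<Psi> (at t) *v u"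
      by (rule vector_derivative_at[OF bounded_linear.has_vector_derivative[OF lin elim(2)]])
    have "diff_expr Q ?y t = (J_mat ** vector_derivative \<Psi> (at t) + Q t ** \<Psi> t) *v u"
      unfolding diff_expr_def d
      by (simp add: bounded_bilinear.add_left[OF matrix_vector_bounded_bilinear] matrix_vector_mul_assoc)
    also have "\<dots> = z *s ?y t" unfolding elim(1) by (simp add: matrix_vector_mul_assoc[symmetric] mat_vec)
    finally show ?case .
  qed
  with ACy have sol: "solution ?y (\<lambda>t. z *s ?y t)" unfolding solution_iff by blast
  have "(l2_class ?y, l2_class (\<lambda>t. z *s ?y t)) \<in> D_max Q"
    by (rule D_maxI[OF sol sqy square_integrable_bounded_linear[OF bounded_linear_vec_scale sqy]])
  then have "l2_class ?y \<in> eig z" by (simp add: eig_def l2_class_cscale[OF sqy])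
  moreover have rep: "rep_ac (l2_class ?y) t = ?y t" if "0 \<le> t" for t by (rule rep_ac_class[OF ACy sqy that])
  have "C *v rep_ac (l2_class ?y) 0 = u"
    unfolding rep[OF order_refl] by (simp add: matrix_vector_mul_assoc C1)
  ultimately show eq: "l2_class ?y = weyl_elt C \<Phi> z u" by (rule weyl_elt_unique[OF z C\<Phi>])
  show "0 \<le> t \<Longrightarrow> \<Psi> t *v u = rep_ac (weyl_elt C \<Phi> z u) t" using rep unfolding eq by simp
qed

text \<open>Convergence of the resolvents holds in the graph norm of the maximal operator, for which point
  evaluation is continuous.\<close>

lemma tendsto_rep_ac_resolvent:
  assumes z: "z \<in> resolvent_set (D_bc Q C)" and t: "0 \<le> t"
  shows "((\<lambda>w. rep_ac (resolvent C w h) t) \<longlongrightarrow> rep_ac (resolvent C z h) t) (at z within resolvent_set (D_bc Q C))"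
proof -
  let ?S = "resolvent_set (D_bc Q C)" and ?R = "resolvent C"
  obtain M where M: "\<And>u v. (u, v) \<in> D_max Q \<Longrightarrow> norm (rep_ac u t) \<le> M * (norm u + norm v)"
    using evaluation_bound[OF t] by metis
  let ?v = "\<lambda>w. h + cscale w (?R w h)"
  have ev: "\<forall>\<^sub>F w in at z within ?S. norm (rep_ac (?R w h) t - rep_ac (?R z h) t) \<le> M * (norm (?R w h - ?R z h) + norm (?v w - ?v z))"
    unfolding eventually_at_filter
  proof (rule always_eventually, intro allI impI)
    fix w assume w: "w \<in> ?S"
    note wz = resolvent_D_max(1)[OF w, of h] resolvent_D_max(1)[OF z, of h]
    show "norm (rep_ac (?R w h) t - rep_ac (?R z h) t) \<le> M * (norm (?R w h - ?R z h) + norm (?v w - ?v z))"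
      using M[OF D_max_diff[OF wz]] unfolding rep_ac_D_max_diff[OF wz t] .
  qed
  have "((\<lambda>w. M * (norm (?R w h - ?R z h) + norm (?v w - ?v z))) \<longlongrightarrow> M * (norm (?R z h - ?R z h) + norm (?v z - ?v z))) (at z within ?S)"
    by (intro tendsto_intros resolvent_tendsto[OF z] bounded_bilinear.tendsto[OF cscale_bounded_bilinear])
  then have "((\<lambda>w. M * (norm (?R w h - ?R z h) + norm (?v w - ?v z))) \<longlongrightarrow> 0) (at z within ?S)"
    by (simp only: diff_self norm_zero add_0_left mult_zero_right)
  then have "((\<lambda>w. rep_ac (?R w h) t - rep_ac (?R z h) t) \<longlongrightarrow> 0) (at z within ?S)"
    by (rule Lim_null_comparison[OF ev])
  then show ?thesis by (rule Lim_null[THEN iffD2])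
qed

lemma weyl_solution_l2_holomorphic:
  assumes C\<Phi>: "\<And>x. C *v (\<Phi> *v x) = x" and \<Psi>: "\<And>z. z \<in> resolvent_set (D_bc Q C) \<Longrightarrow> weyl_solution Q C z (\<Psi> z)"
  shows "l2_holomorphic_on (\<lambda>z. l2_class (\<lambda>t. \<Psi> z t *v u)) (resolvent_set (D_bc Q C))"
  unfolding l2_holomorphic_on_def
proof
  let ?S = "resolvent_set (D_bc Q C)"
  fix z assume z: "z \<in> ?S"
  let ?F = "\<lambda>z. l2_class (\<lambda>t. \<Psi> z t *v u)" and ?f = "weyl_elt C \<Phi> z u"
  have "\<forall>\<^sub>F w in at z within ?S. resolvent C w ?f = cscale (inverse (w - z)) (?F w - ?F z)"
    unfolding eventually_at_filter
  proof (rule always_eventually, intro allI impI)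
    fix w assume w: "w \<noteq> z" "w \<in> ?S"
    have "?F w - ?F z = cscale (w - z) (resolvent C w ?f)"
      unfolding weyl_solution_class(1)[OF w(2) C\<Phi> \<Psi>[OF w(2)]] weyl_solution_class(1)[OF z C\<Phi> \<Psi>[OF z]]
      by (rule weyl_elt_diff[OF z w(2) C\<Phi>])
    then show "resolvent C w ?f = cscale (inverse (w - z)) (?F w - ?F z)" using w(1) by simp
  qed
  from Lim_transform_eventually[OF resolvent_tendsto[OF z, of ?f] this]
  show "\<exists>D. ((\<lambda>w. cscale (inverse (w - z)) (?F w - ?F z)) \<longlongrightarrow> D) (at z within ?S)" by blast
qed

lemma weyl_solution_holomorphic:
  assumes C\<Phi>: "\<And>x. C *v (\<Phi> *v x) = x" and t: "0 \<le> t"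
  shows "(\<lambda>z. weyl_mat C \<Phi> z t $ i $ k) holomorphic_on resolvent_set (D_bc Q C)"
  unfolding holomorphic_on_def field_differentiable_def has_field_derivative_iff
proof
  let ?S = "resolvent_set (D_bc Q C)"
  fix z assume z: "z \<in> ?S"
  let ?f = "\<lambda>z. weyl_elt C \<Phi> z (axis k 1)"
  let ?d = "\<lambda>w. (weyl_mat C \<Phi> w t $ i $ k - weyl_mat C \<Phi> z t $ i $ k) / (w - z)"
  have ev: "\<forall>\<^sub>F w in at z within ?S. rep_ac (resolvent C w (?f z)) t $ i = ?d w"
    unfolding eventually_at_filter
  proof (rule always_eventually, intro allI impI)
    fix w assume w: "w \<noteq> z" "w \<in> ?S"
    note e = eigD[OF weyl_elt(1)[OF w(2) C\<Phi>]] eigD[OF weyl_elt(1)[OF z C\<Phi>]]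
    have "rep_ac (?f w) t - rep_ac (?f z) t = rep_ac (?f w - ?f z) t"
      by (rule rep_ac_D_max_diff[OF e t, symmetric])
    also have "\<dots> = (w - z) *s rep_ac (resolvent C w (?f z)) t"
      unfolding weyl_elt_diff[OF z w(2) C\<Phi>] by (rule rep_ac_D_max_scale[OF resolvent_D_max(1)[OF w(2)] t])
    finally have diff: "rep_ac (?f w) t - rep_ac (?f z) t = (w - z) *s rep_ac (resolvent C w (?f z)) t" .
    have "rep_ac (?f w) t $ i - rep_ac (?f z) t $ i = (w - z) * rep_ac (resolvent C w (?f z)) t $ i"
      using arg_cong[OF diff, of "\<lambda>v. v $ i"] by (simp only: vector_minus_component vector_smult_component)
    then show "rep_ac (resolvent C w (?f z)) t $ i = ?d w"
      using w(1) unfolding weyl_mat_def sum_col_mat_nth by simp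
  qed
  from Lim_transform_eventually[OF tendsto_vec_nth[OF tendsto_rep_ac_resolvent[OF z t, of "?f z"]] ev]
  show "\<exists>D. (?d \<longlongrightarrow> D) (at z within ?S)" by blast
qed

end

section \<open>Defect numbers and the Weyl solution\<close>

theorem theorem4p7:
  fixes Q11 Q12 Q21 Q22 :: "real \<Rightarrow> complex^('p::finite)^'p"
    and Q :: "real \<Rightarrow> complex^('p + 'p)^('p + 'p)"
  assumes Q_blocks: "\<And>t. Q t = block_mat (Q11 t) (Q12 t) (Q21 t) (Q22 t)"
    and Q_loc: "locally_integrable Q"
    and Q11: "AE t in halfline. transpose (Q11 t) = Q22 t"
    and Q12: "AE t in halfline. transpose (Q12 t) = Q12 t"
    and Q21: "AE t in halfline. transpose (Q21 t) = Q21 t"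
    and rho_nonempty: "rho_hat (D_min Q) \<noteq> {}"
  shows
    "(j_symmetric swap_conj (D_min Q) \<and>
      Def_number (D_min Q) = CARD('p) \<and>
      rho_hat (D_min Q) = rho_hat_pair (D_min Q) (D_min (\<lambda>t. adj_mat (Q t))) \<and>
      (\<forall>z\<in>rho_hat (D_min Q).
         l2.dim (defect_space z (D_min (\<lambda>t. adj_mat (Q t)))) = CARD('p) \<and>
         l2.dim (defect_space (cnj z) (D_min Q)) = CARD('p)))
     \<and>
     (\<exists>C :: complex^('p + 'p)^'p.
        D_min Q \<subseteq> D_bc Q C \<and>
        j_selfadjoint swap_conj (D_bc Q C) \<and>
        resolvent_set (D_bc Q C) \<noteq> {} \<and>
        (\<exists>\<Psi> :: complex \<Rightarrow> real \<Rightarrow> complex^'p^('p + 'p).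
           (\<forall>z\<in>resolvent_set (D_bc Q C).
              weyl_solution Q C z (\<Psi> z) \<and>
              (\<forall>\<Phi>. weyl_solution Q C z \<Phi> \<longrightarrow> (\<forall>t\<ge>0. \<Phi> t = \<Psi> z t))) \<and>
           (\<forall>u. l2_holomorphic_on (\<lambda>z. l2_class (\<lambda>t. \<Psi> z t *v u)) (resolvent_set (D_bc Q C))) \<and>
           (\<forall>t\<ge>0. \<forall>i k. (\<lambda>z. \<Psi> z t $ i $ k) holomorphic_on resolvent_set (D_bc Q C))))"
proof -
  have "AE t in halfline. \<forall>u v. sdot (Q t *v u) v = sdot u (Q t *v v)"
    using Q11 Q12 Q21
  proof eventually_elim
    case (elim t)
    then show ?case unfolding Q_blocks by (intro allI sdot_block_mat_symmetric)
  qed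
  with Q_loc interpret dirac Q by (rule dirac.intro)
  have dims: "l2.dim (defect_space z (D_min (\<lambda>t. adj_mat (Q t)))) = CARD('p)"
    "l2.dim (defect_space (cnj z) (D_min Q)) = CARD('p)" if z: "z \<in> rho_hat (D_min Q)" for z
    unfolding defect_space_star defect_space_eq by (rule dim_eig[OF z])+
  have "Def_number (D_min Q) = CARD('p)"
    unfolding Def_number_def
  proof (rule the_equality)
    show "\<forall>z\<in>rho_hat (D_min Q). l2.dim (defect_space (cnj z) (D_min Q)) = CARD('p)" using dims(2) by blast
    show "d = CARD('p)" if "\<forall>z\<in>rho_hat (D_min Q). l2.dim (defect_space (cnj z) (D_min Q)) = d" for d
      using that dims(2) rho_nonempty by (metis ex_in_conv)
  qed
  moreover have "rho_hat (D_min Q) = rho_hat_pair (D_min Q) (D_min (\<lambda>t. adj_mat (Q t)))"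
    unfolding rho_hat_pair_def using rho_hat_D_min_star by blast
  ultimately have i: "j_symmetric swap_conj (D_min Q) \<and> Def_number (D_min Q) = CARD('p) \<and>
      rho_hat (D_min Q) = rho_hat_pair (D_min Q) (D_min (\<lambda>t. adj_mat (Q t))) \<and>
      (\<forall>z\<in>rho_hat (D_min Q).
         l2.dim (defect_space z (D_min (\<lambda>t. adj_mat (Q t)))) = CARD('p) \<and>
         l2.dim (defect_space (cnj z) (D_min Q)) = CARD('p))"
    using dims j_symmetric_D_min by blast
  obtain z0 where z0: "z0 \<in> rho_hat (D_min Q)" using rho_nonempty by blast
  obtain \<Phi> W :: "complex^'p^('p + 'p)" and C :: "complex^('p + 'p)^'p"
    where \<Phi>: "bdry z0 = range ((*v) \<Phi>)" and C\<Phi>: "\<And>x. C *v (\<Phi> *v x) = x" and CW: "\<And>x. C *v (W *v x) = 0"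
      and dual: "\<And>x y. symp (W *v x) (\<Phi> *v y) = (\<Sum>k\<in>UNIV. x $ k * y $ k)"
      and lag: "\<And>c. C *v c = 0 \<longleftrightarrow> (\<forall>d. C *v d = 0 \<longrightarrow> symp d c = 0)"
    by (rule lagrangian_boundary_matrix[OF subspace_bdry bdry_lagrangian[OF z0]]) metis
  note weyl = weyl_solution_weyl_mat[where \<Phi> = \<Phi> and C = C, OF _ C\<Phi>]
  have unique: "\<Psi> t = weyl_mat C \<Phi> z t"
    if z: "z \<in> resolvent_set (D_bc Q C)" and \<Psi>: "weyl_solution Q C z \<Psi>" and t: "0 \<le> t" for z \<Psi> t
    unfolding matrix_eq weyl_solution_class(2)[OF z C\<Phi> \<Psi> t] weyl_solution_class(2)[OF z C\<Phi> weyl[OF z] t] by blast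
  show ?thesis
  proof (intro conjI[OF i] exI[of _ C] exI[of _ "weyl_mat C \<Phi>"] conjI ballI allI impI)
    show "D_min Q \<subseteq> D_bc Q C" by (rule D_min_subset_D_bc)
    show "j_selfadjoint swap_conj (D_bc Q C)" by (rule j_selfadjoint_D_bc[OF lag])
    show "resolvent_set (D_bc Q C) \<noteq> {}"
      using rho_hat_subset_resolvent_set[OF z0 \<Phi> C\<Phi> CW dual] by blast
    show "weyl_solution Q C z (weyl_mat C \<Phi> z)" if "z \<in> resolvent_set (D_bc Q C)" for z by (rule weyl[OF that])
    show "\<Psi> t = weyl_mat C \<Phi> z t"
      if "z \<in> resolvent_set (D_bc Q C)" "weyl_solution Q C z \<Psi>" "0 \<le> t" for z \<Psi> t by (rule unique[OF that])
    show "l2_holomorphic_on (\<lambda>z. l2_class (\<lambda>t. weyl_mat C \<Phi> z t *v u)) (resolvent_set (D_bc Q C))" for u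
      by (rule weyl_solution_l2_holomorphic[OF C\<Phi> weyl])
    show "(\<lambda>z. weyl_mat C \<Phi> z t $ i $ k) holomorphic_on resolvent_set (D_bc Q C)" if "0 \<le> t" for t i k
      by (rule weyl_solution_holomorphic[OF C\<Phi> that])
  qed
qed


end
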